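(* Let $(X,X_0)$ and $(Y,Y_0)$ be conjugation pairs with $H^*$-frames $(\kappa_X,\sigma_X)$ and $(\kappa_Y,\sigma_Y)$ respectively, let $f\colon (Y,Y_0)\to (X,X_0)$ be a $C$-equivariant continuous map of pairs, and let $f^\tau\colon (Y^\tau,Y_0^\tau)\to (X^\tau,X_0^\tau)$ be its restriction to the fixed point sets. Then $$H^*_Cf\circ\sigma_X=\sigma_Y\circ H^*f\qquad\text{and}\qquad H^*f^\tau\circ\kappa_X=\kappa_Y\circ H^*f .$$
   Context: $H^*$ denotes singular cohomology with $\mathbb{Z}_2$-coefficients. An involution $\tau$ on a space $X$ is a continuous action of the group $C=\{1,\tau\}$ of order $2$; $X^\tau$ is its fixed point set. A subspace $Y\subset X$ is $\tau$-invariant if $\tau(Y)=Y$; $Y^\tau=Y\cap X^\tau$. Equivariant cohomology is defined by the Borel construction: $H^*_C(X,Y)=H^*(EC\times_C X,EC\times_C Y)$. Write $H^*(BC)=\mathbb{Z}_2[u]$ with $\deg u=1$; since $C$ acts trivially on $X^\tau$, the Künneth formula identifies $H^*_C(X^\tau,Y^\tau)$ with the polynomial ring $H^*(X^\tau,Y^\tau)[u]$. Let $\rho\colon H^{2*}_C(X,Y)\to H^{2*}(X,Y)$ and $r\colon H^*_C(X,Y)\to H^*_C(X^\tau,Y^\tau)$ be the restriction homomorphisms. An $H^*$-frame for $(X,Y)$ is a pair $(\kappa,\sigma)$ where $\kappa\colon H^{2*}(X,Y)\to H^*(X^\tau,Y^\tau)$ is an additive isomorphism dividing degrees in half, $\sigma\colon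 H^{2*}(X,Y)\to H^{2*}_C(X,Y)$ is an additive (degree-preserving) section of $\rho$, and for all $m\in\mathbb{N}$ and all $a\in H^{2m}(X,Y)$ the conjugation equation $r\circ\sigma(a)=\kappa(a)u^m+\ell t_m$ holds, where $\ell t_m$ denotes some polynomial in the variable $u$ (with coefficients in $H^*(X^\tau,Y^\tau)$) of degree less than $m$. An involution admitting an $H^*$-frame is called a conjugation. A conjugation pair is a pair $(X,Y)$ with $H^{odd}(X,Y)=0$ ($Y$ a $\tau$-invariant subspace of $X$) together with a conjugation. $H^*f$, $H^*_Cf$, $H^*f^\tau$ denote the homomorphisms induced by $f$ (resp. $f^\tau$) in cohomology and $C$-equivariant cohomology. *)

theory Defs
  imports "HOL-Homology.Homology" "HOL-Library.Z2"
begin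

section \<open>Singular cohomology of pairs with coefficients in the field with two elements\<close>

text \<open>
  A cochain of degree \<open>p\<close> on the pair \<open>(X,S)\<close> is a \<open>bit\<close>-valued function on the singular
  \<open>p\<close>-simplices of \<open>X\<close> that vanishes on those lying in \<open>S\<close>; it is made total by the value 0
  outside the singular simplices of \<open>X\<close>.
\<close>

type_synonym 'a cochain = "((nat \<Rightarrow> real) \<Rightarrow> 'a) \<Rightarrow> bit"

definition cochain_set :: "nat \<Rightarrow> 'a topology \<Rightarrow> 'a set \<Rightarrow> 'a cochain set" where
  "cochain_set p X S =
     {\<phi>. (\<forall>s. \<not> singular_simplex p X s \<longrightarrow> \<phi> s = 0) \<and>
         (\<forall>s. singular_simplex p (subtopology X S) s \<longrightarrow> \<phi> s = 0)}"

text \<open>The usual signs \<open>(-1)^k\<close> are trivial modulo 2.\<close>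

definition coboundary :: "nat \<Rightarrow> 'a topology \<Rightarrow> 'a cochain \<Rightarrow> 'a cochain" where
  "coboundary p X \<phi> =
     (\<lambda>s. if singular_simplex (Suc p) X s then \<Sum>k\<le>Suc p. \<phi> (singular_face (Suc p) k s) else 0)"

definition cocycle_set :: "nat \<Rightarrow> 'a topology \<Rightarrow> 'a set \<Rightarrow> 'a cochain set" where
  "cocycle_set p X S = {\<phi> \<in> cochain_set p X S. coboundary p X \<phi> = (\<lambda>s. 0)}"

definition coboundary_set :: "nat \<Rightarrow> 'a topology \<Rightarrow> 'a set \<Rightarrow> 'a cochain set" where
  "coboundary_set p X S =
     (case p of 0 \<Rightarrow> {\<lambda>s. 0} | Suc q \<Rightarrow> coboundary q X ` cochain_set q X S)"

definition cocycle_group :: "nat \<Rightarrow> 'a topology \<Rightarrow> 'a set \<Rightarrow> 'a cochain monoid" where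
  "cocycle_group p X S =
     \<lparr>carrier = cocycle_set p X S, mult = (\<lambda>\<phi> \<psi> s. \<phi> s + \<psi> s), one = (\<lambda>s. 0)\<rparr>"

definition cohomology_group :: "nat \<Rightarrow> 'a topology \<Rightarrow> 'a set \<Rightarrow> 'a cochain set monoid" where
  "cohomology_group p X S = cocycle_group p X S Mod coboundary_set p X S"

definition cohomology_class :: "nat \<Rightarrow> 'a topology \<Rightarrow> 'a set \<Rightarrow> 'a cochain \<Rightarrow> 'a cochain set" where
  "cohomology_class p X S \<phi> = coboundary_set p X S #>\<^bsub>cocycle_group p X S\<^esub> \<phi>"

definition cochain_pullback ::
  "nat \<Rightarrow> 'b topology \<Rightarrow> ('b \<Rightarrow> 'a) \<Rightarrow> 'a cochain \<Rightarrow> 'b cochain" where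
  "cochain_pullback p Y f \<phi> =
     (\<lambda>s. if singular_simplex p Y s then \<phi> (simplex_map p f s) else 0)"

text \<open>
  For a map of pairs \<open>f : (Y,T) \<rightarrow> (X,S)\<close>, \<open>cohomology_map p Y T f\<close> is the induced map from
  \<open>H^p(X,S)\<close> to \<open>H^p(Y,T)\<close>. The union is over the representatives of the given class, which all
  yield the same class; the same device is used for the cup product below.
\<close>

definition cohomology_map ::
  "nat \<Rightarrow> 'b topology \<Rightarrow> 'b set \<Rightarrow> ('b \<Rightarrow> 'a) \<Rightarrow> 'a cochain set \<Rightarrow> 'b cochain set" where
  "cohomology_map p Y T f a = (\<Union>\<phi>\<in>a. cohomology_class p Y T (cochain_pullback p Y f \<phi>))"

definition front_face :: "nat \<Rightarrow> ((nat \<Rightarrow> real) \<Rightarrow> 'a) \<Rightarrow> (nat \<Rightarrow> real) \<Rightarrow> 'a" where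
  "front_face p s = restrict s (standard_simplex p)"

definition back_face :: "nat \<Rightarrow> nat \<Rightarrow> ((nat \<Rightarrow> real) \<Rightarrow> 'a) \<Rightarrow> (nat \<Rightarrow> real) \<Rightarrow> 'a" where
  "back_face p q s = restrict (\<lambda>x. s (\<lambda>i. if i < p then 0 else x (i - p))) (standard_simplex q)"

definition cup_cochain ::
  "nat \<Rightarrow> nat \<Rightarrow> 'a topology \<Rightarrow> 'a cochain \<Rightarrow> 'a cochain \<Rightarrow> 'a cochain" where
  "cup_cochain p q X \<phi> \<psi> =
     (\<lambda>s. if singular_simplex (p + q) X s then \<phi> (front_face p s) * \<psi> (back_face p q s) else 0)"

text \<open>The cup product of \<open>H^p(X,S)\<close> with \<open>H^q(X)\<close>, with values in \<open>H^(p+q)(X,S)\<close>.\<close>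

definition cup ::
  "nat \<Rightarrow> nat \<Rightarrow> 'a topology \<Rightarrow> 'a set \<Rightarrow> 'a cochain set \<Rightarrow> 'a cochain set \<Rightarrow> 'a cochain set" where
  "cup p q X S a b = (\<Union>\<phi>\<in>a. \<Union>\<psi>\<in>b. cohomology_class (p + q) X S (cup_cochain p q X \<phi> \<psi>))"

definition cohomology_unit :: "'a topology \<Rightarrow> 'a cochain set" where
  "cohomology_unit X = cohomology_class 0 X {} (\<lambda>s. if singular_simplex 0 X s then 1 else 0)"

text \<open>Powers of a class of degree 1.\<close>

primrec cup_power :: "'a topology \<Rightarrow> 'a cochain set \<Rightarrow> nat \<Rightarrow> 'a cochain set" where
  "cup_power X v 0 = cohomology_unit X"
| "cup_power X v (Suc i) = cup i 1 X {} (cup_power X v i) v"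


section \<open>Involutions and the Borel construction\<close>

definition involution_on :: "'a topology \<Rightarrow> ('a \<Rightarrow> 'a) \<Rightarrow> bool" where
  "involution_on X \<tau> \<longleftrightarrow> continuous_map X X \<tau> \<and> (\<forall>x\<in>topspace X. \<tau> (\<tau> x) = x)"

definition fixed_set :: "'a topology \<Rightarrow> ('a \<Rightarrow> 'a) \<Rightarrow> 'a set" where
  "fixed_set X \<tau> = {x \<in> topspace X. \<tau> x = x}"

definition fixed_space :: "'a topology \<Rightarrow> ('a \<Rightarrow> 'a) \<Rightarrow> 'a topology" where
  "fixed_space X \<tau> = subtopology X (fixed_set X \<tau>)"

definition quotient_topology :: "'a topology \<Rightarrow> ('a \<Rightarrow> 'b) \<Rightarrow> 'b topology" where
  "quotient_topology X q =
     topology (\<lambda>U. U \<subseteq> q ` topspace X \<and> openin X {x \<in> topspace X. q x \<in> U})"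

lemma openin_quotient_topology:
  "openin (quotient_topology X q) U \<longleftrightarrow>
     U \<subseteq> q ` topspace X \<and> openin X {x \<in> topspace X. q x \<in> U}"
proof -
  let ?L = "\<lambda>U. U \<subseteq> q ` topspace X \<and> openin X {x \<in> topspace X. q x \<in> U}"
  have "?L (S \<inter> T)" if "?L S" "?L T" for S T
  proof -
    have "{x \<in> topspace X. q x \<in> S \<inter> T} =
        {x \<in> topspace X. q x \<in> S} \<inter> {x \<in> topspace X. q x \<in> T}" by auto
    then show ?thesis using that by auto
  qed
  moreover have "?L (\<Union>\<K>)" if "\<forall>K\<in>\<K>. ?L K" for \<K>
  proof -
    have "{x \<in> topspace X. q x \<in> \<Union>\<K>} = (\<Union>K\<in>\<K>. {x \<in> topspace X. q x \<in> K})" by auto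
    then show ?thesis using that by (auto intro!: openin_Union)
  qed
  ultimately have "istopology ?L"
    unfolding istopology_def by blast
  then show ?thesis
    by (simp add: quotient_topology_def)
qed

lemma topspace_quotient_topology [simp]: "topspace (quotient_topology X q) = q ` topspace X"
proof -
  have "{x \<in> topspace X. q x \<in> q ` topspace X} = topspace X" by auto
  then have "openin (quotient_topology X q) (q ` topspace X)"
    by (simp add: openin_quotient_topology)
  then show ?thesis
    by (meson openin_quotient_topology openin_subset openin_topspace subset_antisym)
qed

lemma quotient_map_quotient_topology: "quotient_map X (quotient_topology X q) q"
  unfolding quotient_map_def by (auto simp: openin_quotient_topology)

definition orbit :: "('a \<Rightarrow> 'a) \<Rightarrow> 'a \<Rightarrow> 'a set" where
  "orbit g x = {x, g x}"

definition orbit_space :: "'a topology \<Rightarrow> ('a \<Rightarrow> 'a) \<Rightarrow> 'a set topology" where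
  "orbit_space X g = quotient_topology X (orbit g)"

text \<open>
  The model of \<open>EC\<close> is the infinite-dimensional sphere, the union of the spheres \<open>nsphere n\<close> with
  the colimit (CW) topology, on which \<open>C\<close> acts by the antipodal map.
\<close>

definition EC :: "(nat \<Rightarrow> real) topology" where
  "EC = topology (\<lambda>U. U \<subseteq> (\<Union>n. topspace (nsphere n)) \<and>
                       (\<forall>n. openin (nsphere n) (U \<inter> topspace (nsphere n))))"

lemma openin_EC:
  "openin EC U \<longleftrightarrow> U \<subseteq> (\<Union>n. topspace (nsphere n)) \<and>
                     (\<forall>n. openin (nsphere n) (U \<inter> topspace (nsphere n)))"
proof -
  let ?L = "\<lambda>U. U \<subseteq> (\<Union>n. topspace (nsphere n)) \<and>
                 (\<forall>n. openin (nsphere n) (U \<inter> topspace (nsphere n)))"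
  have "?L (S \<inter> T)" if "?L S" "?L T" for S T
  proof -
    have "S \<inter> T \<inter> topspace (nsphere n) =
        (S \<inter> topspace (nsphere n)) \<inter> (T \<inter> topspace (nsphere n))" for n by auto
    then show ?thesis using that by (metis inf.coboundedI1 openin_Int)
  qed
  moreover have "?L (\<Union>\<K>)" if "\<forall>K\<in>\<K>. ?L K" for \<K>
  proof -
    have "openin (nsphere n) (\<Union>\<K> \<inter> topspace (nsphere n))" for n
    proof -
      have "\<Union>\<K> \<inter> topspace (nsphere n) = \<Union>((\<lambda>K. K \<inter> topspace (nsphere n)) ` \<K>)" by auto
      moreover have "openin (nsphere n) (\<Union>((\<lambda>K. K \<inter> topspace (nsphere n)) ` \<K>))"
        using that by (intro openin_Union) blast
      ultimately show ?thesis by simp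
    qed
    moreover have "\<Union>\<K> \<subseteq> (\<Union>n. topspace (nsphere n))" using that by blast
    ultimately show ?thesis by blast
  qed
  ultimately have "istopology ?L"
    unfolding istopology_def by blast
  then show ?thesis
    by (simp add: EC_def)
qed

definition antipode :: "(nat \<Rightarrow> real) \<Rightarrow> nat \<Rightarrow> real" where
  "antipode e = (\<lambda>i. - e i)"

definition BC :: "(nat \<Rightarrow> real) set topology" where
  "BC = orbit_space EC antipode"

definition borel_involution :: "('a \<Rightarrow> 'a) \<Rightarrow> (nat \<Rightarrow> real) \<times> 'a \<Rightarrow> (nat \<Rightarrow> real) \<times> 'a" where
  "borel_involution \<tau> = map_prod antipode \<tau>"

definition borel_space :: "'a topology \<Rightarrow> ('a \<Rightarrow> 'a) \<Rightarrow> ((nat \<Rightarrow> real) \<times> 'a) set topology" where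
  "borel_space X \<tau> = orbit_space (prod_topology EC X) (borel_involution \<tau>)"

text \<open>The part of the Borel construction lying over an invariant subset \<open>Y\<close>.\<close>

definition borel_subset :: "('a \<Rightarrow> 'a) \<Rightarrow> 'a set \<Rightarrow> ((nat \<Rightarrow> real) \<times> 'a) set set" where
  "borel_subset \<tau> Y = orbit (borel_involution \<tau>) ` (topspace EC \<times> Y)"

definition borel_map ::
  "('a \<Rightarrow> 'b) \<Rightarrow> ((nat \<Rightarrow> real) \<times> 'a) set \<Rightarrow> ((nat \<Rightarrow> real) \<times> 'b) set" where
  "borel_map f z = map_prod id f ` z"

definition equivariant_cohomology_group ::
  "nat \<Rightarrow> 'a topology \<Rightarrow> ('a \<Rightarrow> 'a) \<Rightarrow> 'a set \<Rightarrow> ((nat \<Rightarrow> real) \<times> 'a) set cochain set monoid" where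
  "equivariant_cohomology_group p X \<tau> Y =
     cohomology_group p (borel_space X \<tau>) (borel_subset \<tau> Y)"

text \<open>
  The map in equivariant cohomology induced by an equivariant map \<open>f : (Y,T) \<rightarrow> (X,S)\<close>, where
  \<open>\<tau>\<close> is the involution on \<open>Y\<close>.
\<close>

definition equivariant_cohomology_map ::
  "nat \<Rightarrow> 'b topology \<Rightarrow> ('b \<Rightarrow> 'b) \<Rightarrow> 'b set \<Rightarrow> ('b \<Rightarrow> 'a) \<Rightarrow>
     ((nat \<Rightarrow> real) \<times> 'a) set cochain set \<Rightarrow> ((nat \<Rightarrow> real) \<times> 'b) set cochain set" where
  "equivariant_cohomology_map p Y \<tau> T f =
     cohomology_map p (borel_space Y \<tau>) (borel_subset \<tau> T) (borel_map f)"

definition EC_basepoint :: "nat \<Rightarrow> real" where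
  "EC_basepoint = (\<lambda>i. if i = 0 then 1 else 0)"

text \<open>
  \<open>\<rho>\<close> is restriction to the fibre of the bundle \<open>EC \<times>\<^sub>C X \<rightarrow> BC\<close>; since \<open>EC\<close> is path connected,
  it does not depend on the base point.
\<close>

definition restrict_fibre ::
  "nat \<Rightarrow> 'a topology \<Rightarrow> ('a \<Rightarrow> 'a) \<Rightarrow> 'a set \<Rightarrow>
     ((nat \<Rightarrow> real) \<times> 'a) set cochain set \<Rightarrow> 'a cochain set" where
  "restrict_fibre p X \<tau> Y =
     cohomology_map p X Y (\<lambda>x. orbit (borel_involution \<tau>) (EC_basepoint, x))"

text \<open>\<open>r\<close> is induced by the inclusion of the fixed point pair.\<close>

definition restrict_fixed ::
  "nat \<Rightarrow> 'a topology \<Rightarrow> ('a \<Rightarrow> 'a) \<Rightarrow> 'a set \<Rightarrow>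
     ((nat \<Rightarrow> real) \<times> 'a) set cochain set \<Rightarrow> ((nat \<Rightarrow> real) \<times> 'a) set cochain set" where
  "restrict_fixed p X \<tau> Y =
     equivariant_cohomology_map p (fixed_space X \<tau>) \<tau> (Y \<inter> fixed_set X \<tau>) (\<lambda>x. x)"

text \<open>The generator of the polynomial ring \<open>H^*(BC)\<close>: the nonzero class of degree 1.\<close>

definition u_class :: "(nat \<Rightarrow> real) set cochain set" where
  "u_class = (THE v. v \<in> carrier (cohomology_group 1 BC {}) \<and>
                     v \<noteq> \<one>\<^bsub>cohomology_group 1 BC {}\<^esub>)"

text \<open>
  For a trivial action on \<open>Z\<close>, the orbit of \<open>(e,x)\<close> is \<open>{(e,x), (-e,x)}\<close>, and
  \<open>EC \<times>\<^sub>C Z\<close> is \<open>BC \<times> Z\<close> via the two projections below. Under the Kuenneth identification of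
  \<open>H^*\<^sub>C(Z,W)\<close> with \<open>H^*(Z,W)[u]\<close>, the monomial \<open>c u^i\<close> is the cup product of the pullback of \<open>c\<close>
  and the pullback of the \<open>i\<close>-th power of \<open>u\<close>.
\<close>

definition borel_to_BC :: "((nat \<Rightarrow> real) \<times> 'a) set \<Rightarrow> (nat \<Rightarrow> real) set" where
  "borel_to_BC z = fst ` z"

definition borel_to_space :: "((nat \<Rightarrow> real) \<times> 'a) set \<Rightarrow> 'a" where
  "borel_to_space z = the_elem (snd ` z)"

definition u_monomial ::
  "nat \<Rightarrow> nat \<Rightarrow> 'a topology \<Rightarrow> ('a \<Rightarrow> 'a) \<Rightarrow> 'a set \<Rightarrow> 'a cochain set \<Rightarrow>
     ((nat \<Rightarrow> real) \<times> 'a) set cochain set" where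
  "u_monomial d i Z \<tau> W c =
     cup d i (borel_space Z \<tau>) (borel_subset \<tau> W)
       (cohomology_map d (borel_space Z \<tau>) (borel_subset \<tau> W) borel_to_space c)
       (cohomology_map i (borel_space Z \<tau>) {} borel_to_BC (cup_power BC u_class i))"


section \<open>Frames and conjugation pairs\<close>

text \<open>
  The graded maps \<open>\<kappa>\<close> and \<open>\<sigma>\<close> are given by their components on \<open>H^(2m)(X,Y)\<close>. The conjugation
  equation takes place in degree \<open>2m\<close>, so the coefficient of \<open>u^i\<close> in the remainder has
  degree \<open>2m - i\<close>. The group operation, written multiplicatively by the library, is addition of
  cohomology classes.
\<close>

definition conjugation_equation ::
  "nat \<Rightarrow> 'a topology \<Rightarrow> ('a \<Rightarrow> 'a) \<Rightarrow> 'a set \<Rightarrow> 'a cochain set \<Rightarrow>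
     ((nat \<Rightarrow> real) \<times> 'a) set cochain set \<Rightarrow> bool" where
  "conjugation_equation m X \<tau> Y k b \<longleftrightarrow>
     (let Z = fixed_space X \<tau>; W = Y \<inter> fixed_set X \<tau>;
          G = equivariant_cohomology_group (2 * m) Z \<tau> W
      in \<exists>c. (\<forall>i<m. c i \<in> carrier (cohomology_group (2 * m - i) Z W)) \<and>
             restrict_fixed (2 * m) X \<tau> Y b =
               u_monomial m m Z \<tau> W k \<otimes>\<^bsub>G\<^esub>
               finprod G (\<lambda>i. u_monomial (2 * m - i) i Z \<tau> W (c i)) {..<m})"

definition cohomology_frame ::
  "'a topology \<Rightarrow> ('a \<Rightarrow> 'a) \<Rightarrow> 'a set \<Rightarrow> (nat \<Rightarrow> 'a cochain set \<Rightarrow> 'a cochain set) \<Rightarrow>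
     (nat \<Rightarrow> 'a cochain set \<Rightarrow> ((nat \<Rightarrow> real) \<times> 'a) set cochain set) \<Rightarrow> bool" where
  "cohomology_frame X \<tau> Y \<kappa> \<sigma> \<longleftrightarrow>
     (\<forall>m. \<kappa> m \<in> iso (cohomology_group (2 * m) X Y)
                    (cohomology_group m (fixed_space X \<tau>) (Y \<inter> fixed_set X \<tau>))) \<and>
     (\<forall>m. \<sigma> m \<in> hom (cohomology_group (2 * m) X Y)
                    (equivariant_cohomology_group (2 * m) X \<tau> Y)) \<and>
     (\<forall>m. \<forall>a\<in>carrier (cohomology_group (2 * m) X Y).
        restrict_fibre (2 * m) X \<tau> Y (\<sigma> m a) = a) \<and>
     (\<forall>m. \<forall>a\<in>carrier (cohomology_group (2 * m) X Y).
        conjugation_equation m X \<tau> Y (\<kappa> m a) (\<sigma> m a))"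

definition conjugation_pair :: "'a topology \<Rightarrow> ('a \<Rightarrow> 'a) \<Rightarrow> 'a set \<Rightarrow> bool" where
  "conjugation_pair X \<tau> Y \<longleftrightarrow>
     involution_on X \<tau> \<and> Y \<subseteq> topspace X \<and> \<tau> ` Y = Y \<and>
     (\<forall>n. odd n \<longrightarrow> trivial_group (cohomology_group n X Y)) \<and>
     (\<exists>\<kappa> \<sigma>. cohomology_frame X \<tau> Y \<kappa> \<sigma>)"

end

theory Submission
  imports Defs "HOL-Library.Function_Algebras" "HOL-Analysis.Abstract_Topological_Spaces"
begin

text \<open>
  Everything rests on the transfer (Gysin) sequence of the double covering \<open>EC \<times> X \<rightarrow> EC \<times>\<^sub>C X\<close>, whose
  connecting homomorphism is the cup product with \<open>u\<close>: the kernel of \<open>\<rho>\<close> consists of the multiples of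
  \<open>u\<close>, and for a trivial action multiplication by \<open>u\<close> is injective and restriction to the fibre picks out the
  constant term, so polynomials in \<open>u\<close> can be compared coefficientwise. For a conjugation pair
  the conjugation equation then shows, by induction on \<open>n\<close>, that an equivariant class of degree \<open>n\<close>
  vanishes if its restriction to the fixed points has \<open>u\<close>-degree less than \<open>n / 2\<close>: subtract the
  section of its image under \<open>\<rho>\<close>, divide by \<open>u\<close>, and compare leading coefficients. The
  difference of \<open>H\<^sup>*\<^sub>C f (\<sigma>\<^sub>X a)\<close> and \<open>\<sigma>\<^sub>Y (H\<^sup>* f a)\<close> lies in the kernel of \<open>\<rho>\<close> and restricts to a polynomial
  of degree at most \<open>m\<close>; its quotient by \<open>u\<close> has degree \<open>2m - 1\<close> and a restriction of \<open>u\<close>-degree at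
  most \<open>m - 1\<close>, hence is zero. The coefficient of \<open>u\<^sup>m\<close> gives the second equation.
\<close>

section \<open>Cochains modulo two\<close>

text \<open>The transfer sequence arises from a short exact sequence of cochain groups, pullback
  followed by transfer. Its exactness needs exactly two lifts of every singular simplex of the orbit
  space, so the geometric obstacle is the lifting of simplices; the coordinates of the sphere, which
  change sign under the involution, supply the charts. The same signs yield a 0-cochain that selects
  one point of each orbit. It need not be continuous: its coboundary descends to a cocycle for
  \<open>u\<close>, and the cup product with it splits the transfer, which makes the connecting
  homomorphism explicit on cochains. Neither a spectral sequence nor a Kuenneth theorem enters: for
  a trivial action every class of \<open>EC \<times> X\<close> is pulled back from the orbit space,
  so the transfer is zero in cohomology and multiplication by \<open>u\<close> is injective. The
  bound \<open>n / 2\<close> is where \<open>\<kappa>\<close> becomes visible: in degree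
  \<open>2m\<close> the coefficient of \<open>u^m\<close> in the restriction of a section is
  \<open>\<kappa>\<close>, so a restriction of smaller \<open>u\<close>-degree forces
  \<open>\<kappa>\<close> of the fibre class to vanish. Division by \<open>u\<close> lowers the
  degree by one only, which is why odd degrees take part in the induction.\<close>

declare add_bit_eq_xor [simp del] mult_bit_eq_and [simp del] plus_fun_def [simp del] zero_fun_def [simp del]

lemma bit_add_self [simp]: "(x::bit) + x = 0"
  by (cases x) auto

lemma cochain_add_self [simp]: "(\<phi>::'c \<Rightarrow> bit) + \<phi> = 0"
  by (simp add: fun_eq_iff)

lemma cochain_add_left_self [simp]: "(\<phi>::'c \<Rightarrow> bit) + (\<phi> + \<psi>) = \<psi>"
  by (simp add: fun_eq_iff flip: add.assoc)

lemma cochain_add_eq_0_iff: "(\<phi>::'c \<Rightarrow> bit) + \<psi> = 0 \<longleftrightarrow> \<phi> = \<psi>"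
  by (metis add.right_neutral cochain_add_self cochain_add_left_self)

lemma sum_fun_apply: "(\<Sum>i\<in>I. f i) s = (\<Sum>i\<in>I. f i s)" for f :: "'i \<Rightarrow> 'c \<Rightarrow> 'd::comm_monoid_add"
  by (induction I rule: infinite_finite_induct) auto

lemma cochain_set_0 [simp]: "0 \<in> cochain_set p X S"
  by (simp add: cochain_set_def)

lemma cochain_set_add: "\<phi> \<in> cochain_set p X S \<Longrightarrow> \<psi> \<in> cochain_set p X S \<Longrightarrow> \<phi> + \<psi> \<in> cochain_set p X S"
  by (simp add: cochain_set_def)

lemma coboundary_0 [simp]: "coboundary p X 0 = 0"
  by (simp add: coboundary_def fun_eq_iff)

lemma coboundary_add: "coboundary p X (\<phi> + \<psi>) = coboundary p X \<phi> + coboundary p X \<psi>"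
  by (simp add: coboundary_def fun_eq_iff sum.distrib del: sum.atMost_Suc)

lemma coboundary_cochain:
  assumes "\<phi> \<in> cochain_set p X S"
  shows "coboundary p X \<phi> \<in> cochain_set (Suc p) X S"
proof -
  have "\<phi> (singular_face (Suc p) k s) = 0" if "singular_simplex (Suc p) (subtopology X S) s" "k \<le> Suc p" for s k
    using singular_simplex_singular_face [OF that(1) _ that(2)] assms by (simp add: cochain_set_def)
  then show ?thesis
    by (auto simp: cochain_set_def coboundary_def simp del: sum.atMost_Suc)
qed

text \<open>Chains come with integer coefficients; evaluation modulo 2 carries the identities for
  boundaries and chain maps over to cochains.\<close>

definition chain_pairing :: "('s \<Rightarrow> bit) \<Rightarrow> ('s \<Rightarrow>\<^sub>0 int) \<Rightarrow> bit" where
  "chain_pairing \<phi> c = (\<Sum>s\<in>Poly_Mapping.keys c. of_int (Poly_Mapping.lookup c s) * \<phi> s)"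

lemma chain_pairing_superset:
  assumes "finite A" "Poly_Mapping.keys c \<subseteq> A"
  shows "chain_pairing \<phi> c = (\<Sum>s\<in>A. of_int (Poly_Mapping.lookup c s) * \<phi> s)"
  unfolding chain_pairing_def
  by (rule sum.mono_neutral_left) (use assms in \<open>auto simp: in_keys_iff\<close>)

lemma chain_pairing_0 [simp]: "chain_pairing \<phi> 0 = 0"
  by (simp add: chain_pairing_def)

lemma chain_pairing_of [simp]: "chain_pairing \<phi> (frag_of s) = \<phi> s"
  by (simp add: chain_pairing_def)

lemma chain_pairing_cmul [simp]: "chain_pairing \<phi> (frag_cmul a c) = of_int a * chain_pairing \<phi> c"
proof -
  have "chain_pairing \<phi> (frag_cmul a c) =
      (\<Sum>s\<in>Poly_Mapping.keys c. of_int (Poly_Mapping.lookup (frag_cmul a c) s) * \<phi> s)"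
    by (rule chain_pairing_superset) (auto simp: keys_cmul)
  then show ?thesis
    by (simp add: chain_pairing_def sum_distrib_left mult.assoc)
qed

lemma chain_pairing_diff: "chain_pairing \<phi> (c - d) = chain_pairing \<phi> c + chain_pairing \<phi> d"
proof -
  let ?A = "Poly_Mapping.keys c \<union> Poly_Mapping.keys d"
  have *: "(x::bit) - y = x + y" for x y
    by (cases x; cases y) auto
  have "chain_pairing \<phi> (c - d) = (\<Sum>s\<in>?A. of_int (Poly_Mapping.lookup (c - d) s) * \<phi> s)"
    by (rule chain_pairing_superset) (auto simp: keys_diff)
  also have "\<dots> = (\<Sum>s\<in>?A. of_int (Poly_Mapping.lookup c s) * \<phi> s) + (\<Sum>s\<in>?A. of_int (Poly_Mapping.lookup d s) * \<phi> s)"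
    by (simp add: lookup_minus * distrib_right sum.distrib)
  also have "\<dots> = chain_pairing \<phi> c + chain_pairing \<phi> d"
    by (simp add: chain_pairing_superset [of ?A])
  finally show ?thesis .
qed

lemma chain_pairing_minus [simp]: "chain_pairing \<phi> (- c) = chain_pairing \<phi> c"
  using chain_pairing_diff [of \<phi> 0 c] by simp

lemma chain_pairing_add: "chain_pairing \<phi> (c + d) = chain_pairing \<phi> c + chain_pairing \<phi> d"
  using chain_pairing_diff [of \<phi> c "- d"] by simp

lemma chain_pairing_sum: "chain_pairing \<phi> (\<Sum>i\<in>I. f i) = (\<Sum>i\<in>I. chain_pairing \<phi> (f i))"
  by (induction I rule: infinite_finite_induct) (auto simp: chain_pairing_add)

lemma bit_sign [simp]: "of_int ((-1) ^ k) = (1::bit)"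
  by (induction k) auto

lemma chain_pairing_eqI:
  assumes "Poly_Mapping.keys c \<subseteq> A" "\<And>s. s \<in> A \<Longrightarrow> \<phi> s = \<psi> s"
  shows "chain_pairing \<phi> c = chain_pairing \<psi> c"
  unfolding chain_pairing_def by (rule sum.cong) (use assms in auto)

lemma chain_pairing_eq_0:
  assumes "\<phi> \<in> cochain_set p X S" "singular_chain p (subtopology X S) c"
  shows "chain_pairing \<phi> c = 0"
proof -
  have "chain_pairing \<phi> c = chain_pairing (\<lambda>s. 0) c"
    by (rule chain_pairing_eqI [of _ "Collect (singular_simplex p (subtopology X S))"])
       (use assms in \<open>auto simp: singular_chain_def cochain_set_def\<close>)
  then show ?thesis
    by (simp add: chain_pairing_def)
qed

text \<open>Coboundary and boundary are adjoint: by linearity one simplex suffices, and the signs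
  vanish modulo 2. The chain has to lie in \<open>X\<close>, since \<open>coboundary\<close> is set
  to 0 elsewhere.\<close>

lemma coboundary_pairing:
  assumes "singular_chain (Suc p) X c"
  shows "chain_pairing (coboundary p X \<phi>) c = chain_pairing \<phi> (chain_boundary (Suc p) c)"
  using assms unfolding singular_chain_def
proof (induction c rule: frag_induction)
  case (one s)
  then show ?case
    by (simp add: coboundary_def chain_boundary_of chain_pairing_sum chain_pairing_add del: sum.atMost_Suc)
next
  case (diff a b)
  then show ?case
    by (simp add: chain_boundary_diff chain_pairing_diff)
qed auto

lemma coboundary_coboundary: "coboundary (Suc p) X (coboundary p X \<phi>) = 0"
proof
  fix s
  show "coboundary (Suc p) X (coboundary p X \<phi>) s = 0 s"
  proof (cases "singular_simplex (Suc (Suc p)) X s")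
    case True
    then have c: "singular_chain (Suc (Suc p)) X (frag_of s)"
      by (simp add: singular_chain_of)
    have "coboundary (Suc p) X (coboundary p X \<phi>) s
        = chain_pairing (coboundary p X \<phi>) (chain_boundary (Suc (Suc p)) (frag_of s))"
      using coboundary_pairing [OF c] by simp
    also have "\<dots> = chain_pairing \<phi> (chain_boundary (Suc p) (chain_boundary (Suc (Suc p)) (frag_of s)))"
      using singular_chain_boundary [OF c] coboundary_pairing by fastforce
    also have "\<dots> = 0"
      using chain_boundary_boundary [OF c] by simp
    finally show ?thesis by simp
  qed (simp add: coboundary_def)
qed

section \<open>Cocycles and coboundaries\<close>

lemma cocycle_set_iff: "\<phi> \<in> cocycle_set p X S \<longleftrightarrow> \<phi> \<in> cochain_set p X S \<and> coboundary p X \<phi> = 0"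
  by (simp add: cocycle_set_def zero_fun_def)

lemma cocycle_set_0 [simp]: "0 \<in> cocycle_set p X S"
  by (simp add: cocycle_set_iff)

lemma cocycle_set_add: "\<phi> \<in> cocycle_set p X S \<Longrightarrow> \<psi> \<in> cocycle_set p X S \<Longrightarrow> \<phi> + \<psi> \<in> cocycle_set p X S"
  by (simp add: cocycle_set_iff cochain_set_add coboundary_add)

lemma coboundary_set_0_eq: "coboundary_set 0 X S = {0}"
  by (simp add: coboundary_set_def zero_fun_def)

lemma coboundary_set_Suc: "coboundary_set (Suc p) X S = coboundary p X ` cochain_set p X S"
  by (simp add: coboundary_set_def)

lemma coboundary_set_0 [simp]: "0 \<in> coboundary_set p X S"
  by (cases p) (auto simp: coboundary_set_0_eq coboundary_set_Suc intro: rev_image_eqI [of 0])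

lemma coboundary_set_add:
  "\<phi> \<in> coboundary_set p X S \<Longrightarrow> \<psi> \<in> coboundary_set p X S \<Longrightarrow> \<phi> + \<psi> \<in> coboundary_set p X S"
  by (cases p) (auto simp: coboundary_set_0_eq coboundary_set_Suc simp flip: coboundary_add intro: cochain_set_add)

lemma coboundary_set_subset: "coboundary_set p X S \<subseteq> cocycle_set p X S"
  by (cases p) (auto simp: coboundary_set_0_eq coboundary_set_Suc cocycle_set_iff coboundary_cochain coboundary_coboundary)

lemma cocycle_set_sum:
  "(\<And>i. i \<in> I \<Longrightarrow> f i \<in> cocycle_set p X S) \<Longrightarrow> (\<Sum>i\<in>I. f i) \<in> cocycle_set p X S"
  by (induction I rule: infinite_finite_induct) (auto intro: cocycle_set_add)

subsection \<open>Pullback\<close>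

lemma cochain_pullback_add: "cochain_pullback p Y f (\<phi> + \<psi>) = cochain_pullback p Y f \<phi> + cochain_pullback p Y f \<psi>"
  by (simp add: cochain_pullback_def fun_eq_iff)

lemma cochain_pullback_0 [simp]: "cochain_pullback p Y f 0 = 0"
  by (simp add: cochain_pullback_def fun_eq_iff)

lemma cochain_pullback_sum: "cochain_pullback p Y f (\<Sum>i\<in>I. g i) = (\<Sum>i\<in>I. cochain_pullback p Y f (g i))"
  by (auto simp: cochain_pullback_def fun_eq_iff sum_fun_apply)

lemma singular_simplex_image:
  "singular_simplex p X s \<Longrightarrow> x \<in> standard_simplex p \<Longrightarrow> s x \<in> topspace X"
  by (auto simp: singular_simplex_def continuous_map_def Pi_iff)

text \<open>Only the part of \<open>T\<close> inside \<open>topspace Y\<close> carries simplices, so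
  only that part has to be mapped into \<open>S\<close>.\<close>

lemma cochain_pullback_cochain:
  assumes "\<phi> \<in> cochain_set p X S" "continuous_map Y X f" "f ` (topspace Y \<inter> T) \<subseteq> S"
  shows "cochain_pullback p Y f \<phi> \<in> cochain_set p Y T"
proof -
  have "singular_simplex p (subtopology X S) (simplex_map p f s)" if "singular_simplex p (subtopology Y T) s" for s
  proof (rule singular_simplex_simplex_map [OF that])
    show "continuous_map (subtopology Y T) (subtopology X S) f"
      using assms by (auto simp: continuous_map_in_subtopology continuous_map_from_subtopology)
  qed
  then show ?thesis
    using assms(1) by (auto simp: cochain_pullback_def cochain_set_def)
qed

lemma singular_face_simplex_map':
  assumes "1 \<le> p" "k \<le> p"
  shows "singular_face p k (simplex_map p f s) = simplex_map (p - Suc 0) f (singular_face p k s)"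
  using assms by (auto simp: singular_face_def simplex_map_def fun_eq_iff simplical_face_in_standard_simplex)

lemma coboundary_pullback:
  assumes "continuous_map Y X f"
  shows "coboundary p Y (cochain_pullback p Y f \<phi>) = cochain_pullback (Suc p) Y f (coboundary p X \<phi>)"
proof
  fix s
  have "singular_simplex p Y (singular_face (Suc p) k s)" if "singular_simplex (Suc p) Y s" "k \<le> Suc p" for k
    using singular_simplex_singular_face [OF that(1) _ that(2)] by simp
  then show "coboundary p Y (cochain_pullback p Y f \<phi>) s = cochain_pullback (Suc p) Y f (coboundary p X \<phi>) s"
    using assms
    by (auto simp: coboundary_def cochain_pullback_def singular_simplex_simplex_map singular_face_simplex_map'
        simp del: sum.atMost_Suc intro!: sum.cong)
qed

lemma cochain_pullback_cocycle:
  assumes "\<phi> \<in> cocycle_set p X S" "continuous_map Y X f" "f ` (topspace Y \<inter> T) \<subseteq> S"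
  shows "cochain_pullback p Y f \<phi> \<in> cocycle_set p Y T"
  using assms by (auto simp: cocycle_set_iff coboundary_pullback intro: cochain_pullback_cochain)

lemma cochain_pullback_coboundary_set:
  assumes "\<phi> \<in> coboundary_set p X S" "continuous_map Y X f" "f ` (topspace Y \<inter> T) \<subseteq> S"
  shows "cochain_pullback p Y f \<phi> \<in> coboundary_set p Y T"
proof (cases p)
  case 0
  then show ?thesis using assms by (simp add: coboundary_set_0_eq)
next
  case (Suc q)
  with assms(1) obtain \<psi> where \<psi>: "\<psi> \<in> cochain_set q X S" "\<phi> = coboundary q X \<psi>"
    by (auto simp: coboundary_set_Suc)
  then have "cochain_pullback p Y f \<phi> = coboundary q Y (cochain_pullback q Y f \<psi>)"
    using Suc coboundary_pullback [OF assms(2), of q \<psi>] by simp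
  then show ?thesis
    using cochain_pullback_cochain [OF \<psi>(1) assms(2,3)] by (auto simp: Suc coboundary_set_Suc)
qed

lemma cochain_pullback_compose:
  assumes "continuous_map Z Y g"
  shows "cochain_pullback p Z g (cochain_pullback p Y f \<phi>) = cochain_pullback p Z (f \<circ> g) \<phi>"
  using assms by (auto simp: cochain_pullback_def fun_eq_iff singular_simplex_simplex_map simplex_map_compose)

lemma cochain_pullback_cong:
  assumes "\<And>y. y \<in> topspace Y \<Longrightarrow> f y = g y"
  shows "cochain_pullback p Y f \<phi> = cochain_pullback p Y g \<phi>"
  by (auto simp: cochain_pullback_def fun_eq_iff simplex_map_eq [OF _ assms])

lemma cochain_pullback_id:
  assumes "\<phi> \<in> cochain_set p Y S" "\<And>y. y \<in> topspace Y \<Longrightarrow> f y = y"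
  shows "cochain_pullback p Y f \<phi> = \<phi>"
  using assms by (auto simp: cochain_pullback_def fun_eq_iff cochain_set_def simplex_map_id_gen)

subsection \<open>Cup products\<close>

lemma front_face_in: "x \<in> standard_simplex p \<Longrightarrow> x \<in> standard_simplex (p + q)"
  using standard_simplex_mono [of p "p + q"] by auto

lemma back_face_in:
  assumes "x \<in> standard_simplex q"
  shows "(\<lambda>i. if i < p then 0 else x (i - p)) \<in> standard_simplex (p + q)"
proof -
  have "(\<Sum>i\<le>p + q. if i < p then 0 else x (i - p)) = (\<Sum>i=0+p..q+p. if i < p then 0 else x (i - p))"
    by (rule sum.mono_neutral_right) (auto simp: )
  also have "\<dots> = (\<Sum>i=0..q. x i)"
    by (subst sum.shift_bounds_cl_nat_ivl) simp
  finally show ?thesis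
    using assms by (auto simp: standard_simplex_def atLeast0AtMost)
qed

lemma singular_simplex_front_face:
  assumes "singular_simplex (p + q) X s"
  shows "singular_simplex p X (front_face p s)"
proof -
  have "continuous_map (subtopology (powertop_real UNIV) (standard_simplex p)) X s"
    using assms continuous_map_from_subtopology_mono standard_simplex_mono [of p "p + q"]
    by (fastforce simp: singular_simplex_def)
  then have "continuous_map (subtopology (powertop_real UNIV) (standard_simplex p)) X (front_face p s)"
    by (rule continuous_map_eq) (simp add: front_face_def)
  then show ?thesis
    by (simp add: singular_simplex_def front_face_def)
qed

lemma singular_simplex_back_face:
  assumes "singular_simplex (p + q) X s"
  shows "singular_simplex q X (back_face p q s)"
proof -
  have "continuous_map (subtopology (powertop_real UNIV) (standard_simplex q))
          (subtopology (powertop_real UNIV) (standard_simplex (p + q))) (\<lambda>x i. if i < p then 0 else x (i - p))"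
    unfolding continuous_map_in_subtopology
  proof
    have "continuous_map (powertop_real UNIV) euclideanreal (\<lambda>x. if i < p then 0 else x (i - p))" for i
      by (auto intro: continuous_map_product_projection)
    then show "continuous_map (subtopology (powertop_real UNIV) (standard_simplex q)) (powertop_real UNIV)
          (\<lambda>x i. if i < p then 0 else x (i - p))"
      by (auto simp: continuous_map_componentwise continuous_map_from_subtopology)
  qed (auto simp: back_face_in)
  then have "continuous_map (subtopology (powertop_real UNIV) (standard_simplex q)) X
      (s \<circ> (\<lambda>x i. if i < p then 0 else x (i - p)))"
    using assms by (auto simp: singular_simplex_def intro: continuous_map_compose)
  then show ?thesis
    by (auto simp: singular_simplex_def back_face_def o_def)
qed

lemma front_face_simplex_map: "front_face p (simplex_map (p + q) f s) = simplex_map p f (front_face p s)"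
  by (auto simp: front_face_def simplex_map_def fun_eq_iff front_face_in)

lemma back_face_simplex_map: "back_face p q (simplex_map (p + q) f s) = simplex_map q f (back_face p q s)"
  by (auto simp: back_face_def simplex_map_def fun_eq_iff back_face_in)

lemma cup_cochain_pullback:
  assumes "continuous_map Y X f"
  shows "cup_cochain p q Y (cochain_pullback p Y f \<phi>) (cochain_pullback q Y f \<psi>)
    = cochain_pullback (p + q) Y f (cup_cochain p q X \<phi> \<psi>)"
  using assms
  by (auto simp: cup_cochain_def cochain_pullback_def fun_eq_iff singular_simplex_simplex_map
      front_face_simplex_map back_face_simplex_map singular_simplex_front_face singular_simplex_back_face)

lemma cup_cochain_add_left: "cup_cochain p q X (\<phi> + \<phi>') \<psi> = cup_cochain p q X \<phi> \<psi> + cup_cochain p q X \<phi>' \<psi>"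
  by (simp add: cup_cochain_def fun_eq_iff distrib_right)

lemma cup_cochain_add_right: "cup_cochain p q X \<phi> (\<psi> + \<psi>') = cup_cochain p q X \<phi> \<psi> + cup_cochain p q X \<phi> \<psi>'"
  by (simp add: cup_cochain_def fun_eq_iff distrib_left)

lemma cup_cochain_0_left [simp]: "cup_cochain p q X 0 \<psi> = 0"
  by (simp add: cup_cochain_def fun_eq_iff)

lemma cup_cochain_0_right [simp]: "cup_cochain p q X \<phi> 0 = 0"
  by (simp add: cup_cochain_def fun_eq_iff)

lemma cup_cochain_sum_left:
  "cup_cochain p q X (\<Sum>i\<in>I. g i) \<psi> = (\<Sum>i\<in>I. cup_cochain p q X (g i) \<psi>)"
  by (auto simp: cup_cochain_def fun_eq_iff sum_fun_apply sum_distrib_right)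

lemma cup_cochain_cochain:
  assumes "\<phi> \<in> cochain_set p X S"
  shows "cup_cochain p q X \<phi> \<psi> \<in> cochain_set (p + q) X S"
  using assms by (auto simp: cup_cochain_def cochain_set_def dest: singular_simplex_front_face)

text \<open>Both sides evaluate on the same three faces, with vertices 0 to p, p to p + q, and p + q
  to p + q + r. Associativity therefore holds before passing to classes.\<close>

lemma cup_cochain_assoc:
  fixes \<phi> :: "'a cochain"
  shows "cup_cochain (p + q) r X (cup_cochain p q X \<phi> \<psi>) \<zeta> = cup_cochain p (q + r) X \<phi> (cup_cochain q r X \<psi> \<zeta>)"
proof
  fix s :: "(nat \<Rightarrow> real) \<Rightarrow> 'a"
  have f: "front_face p (front_face (p + q) s) = front_face p s"
    by (auto simp: front_face_def fun_eq_iff front_face_in)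
  have m: "back_face p q (front_face (p + q) s) = front_face q (back_face p (q + r) s)"
    using standard_simplex_mono [of q "q + r"] by (auto simp: front_face_def back_face_def fun_eq_iff back_face_in)
  have "back_face q r (back_face p (q + r) s) x = back_face (p + q) r s x" for x
    using back_face_in [of x r q]
    by (auto simp: back_face_def intro!: arg_cong [of _ _ s] ext)
  then have b: "back_face q r (back_face p (q + r) s) = back_face (p + q) r s" ..
  show "cup_cochain (p + q) r X (cup_cochain p q X \<phi> \<psi>) \<zeta> s = cup_cochain p (q + r) X \<phi> (cup_cochain q r X \<psi> \<zeta>) s"
  proof (cases "singular_simplex (p + q + r) X s")
    case True
    then have "singular_simplex (p + (q + r)) X s" by (simp add: add.assoc)
    with True show ?thesis
      by (simp add: cup_cochain_def f m b singular_simplex_front_face singular_simplex_back_face mult.assoc)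
  next
    case False
    then show ?thesis
      by (simp add: cup_cochain_def add.assoc)
  qed
qed

text \<open>The Leibniz rule modulo 2. A face with index at most \<open>p\<close> changes only the
  front factor, a later one only the back factor. The two sums on the right have one extra term
  each, the last face of the front and face 0 of the back, and these coincide.\<close>

lemma coboundary_cup:
  "coboundary (p + q) X (cup_cochain p q X \<phi> \<psi>)
    = cup_cochain (Suc p) q X (coboundary p X \<phi>) \<psi> + cup_cochain p (Suc q) X \<phi> (coboundary q X \<psi>)"
proof
  fix s
  show "coboundary (p + q) X (cup_cochain p q X \<phi> \<psi>) s =
    (cup_cochain (Suc p) q X (coboundary p X \<phi>) \<psi> + cup_cochain p (Suc q) X \<phi> (coboundary q X \<psi>)) s"
  proof (cases "singular_simplex (Suc (p + q)) X s")
    case True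
    then have s1: "singular_simplex (Suc p + q) X s" and s2: "singular_simplex (p + Suc q) X s"
      by auto
    have sf: "singular_simplex (p + q) X (singular_face (Suc (p + q)) k s)" if "k \<le> Suc (p + q)" for k
      using singular_simplex_singular_face [OF True _ that] by simp
    let ?F = "\<lambda>k. \<phi> (singular_face (Suc p) k (front_face (Suc p) s)) * \<psi> (back_face (Suc p) q s)"
    let ?G = "\<lambda>k. \<phi> (front_face p s) * \<psi> (singular_face (Suc q) k (back_face p (Suc q) s))"
    have F: "cup_cochain p q X \<phi> \<psi> (singular_face (Suc (p + q)) k s) = ?F k" if "k \<le> p" for k
    proof -
      have "front_face p (singular_face (Suc (p + q)) k s) = singular_face (Suc p) k (front_face (Suc p) s)"
        using that simplical_face_in_standard_simplex [of "Suc p" k]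
        by (auto simp: front_face_def singular_face_def fun_eq_iff front_face_in)
      moreover have "back_face p q (singular_face (Suc (p + q)) k s) x = back_face (Suc p) q s x" for x
        using that back_face_in [of x q p]
        by (auto simp: back_face_def singular_face_def simplical_face_def fun_eq_iff intro!: arg_cong [of _ _ s] ext)
      then have "back_face p q (singular_face (Suc (p + q)) k s) = back_face (Suc p) q s" ..
      ultimately show ?thesis
        using that by (simp add: cup_cochain_def sf)
    qed
    have G: "cup_cochain p q X \<phi> \<psi> (singular_face (Suc (p + q)) (p + k) s) = ?G k" if "1 \<le> k" "k \<le> Suc q" for k
    proof -
      have "front_face p (singular_face (Suc (p + q)) (p + k) s) x = front_face p s x" for x
        using that front_face_in [of x p q]
        by (auto simp: front_face_def singular_face_def simplical_face_def standard_simplex_def intro!: arg_cong [of _ _ s] ext)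
      then have "front_face p (singular_face (Suc (p + q)) (p + k) s) = front_face p s" ..
      moreover have "back_face p q (singular_face (Suc (p + q)) (p + k) s) x = singular_face (Suc q) k (back_face p (Suc q) s) x" for x
        using that back_face_in [of x q p] simplical_face_in_standard_simplex [of "Suc q" k x]
        by (auto simp: back_face_def singular_face_def simplical_face_def fun_eq_iff intro!: arg_cong [of _ _ s] ext)
      then have "back_face p q (singular_face (Suc (p + q)) (p + k) s) = singular_face (Suc q) k (back_face p (Suc q) s)" ..
      ultimately show ?thesis
        using that by (simp add: cup_cochain_def sf)
    qed
    have "singular_face (Suc p) (Suc p) (front_face (Suc p) s) = front_face p s"
    proof
      fix x
      show "singular_face (Suc p) (Suc p) (front_face (Suc p) s) x = front_face p s x"
        using simplical_face_in_standard_simplex [of "Suc p" "Suc p" x]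
        by (auto simp: front_face_def singular_face_def simplical_face_def standard_simplex_def
            intro!: arg_cong [of _ _ s] ext)
    qed
    moreover have "singular_face (Suc q) 0 (back_face p (Suc q) s) = back_face (Suc p) q s"
    proof
      fix x
      show "singular_face (Suc q) 0 (back_face p (Suc q) s) x = back_face (Suc p) q s x"
        using simplical_face_in_standard_simplex [of "Suc q" 0 x]
        by (auto simp: back_face_def singular_face_def simplical_face_def intro!: arg_cong [of _ _ s] ext)
    qed
    ultimately have FG: "?F (Suc p) = ?G 0" by simp
    have "coboundary (p + q) X (cup_cochain p q X \<phi> \<psi>) s
        = (\<Sum>k\<le>Suc (p + q). cup_cochain p q X \<phi> \<psi> (singular_face (Suc (p + q)) k s))"
      using True by (simp add: coboundary_def del: sum.atMost_Suc)
    also have "{..Suc (p + q)} = {..p} \<union> {1 + p..Suc q + p}"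
      by auto
    also have "(\<Sum>k\<in>{..p} \<union> {1 + p..Suc q + p}. cup_cochain p q X \<phi> \<psi> (singular_face (Suc (p + q)) k s))
      = (\<Sum>k\<le>p. cup_cochain p q X \<phi> \<psi> (singular_face (Suc (p + q)) k s))
        + (\<Sum>k=1 + p..Suc q + p. cup_cochain p q X \<phi> \<psi> (singular_face (Suc (p + q)) k s))"
      by (rule sum.union_disjoint) auto
    also have "\<dots> = (\<Sum>k\<le>p. ?F k) + (\<Sum>k=1..Suc q. ?G k)"
      unfolding sum.shift_bounds_cl_nat_ivl
      by (intro arg_cong2 [of _ _ _ _ "(+)"] sum.cong) (auto simp: F G add.commute [of _ p])
    also have "\<dots> = (\<Sum>k\<le>Suc p. ?F k) + (\<Sum>k\<le>Suc q. ?G k)"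
    proof -
      have e1: "(\<Sum>k\<le>Suc p. ?F k) = (\<Sum>k\<le>p. ?F k) + ?G 0"
        using FG by simp
      have e2: "(\<Sum>k\<le>Suc q. ?G k) = ?G 0 + (\<Sum>k=1..Suc q. ?G k)"
        using sum.atLeast_Suc_atMost [of 0 "Suc q" ?G] by (simp only: atMost_atLeast0 One_nat_def zero_le)
      \<comment> \<open>\<open>c\<close> stands for the coinciding extra term, which cancels modulo
        2.\<close>
      have e3: "a + b = (a + c) + (c + b)" for a b c :: bit
        by (cases a; cases b; cases c) auto
      show ?thesis
        unfolding e1 e2 by (rule e3)
    qed
    also have "\<dots> = (cup_cochain (Suc p) q X (coboundary p X \<phi>) \<psi> + cup_cochain p (Suc q) X \<phi> (coboundary q X \<psi>)) s"
      unfolding plus_fun_apply cup_cochain_def coboundary_def if_P [OF s1] if_P [OF s2]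
        if_P [OF singular_simplex_front_face [OF s1]] if_P [OF singular_simplex_back_face [OF s2]]
        sum_distrib_left sum_distrib_right ..
    finally show ?thesis .
  qed (auto simp: coboundary_def cup_cochain_def)
qed

lemma cup_cochain_cocycle:
  assumes "\<phi> \<in> cocycle_set p X S" "\<psi> \<in> cocycle_set q X {}"
  shows "cup_cochain p q X \<phi> \<psi> \<in> cocycle_set (p + q) X S"
  using assms by (auto simp: cocycle_set_iff coboundary_cup cup_cochain_cochain)

lemma cup_cochain_coboundary_left:
  assumes "\<phi> \<in> coboundary_set p X S" "\<psi> \<in> cocycle_set q X {}"
  shows "cup_cochain p q X \<phi> \<psi> \<in> coboundary_set (p + q) X S"
proof (cases p)
  case 0
  then show ?thesis using assms by (simp add: coboundary_set_0_eq)
next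
  case (Suc n)
  with assms(1) obtain \<zeta> where "\<zeta> \<in> cochain_set n X S" "\<phi> = coboundary n X \<zeta>"
    by (auto simp: coboundary_set_Suc)
  with assms(2) show ?thesis
    using coboundary_cup [of n q X \<zeta> \<psi>] cup_cochain_cochain [of \<zeta> n X S q \<psi>]
    by (auto simp: Suc coboundary_set_Suc cocycle_set_iff intro: rev_image_eqI)
qed

lemma cup_cochain_coboundary_right:
  assumes "\<phi> \<in> cocycle_set p X S" "\<psi> \<in> coboundary_set q X {}"
  shows "cup_cochain p q X \<phi> \<psi> \<in> coboundary_set (p + q) X S"
proof (cases q)
  case 0
  then show ?thesis using assms by (simp add: coboundary_set_0_eq)
next
  case (Suc n)
  with assms(2) obtain \<zeta> where "\<zeta> \<in> cochain_set n X {}" "\<psi> = coboundary n X \<zeta>"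
    by (auto simp: coboundary_set_Suc)
  with assms(1) show ?thesis
    using coboundary_cup [of p n X \<phi> \<zeta>] cup_cochain_cochain [of \<phi> p X S n \<zeta>]
    by (auto simp: Suc coboundary_set_Suc cocycle_set_iff intro: rev_image_eqI)
qed

section \<open>The unit of the cup product\<close>

abbreviation unit_cochain :: "'a topology \<Rightarrow> 'a cochain" where
  "unit_cochain X \<equiv> (\<lambda>s. if singular_simplex 0 X s then 1 else 0)"

lemma unit_cochain_cocycle: "unit_cochain X \<in> cocycle_set 0 X {}"
proof -
  have "coboundary 0 X (unit_cochain X) = 0"
  proof
    fix s
    show "coboundary 0 X (unit_cochain X) s = 0 s"
      using singular_simplex_singular_face [of "Suc 0" X s] by (simp add: coboundary_def)
  qed
  then show ?thesis
    by (simp add: cocycle_set_iff) (simp add: cochain_set_def singular_simplex_empty)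
qed

lemma cup_unit_cochain_left:
  assumes "\<phi> \<in> cochain_set p X S"
  shows "cup_cochain 0 p X (unit_cochain X) \<phi> = \<phi>"
proof
  fix s
  show "cup_cochain 0 p X (unit_cochain X) \<phi> s = \<phi> s"
  proof (cases "singular_simplex p X s")
    case True
    have "back_face 0 p s = s"
      using True by (auto simp: back_face_def singular_simplex_def extensional_restrict)
    then show ?thesis
      using True singular_simplex_front_face [of 0 p X s] by (simp add: cup_cochain_def)
  qed (use assms in \<open>auto simp: cup_cochain_def cochain_set_def\<close>)
qed

lemma cup_unit_cochain_right:
  assumes "\<phi> \<in> cochain_set p X S"
  shows "cup_cochain p 0 X \<phi> (unit_cochain X) = \<phi>"
proof
  fix s
  show "cup_cochain p 0 X \<phi> (unit_cochain X) s = \<phi> s"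
  proof (cases "singular_simplex p X s")
    case True
    have "front_face p s = s"
      using True by (auto simp: front_face_def singular_simplex_def extensional_restrict)
    then show ?thesis
      using True singular_simplex_back_face [of p 0 X s] by (simp add: cup_cochain_def)
  qed (use assms in \<open>auto simp: cup_cochain_def cochain_set_def\<close>)
qed

section \<open>Homotopy invariance\<close>

abbreviation unit_interval :: "real topology" where
  "unit_interval \<equiv> top_of_set {0..1}"

abbreviation simplex_space :: "nat \<Rightarrow> (nat \<Rightarrow> real) topology" where
  "simplex_space q \<equiv> subtopology (powertop_real UNIV) (standard_simplex q)"

abbreviation simplex_cylinder :: "nat \<Rightarrow> (real \<times> (nat \<Rightarrow> real)) topology" where
  "simplex_cylinder q \<equiv> prod_topology unit_interval (simplex_space q)"

abbreviation identity_simplex :: "nat \<Rightarrow> (nat \<Rightarrow> real) \<Rightarrow> (nat \<Rightarrow> real)" where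
  "identity_simplex q \<equiv> restrict id (standard_simplex q)"

lemma contractible_simplex_space: "contractible_space (simplex_space q)"
proof -
  define v :: "nat \<Rightarrow> real" where "v = (\<lambda>j. if j = 0 then 1 else 0)"
  have v: "v \<in> standard_simplex q" by (simp add: v_def)
  define h where "h = (\<lambda>z::real \<times> (nat \<Rightarrow> real). \<lambda>i. (1 - fst z) * snd z i + fst z * v i)"
  have "continuous_map (prod_topology unit_interval (simplex_space q)) euclideanreal (\<lambda>z. h z i)" for i
  proof -
    have 1: "continuous_map (prod_topology unit_interval (simplex_space q)) euclideanreal fst"
      by (meson continuous_map_fst continuous_map_into_fulltopology)
    have 2: "continuous_map (prod_topology unit_interval (simplex_space q)) euclideanreal (\<lambda>z. snd z i)"
    proof -
      have "continuous_map (simplex_space q) euclideanreal (\<lambda>x. x i)"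
        using continuous_map_product_projection [of i UNIV "\<lambda>_. euclideanreal"]
        by (intro continuous_map_from_subtopology) simp
      from continuous_map_compose [OF continuous_map_snd this, of unit_interval] show ?thesis
        by (simp add: o_def)
    qed
    show ?thesis
      unfolding h_def by (intro continuous_intros 1 2)
  qed
  moreover have "h ` ({0..1} \<times> standard_simplex q) \<subseteq> standard_simplex q"
    using v by (auto simp: h_def convex_standard_simplex)
  ultimately have "continuous_map (prod_topology unit_interval (simplex_space q)) (simplex_space q) h"
    by (auto simp: continuous_map_in_subtopology continuous_map_componentwise image_subset_iff)
  then have "homotopic_with (\<lambda>x. True) (simplex_space q) (simplex_space q) id (\<lambda>x. v)"
    unfolding homotopic_with_def by (intro exI [of _ h]) (auto simp: h_def)
  then show ?thesis
    unfolding contractible_space_def by blast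
qed

lemma contractible_simplex_cylinder: "contractible_space (simplex_cylinder q)"
  by (simp add: contractible_space_prod_topology contractible_simplex_space contractible_space_top_of_set convex_imp_contractible del: contractible_space_subtopology_euclideanreal)

text \<open>A contraction makes the cycle homologous to its image in a one-point space, where cycles
  of positive degree bound. Degree 0 is excluded because a single point is a cycle that does not
  bound.\<close>

lemma contractible_cycle_imp_boundary:
  assumes X: "contractible_space X" and c: "singular_chain p X c" "chain_boundary p c = 0" and "1 \<le> p"
  shows "\<exists>d. singular_chain (Suc p) X d \<and> chain_boundary (Suc p) d = c"
proof -
  obtain a where a: "homotopic_with (\<lambda>x. True) X X id (\<lambda>x. a)"
    using X unfolding contractible_space_def by blast
  show ?thesis
  proof (cases "topspace X = {}")
    case True
    then have "c = 0"
      using c by (simp add: singular_chain_empty)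
    then show ?thesis
      by (intro exI [of _ 0]) simp
  next
    case False
    then have aX: "a \<in> topspace X"
      using homotopic_with_imp_continuous_maps [OF a] by (auto simp: continuous_map_def)
    have cyc: "singular_relcycle p X {} c"
      using c by (simp add: singular_cycle)
    have "homologous_rel p X {} (chain_map p id c) (chain_map p (\<lambda>x. a) c)"
      by (rule homotopic_imp_homologous_rel_chain_maps [OF _ cyc]) (use a in \<open>simp add: homotopic_with_def\<close>)
    then have h: "homologous_rel p X {} c (chain_map p (\<lambda>x. a) c)"
      using c by (simp add: chain_map_ident)
    have "singular_relcycle p (subtopology X {a}) {} (chain_map p (\<lambda>x. a) c)"
      by (rule singular_relcycle_chain_map [OF cyc]) (use aX in auto)
    then have "singular_relboundary p (subtopology X {a}) {} (chain_map p (\<lambda>x. a) c)"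
      using singular_boundary_eq_cycle_singleton [of "subtopology X {a}" a p] aX \<open>1 \<le> p\<close> by auto
    then have "singular_relboundary p X {} (chain_map p (\<lambda>x. a) c)"
      using singular_boundary_mono [of "{a}" UNIV p X] by simp
    then have "singular_relboundary p X {} c"
      using h singular_relboundary_add unfolding homologous_rel_def
      by (metis diff_add_cancel)
    then show ?thesis
      by (simp add: singular_boundary)
  qed
qed

text \<open>The natural operator determined by its value \<open>P\<close> on the identity simplex: a
  simplex \<open>s\<close> receives the image of \<open>P\<close> under
  \<open>map_prod id s\<close>.\<close>

definition prism_extend ::
  "nat \<Rightarrow> (real \<times> (nat \<Rightarrow> real)) chain \<Rightarrow> 'b chain \<Rightarrow> (real \<times> 'b) chain" where
  "prism_extend q P c = frag_extend (\<lambda>s. chain_map (Suc q) (map_prod id s) P) c"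

text \<open>
  Acyclic models: \<open>prism q\<close> is a chain on the contractible space \<open>[0,1] \<times> \<Delta>\<^sup>q\<close> with the boundary that
  makes \<open>prism_extend\<close> a chain homotopy between the two ends of a cylinder.
\<close>

definition prism_boundary :: "nat \<Rightarrow> (real \<times> (nat \<Rightarrow> real)) chain \<Rightarrow> (real \<times> (nat \<Rightarrow> real)) chain" where
  "prism_boundary q P =
     chain_map q (Pair 1) (frag_of (identity_simplex q)) - chain_map q (Pair 0) (frag_of (identity_simplex q))
     - prism_extend (q - 1) P (chain_boundary q (frag_of (identity_simplex q)))"

primrec prism :: "nat \<Rightarrow> (real \<times> (nat \<Rightarrow> real)) chain" where
  "prism 0 = (SOME c. singular_chain 1 (simplex_cylinder 0) c \<and> chain_boundary 1 c = prism_boundary 0 0)"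
| "prism (Suc q) = (SOME c. singular_chain (Suc (Suc q)) (simplex_cylinder (Suc q)) c \<and>
     chain_boundary (Suc (Suc q)) c = prism_boundary (Suc q) (prism q))"

lemma prism_extend_0 [simp]: "prism_extend q P 0 = 0"
  by (simp add: prism_extend_def)

lemma prism_extend_of [simp]: "prism_extend q P (frag_of s) = chain_map (Suc q) (map_prod id s) P"
  by (simp add: prism_extend_def)

lemma prism_extend_diff: "prism_extend q P (c - d) = prism_extend q P c - prism_extend q P d"
  by (simp add: prism_extend_def frag_extend_diff)

lemma singular_chain_identity_simplex: "singular_chain q (simplex_space q) (frag_of (identity_simplex q))"
proof -
  have "continuous_map (simplex_space q) (simplex_space q) (identity_simplex q)"
    by (rule continuous_map_eq [of _ _ id]) auto
  then show ?thesis
    by (simp add: singular_chain_of singular_simplex_def)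
qed

lemma continuous_map_prod_simplex:
  assumes "singular_simplex q Y s"
  shows "continuous_map (simplex_cylinder q) (prod_topology unit_interval Y) (map_prod id s)"
proof -
  have "continuous_map (simplex_space q) Y s"
    using assms by (simp add: singular_simplex_def)
  then have "continuous_map (simplex_cylinder q) (prod_topology unit_interval Y) (\<lambda>(x, y). (id x, s y))"
    by (subst continuous_map_prod_top) auto
  then show ?thesis
    by (simp add: map_prod_def)
qed

lemma singular_chain_prism_extend:
  assumes P: "singular_chain (Suc q) (simplex_cylinder q) P" and c: "singular_chain q Y c"
  shows "singular_chain (Suc q) (prod_topology unit_interval Y) (prism_extend q P c)"
  unfolding prism_extend_def
proof (rule singular_chain_extend)
  fix s assume "s \<in> Poly_Mapping.keys c"
  then have "singular_simplex q Y s"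
    using c by (auto simp: singular_chain_def)
  then show "singular_chain (Suc q) (prod_topology unit_interval Y) (chain_map (Suc q) (map_prod id s) P)"
    by (intro singular_chain_chain_map [OF P] continuous_map_prod_simplex)
qed

text \<open>Naturality, from functoriality of \<open>chain_map\<close>. As
  \<open>simplex_map\<close> is cut off outside the standard simplex, the maps to be compared agree
  on the cylinder, and that is where \<open>P\<close> lives.\<close>

lemma prism_extend_chain_map:
  assumes P: "singular_chain (Suc q) (simplex_cylinder q) P" and c: "singular_chain q Y c"
  shows "chain_map (Suc q) (map_prod id f) (prism_extend q P c) = prism_extend q P (chain_map q f c)"
  using c unfolding singular_chain_def
proof (induction c rule: frag_induction)
  case (one s)
  have "chain_map (Suc q) (map_prod id f) (chain_map (Suc q) (map_prod id s) P)
     = chain_map (Suc q) (map_prod id f \<circ> map_prod id s) P"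
    by (simp add: chain_map_compose)
  also have "\<dots> = chain_map (Suc q) (map_prod id (simplex_map q f s)) P"
    by (rule chain_map_eq [OF P]) (auto simp: simplex_map_def)
  finally show ?case
    by (simp only: prism_extend_of chain_map_of)
next
  case (diff a b)
  then show ?case
    by (simp add: prism_extend_diff chain_map_diff)
qed auto

text \<open>For a single simplex \<open>s\<close> the boundary formula of the model is pushed
  forward along \<open>map_prod id s\<close>; naturality turns the side term of the identity simplex
  into that of \<open>s\<close>. In degree 0 the side term is 0, so \<open>P'\<close> is constrained
  only for \<open>q > 0\<close>.\<close>

lemma chain_boundary_prism_extend_aux:
  assumes P: "singular_chain (Suc q) (simplex_cylinder q) P"
    and P': "q > 0 \<Longrightarrow> singular_chain q (simplex_cylinder (q - 1)) P'"
    and bd: "chain_boundary (Suc q) P = prism_boundary q P'"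
    and c: "singular_chain q Y c"
  shows "chain_boundary (Suc q) (prism_extend q P c)
    = chain_map q (Pair 1) c - chain_map q (Pair 0) c - prism_extend (q - 1) P' (chain_boundary q c)"
  using c unfolding singular_chain_def
proof (induction c rule: frag_induction)
  case (one s)
  then have s: "singular_simplex q Y s" by simp
  have ends: "chain_map q (map_prod id s) (chain_map q (Pair t) (frag_of (identity_simplex q)))
      = chain_map q (Pair t) (frag_of s)" for t :: real
  proof -
    have "simplex_map q (map_prod id s) (simplex_map q (Pair t) (identity_simplex q)) = simplex_map q (Pair t) s"
      by (auto simp: simplex_map_def)
    then show ?thesis by simp
  qed
  have rest: "chain_map q (map_prod id s) (prism_extend (q - 1) P' (chain_boundary q (frag_of (identity_simplex q))))
      = prism_extend (q - 1) P' (chain_boundary q (frag_of s))"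
  proof (cases "q = 0")
    case True
    then show ?thesis by (simp add: chain_boundary_def)
  next
    case False
    then have [simp]: "Suc (q - Suc 0) = q" by simp
    have "chain_map q (map_prod id s) (prism_extend (q - 1) P' (chain_boundary q (frag_of (identity_simplex q))))
      = prism_extend (q - 1) P' (chain_map (q - 1) s (chain_boundary q (frag_of (identity_simplex q))))"
      using prism_extend_chain_map [of "q - 1" P' "simplex_space q" "chain_boundary q (frag_of (identity_simplex q))" s]
        P' False singular_chain_boundary [OF singular_chain_identity_simplex] by simp
    also have "chain_map (q - 1) s (chain_boundary q (frag_of (identity_simplex q)))
      = chain_boundary q (chain_map q s (frag_of (identity_simplex q)))"
      using chain_boundary_chain_map [OF singular_chain_identity_simplex, of q s] by simp
    also have "chain_map q s (frag_of (identity_simplex q)) = frag_of s"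
      by (rule singular_simplex_chain_map_id [OF s])
    finally show ?thesis .
  qed
  have "chain_boundary (Suc q) (prism_extend q P (frag_of s)) = chain_map q (map_prod id s) (prism_boundary q P')"
    using chain_boundary_chain_map [OF P, of "map_prod id s"] by (simp add: bd)
  then show ?case
    unfolding prism_boundary_def chain_map_diff ends rest .
next
  case (diff a b)
  then show ?case
    by (simp add: prism_extend_diff chain_map_diff chain_boundary_diff)
qed auto

text \<open>The prescribed boundary is a cycle: the boundaries of its two ends cancel against that
  of the side term, by the homotopy formula one degree lower. Contractibility of the cylinder then
  supplies a chain with this boundary.\<close>

lemma prism_step:
  fixes q P
  assumes P: "singular_chain (Suc q) (simplex_cylinder q) P"
    and P': "q > 0 \<Longrightarrow> singular_chain q (simplex_cylinder (q - 1)) P'"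
    and bd: "chain_boundary (Suc q) P = prism_boundary q P'"
  shows "\<exists>c. singular_chain (Suc (Suc q)) (simplex_cylinder (Suc q)) c \<and>
     chain_boundary (Suc (Suc q)) c = prism_boundary (Suc q) P"
proof (rule contractible_cycle_imp_boundary [OF contractible_simplex_cylinder])
  let ?i = "frag_of (identity_simplex (Suc q))"
  have i: "singular_chain (Suc q) (simplex_space (Suc q)) ?i"
    by (rule singular_chain_identity_simplex)
  have di: "singular_chain q (simplex_space (Suc q)) (chain_boundary (Suc q) ?i)"
    using singular_chain_boundary [OF i] by simp
  have ct: "continuous_map (simplex_space (Suc q)) (simplex_cylinder (Suc q)) (Pair t)" if "t \<in> {0..1}" for t
    using that by (auto simp: continuous_map_pairwise o_def)
  show "singular_chain (Suc q) (simplex_cylinder (Suc q)) (prism_boundary (Suc q) P)"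
    unfolding prism_boundary_def
    using singular_chain_prism_extend [OF P di]
    by (intro singular_chain_diff singular_chain_chain_map [OF i] ct) auto
  have ends: "chain_boundary (Suc q) (chain_map (Suc q) (Pair t) ?i)
     = chain_map q (Pair t) (chain_boundary (Suc q) ?i)" for t :: real
    using chain_boundary_chain_map [OF i] by simp
  have "chain_boundary q (chain_boundary (Suc q) ?i) = 0"
    using chain_boundary_boundary [OF i] by simp
  then show "chain_boundary (Suc q) (prism_boundary (Suc q) P) = 0"
    unfolding prism_boundary_def chain_boundary_diff ends
    using chain_boundary_prism_extend_aux [OF P P' bd di] by simp
qed simp

text \<open>In degree 0 cycles need not bound, but the two ends differ by a boundary because maps
  into a contractible space are homotopic.\<close>

lemma prism_0: "\<exists>c. singular_chain 1 (simplex_cylinder 0) c \<and> chain_boundary 1 c = prism_boundary 0 0"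
proof -
  let ?i = "frag_of (identity_simplex 0)"
  have "homotopic_with (\<lambda>h. True) (simplex_space 0) (simplex_cylinder 0) (Pair 1) (Pair 0)"
    by (rule homotopic_into_contractible_space)
       (auto simp: contractible_simplex_cylinder continuous_map_pairwise o_def)
  then have "homotopic_with (\<lambda>h. h \<in> {} \<rightarrow> {}) (simplex_space 0) (simplex_cylinder 0) (Pair 1) (Pair 0)"
    by simp
  moreover have "singular_relcycle 0 (simplex_space 0) {} ?i"
    using singular_chain_identity_simplex [of 0] by (simp add: singular_cycle chain_boundary_def)
  ultimately have "homologous_rel 0 (simplex_cylinder 0) {} (chain_map 0 (Pair 1) ?i) (chain_map 0 (Pair 0) ?i)"
    by (rule homotopic_imp_homologous_rel_chain_maps)
  moreover have "chain_boundary 0 c = 0" for c :: "(nat \<Rightarrow> real) chain"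
    by (simp add: chain_boundary_def)
  ultimately show ?thesis
    by (simp add: homologous_rel_def singular_boundary prism_boundary_def)
qed

lemma prism:
  "singular_chain (Suc q) (simplex_cylinder q) (prism q) \<and>
   chain_boundary (Suc q) (prism q) = prism_boundary q (prism (q - 1))"
proof (induction q rule: less_induct)
  case (less q)
  show ?case
  proof (cases q)
    case 0
    \<comment> \<open>Here \<open>q - 1\<close> is truncated to 0. The second argument is
      immaterial, since a 0-simplex has boundary 0.\<close>
    have "prism_boundary 0 (prism 0) = prism_boundary 0 0"
      by (simp add: prism_boundary_def chain_boundary_def)
    then show ?thesis
      using someI_ex [OF prism_0] 0 by simp
  next
    case (Suc n)
    have "\<exists>c. singular_chain (Suc (Suc n)) (simplex_cylinder (Suc n)) c \<and>
       chain_boundary (Suc (Suc n)) c = prism_boundary (Suc n) (prism n)"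
    proof (rule prism_step)
      show "singular_chain n (simplex_cylinder (n - 1)) (prism (n - 1))" if "n > 0"
        using less [of "n - 1"] that Suc by simp
    qed (use less [of n] Suc in auto)
    from someI_ex [OF this] show ?thesis
      by (simp add: Suc)
  qed
qed

lemma chain_boundary_prism_extend:
  assumes "singular_chain q Y c"
  shows "chain_boundary (Suc q) (prism_extend q (prism q) c)
    = chain_map q (Pair 1) c - chain_map q (Pair 0) c - prism_extend (q - 1) (prism (q - 1)) (chain_boundary q c)"
  using prism [of "q - 1"] prism [of q] assms by (intro chain_boundary_prism_extend_aux) auto

text \<open>The prism operator, dualised, is a cochain homotopy \<open>K\<close>. It yields relative
  cochains because the homotopy keeps \<open>T\<close> inside \<open>S\<close> at all times.\<close>

lemma homotopic_cochain_pullback: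
  assumes hom: "homotopic_with (\<lambda>h. h ` (topspace Y \<inter> T) \<subseteq> S) Y X f g" and \<phi>: "\<phi> \<in> cocycle_set p X S"
  shows "cochain_pullback p Y f \<phi> + cochain_pullback p Y g \<phi> \<in> coboundary_set p Y T"
proof -
  obtain h where h: "continuous_map (prod_topology unit_interval Y) X h"
    and h0: "\<And>x. h (0, x) = f x" and h1: "\<And>x. h (1, x) = g x"
    and hS: "\<And>t x. \<lbrakk>0 \<le> t; t \<le> 1; x \<in> topspace Y; x \<in> T\<rbrakk> \<Longrightarrow> h (t, x) \<in> S"
    using hom by (fastforce simp: homotopic_with_def)
  define K where "K q s = (if singular_simplex q Y s
    then chain_pairing \<phi> (chain_map (Suc q) h (prism_extend q (prism q) (frag_of s))) else 0)" for q s
  have key: "cochain_pullback p Y f \<phi> s + cochain_pullback p Y g \<phi> s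
     = chain_pairing \<phi> (chain_map p h (prism_extend (p - 1) (prism (p - 1)) (chain_boundary p (frag_of s))))"
    if s: "singular_simplex p Y s" for s
  proof -
    have c: "singular_chain p Y (frag_of s)"
      using s by (simp add: singular_chain_of)
    let ?c = "prism_extend p (prism p) (frag_of s)"
    have c': "singular_chain (Suc p) (prod_topology unit_interval Y) ?c"
      by (rule singular_chain_prism_extend [OF _ c]) (simp add: prism)
    \<comment> \<open>The cocycle condition is evaluated on the image of the prism over
      \<open>s\<close>, whose boundary consists of the two ends and the sides.\<close>
    have "0 = chain_pairing (coboundary p X \<phi>) (chain_map (Suc p) h ?c)"
      using \<phi> by (simp add: cocycle_set_iff chain_pairing_def)
    also have "\<dots> = chain_pairing \<phi> (chain_map p h (chain_boundary (Suc p) ?c))"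
      using coboundary_pairing [OF singular_chain_chain_map [OF c' h]] chain_boundary_chain_map [OF c', of h] by simp
    also have "\<dots> = chain_pairing \<phi> (chain_map p h (chain_map p (Pair 1) (frag_of s)))
       + chain_pairing \<phi> (chain_map p h (chain_map p (Pair 0) (frag_of s)))
       + chain_pairing \<phi> (chain_map p h (prism_extend (p - 1) (prism (p - 1)) (chain_boundary p (frag_of s))))"
      unfolding chain_boundary_prism_extend [OF c] chain_map_diff chain_pairing_diff ..
    also have "chain_pairing \<phi> (chain_map p h (chain_map p (Pair 1) (frag_of s))) = cochain_pullback p Y g \<phi> s"
      using s h1 by (auto simp: cochain_pullback_def simplex_map_def intro!: arg_cong [of _ _ \<phi>])
    also have "chain_pairing \<phi> (chain_map p h (chain_map p (Pair 0) (frag_of s))) = cochain_pullback p Y f \<phi> s"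
      using s h0 by (auto simp: cochain_pullback_def simplex_map_def intro!: arg_cong [of _ _ \<phi>])
    finally have "0 = cochain_pullback p Y g \<phi> s + cochain_pullback p Y f \<phi> s
       + chain_pairing \<phi> (chain_map p h (prism_extend (p - 1) (prism (p - 1)) (chain_boundary p (frag_of s))))" .
    moreover have "x + y = z" if "0 = y + x + z" for x y z :: bit
      using that by (cases x; cases y; cases z) auto
    ultimately show ?thesis by blast
  qed
  show ?thesis
  proof (cases p)
    case 0
    \<comment> \<open>In degree 0 the only coboundary is 0, so the pullbacks have to agree exactly;
      they do, because a prism over a point has no sides.\<close>
    have "cochain_pullback p Y f \<phi> + cochain_pullback p Y g \<phi> = 0"
    proof
      fix s
      show "(cochain_pullback p Y f \<phi> + cochain_pullback p Y g \<phi>) s = 0 s"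
      proof (cases "singular_simplex p Y s")
        case True
        then show ?thesis
          using key [OF True] by (simp add: 0 chain_boundary_def)
      qed (simp add: cochain_pullback_def)
    qed
    then show ?thesis by simp
  next
    case (Suc q)
    have "K q s = 0" if s: "singular_simplex q (subtopology Y T) s" for s
    proof -
      have "singular_chain (Suc q) (prod_topology unit_interval (subtopology Y T)) (prism_extend q (prism q) (frag_of s))"
        by (rule singular_chain_prism_extend) (use s in \<open>simp_all add: prism singular_chain_of\<close>)
      moreover have "continuous_map (prod_topology unit_interval (subtopology Y T)) (subtopology X S) h"
        unfolding continuous_map_in_subtopology
      proof
        have "prod_topology unit_interval (subtopology Y T) = subtopology (prod_topology unit_interval Y) ({0..1} \<times> T)"
          by (auto simp: prod_topology_subtopology subtopology_subtopology intro: arg_cong2 [of _ _ _ _ subtopology])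
        then show "continuous_map (prod_topology unit_interval (subtopology Y T)) X h"
          using h by (simp add: continuous_map_from_subtopology)
      qed (use hS in auto)
      ultimately have "singular_chain (Suc q) (subtopology X S) (chain_map (Suc q) h (prism_extend q (prism q) (frag_of s)))"
        by (rule singular_chain_chain_map)
      then have "chain_pairing \<phi> (chain_map (Suc q) h (prism_extend q (prism q) (frag_of s))) = 0"
        using \<phi> by (intro chain_pairing_eq_0) (auto simp: cocycle_set_iff Suc)
      then show ?thesis by (simp add: K_def)
    qed
    then have "K q \<in> cochain_set q Y T"
      by (simp add: cochain_set_def K_def)
    moreover have "cochain_pullback p Y f \<phi> + cochain_pullback p Y g \<phi> = coboundary q Y (K q)"
    proof
      fix s
      show "(cochain_pullback p Y f \<phi> + cochain_pullback p Y g \<phi>) s = coboundary q Y (K q) s"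
      proof (cases "singular_simplex p Y s")
        case True
        have "(cochain_pullback p Y f \<phi> + cochain_pullback p Y g \<phi>) s
          = chain_pairing \<phi> (chain_map p h (prism_extend q (prism q) (chain_boundary p (frag_of s))))"
          using key [OF True] by (simp add: Suc)
        also have "\<dots> = (\<Sum>k\<le>Suc q. chain_pairing \<phi> (chain_map p h (prism_extend q (prism q) (frag_of (singular_face p k s)))))"
          by (simp add: chain_boundary_of Suc prism_extend_def frag_extend_sum frag_extend_cmul chain_map_sum
              chain_pairing_sum chain_pairing_add chain_map_add frag_extend_add o_def)
        also have "\<dots> = coboundary q Y (K q) s"
          using True singular_simplex_singular_face [OF True]
          by (auto simp: coboundary_def K_def Suc simp del: sum.atMost_Suc intro!: sum.cong)
        finally show ?thesis .
      qed (auto simp: cochain_pullback_def coboundary_def Suc)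
    qed
    ultimately show ?thesis
      by (auto simp: Suc coboundary_set_Suc)
  qed
qed

section \<open>Lifting simplices to a double covering\<close>

lemma convex_combination_bounds:
  fixes a :: real
  assumes "a \<le> x" "x \<le> b" "a \<le> y" "y \<le> b" "0 \<le> u" "u \<le> 1"
  shows "a \<le> (1 - u) * x + u * y \<and> (1 - u) * x + u * y \<le> b"
  using convex_bound_le [of x b y "1 - u" u] convex_bound_le [of "- x" "- a" "- y" "1 - u" u] assms by auto

lemma connected_convex_combinations:
  fixes S :: "(nat \<Rightarrow> real) set"
  assumes "\<And>x y u. x \<in> S \<Longrightarrow> y \<in> S \<Longrightarrow> 0 \<le> u \<Longrightarrow> u \<le> 1 \<Longrightarrow> (\<lambda>i. (1 - u) * x i + u * y i) \<in> S"
  shows "connected S"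
proof (rule path_connected_imp_connected)
  show "path_connected S"
    unfolding path_connected_def
  proof (intro ballI)
    fix x y assume "x \<in> S" "y \<in> S"
    let ?\<gamma> = "\<lambda>u i. (1 - u) * x i + u * y i"
    have "path ?\<gamma>"
      unfolding path_def by (intro continuous_intros)
    moreover have "path_image ?\<gamma> \<subseteq> S"
      using assms [OF \<open>x \<in> S\<close> \<open>y \<in> S\<close>] by (auto simp: path_image_def)
    ultimately show "\<exists>\<gamma>. path \<gamma> \<and> path_image \<gamma> \<subseteq> S \<and> pathstart \<gamma> = x \<and> pathfinish \<gamma> = y"
      by (intro exI [of _ ?\<gamma>]) (auto simp: pathstart_def pathfinish_def)
  qed
qed

text \<open>The metric weights the coordinates by \<open>(1/2)^n\<close>; the factor 2 is the sum of
  these weights.\<close>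

lemma dist_fun_le:
  fixes x y :: "nat \<Rightarrow> real"
  assumes "\<And>i. \<bar>x i - y i\<bar> \<le> \<epsilon>"
  shows "dist x y \<le> 2 * \<epsilon>"
proof -
  have s: "summable (\<lambda>n. (1/2)^n * \<epsilon>)"
    by (intro summable_mult2) (simp add: summable_geometric_iff)
  have le: "(1/2)^n * min (dist (x (from_nat n)) (y (from_nat n))) 1 \<le> (1/2)^n * \<epsilon>" for n
    using assms [of "from_nat n"] by (intro mult_left_mono) (auto simp: dist_real_def)
  have "summable (\<lambda>n. (1/2)^n * min (dist (x (from_nat n)) (y (from_nat n))) 1)"
    by (rule summable_comparison_test' [OF s, of 0]) (use le in \<open>auto simp: abs_mult\<close>)
  then have "dist x y \<le> suminf (\<lambda>n. (1/2)^n * \<epsilon>)"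
    unfolding dist_fun_def by (rule suminf_le [OF le _ s])
  also have "\<dots> = 2 * \<epsilon>"
    using suminf_mult2 [of "\<lambda>n. (1/2::real)^n" \<epsilon>] suminf_geometric [of "1/2::real"]
    by (simp add: summable_geometric_iff)
  finally show ?thesis .
qed

lemma compact_standard_simplex: "compact (standard_simplex p)"
  using compactin_standard_simplex by (simp add: euclidean_product_topology)

lemma closed_standard_simplex: "closed (standard_simplex p)"
  using closedin_standard_simplex by (simp add: euclidean_product_topology)

text \<open>With a Lebesgue number \<open>e\<close> of the cover, \<open>N > 2 / e\<close> works,
  since a coordinatewise bound \<open>1 / N\<close> gives distance at most \<open>2 / N\<close>.
  Coordinates beyond \<open>p\<close> vanish on the simplex.\<close>

lemma simplex_grid_fine:
  assumes op: "\<And>W. W \<in> \<W> \<Longrightarrow> open W" and cov: "standard_simplex p \<subseteq> \<Union>\<W>"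
  obtains N :: nat where "N > 0"
    "\<And>A. A \<subseteq> standard_simplex p \<Longrightarrow>
      (\<And>x y i. x \<in> A \<Longrightarrow> y \<in> A \<Longrightarrow> i \<le> p \<Longrightarrow> \<bar>x i - y i\<bar> \<le> 1 / real N) \<Longrightarrow> A \<noteq> {} \<Longrightarrow> \<exists>W\<in>\<W>. A \<subseteq> W"
proof -
  obtain e where e: "0 < e" "\<And>x. x \<in> standard_simplex p \<Longrightarrow> \<exists>W\<in>\<W>. ball x e \<subseteq> W"
    using Heine_Borel_lemma [OF compact_standard_simplex cov op] by blast
  obtain N :: nat where N: "2 / e < real N"
    using reals_Archimedean2 by blast
  moreover have "N > 0"
    using N e(1) by (auto intro: Nat.gr0I simp: divide_less_0_iff)
  ultimately have "2 * (1 / real N) < e"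
    using e(1) by (simp add: field_simps)
  show ?thesis
  proof
    show "N > 0" by fact
  next
    fix A assume A: "A \<subseteq> standard_simplex p" "A \<noteq> {}"
      and small: "\<And>x y i. x \<in> A \<Longrightarrow> y \<in> A \<Longrightarrow> i \<le> p \<Longrightarrow> \<bar>x i - y i\<bar> \<le> 1 / real N"
    then obtain x where x: "x \<in> A" by blast
    have "y \<in> ball x e" if "y \<in> A" for y
    proof -
      have "\<bar>x i - y i\<bar> \<le> 1 / real N" for i
      proof (cases "i \<le> p")
        case False
        then have "x i = 0" "y i = 0"
          using A x that by (auto simp: standard_simplex_def)
        then show ?thesis by simp
      qed (use small x that in auto)
      then have "dist x y \<le> 2 * (1 / real N)"
        by (rule dist_fun_le)
      with \<open>2 * (1 / real N) < e\<close> show ?thesis by simp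
    qed
    moreover obtain W where "W \<in> \<W>" "ball x e \<subseteq> W"
      using e(2) x A by blast
    ultimately show "\<exists>W\<in>\<W>. A \<subseteq> W" by blast
  qed
qed

text \<open>
  The sets \<open>{e. \<xi> e i > 0}\<close> cover every orbit and are mapped homeomorphically to open sets of the orbit
  space; this is all the local triviality that lifting simplices needs.
\<close>

locale antipodal_space =
  fixes E :: "'e topology" and g :: "'e \<Rightarrow> 'e" and \<xi> :: "'e \<Rightarrow> nat \<Rightarrow> real"
  assumes continuous_involution: "continuous_map E E g"
    and involution: "\<And>e. e \<in> topspace E \<Longrightarrow> g (g e) = e"
    and continuous_coordinate: "\<And>i. continuous_map E euclideanreal (\<lambda>e. \<xi> e i)"
    and coordinate_involution: "\<And>e i. e \<in> topspace E \<Longrightarrow> \<xi> (g e) i = - \<xi> e i"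
    and coordinate_nonzero: "\<And>e. e \<in> topspace E \<Longrightarrow> \<exists>i. \<xi> e i \<noteq> 0"
begin

abbreviation "B \<equiv> orbit_space E g"
abbreviation "q \<equiv> orbit g"

lemma involution_in [simp]: "e \<in> topspace E \<Longrightarrow> g e \<in> topspace E"
  using continuous_involution by (auto simp: continuous_map_def)

lemma orbit_involution [simp]: "e \<in> topspace E \<Longrightarrow> q (g e) = q e"
  by (auto simp: orbit_def involution)

lemma orbit_eq_iff:
  assumes "e \<in> topspace E" "e' \<in> topspace E"
  shows "q e = q e' \<longleftrightarrow> e' = e \<or> e' = g e"
  using assms involution by (auto simp: orbit_def doubleton_eq_iff)

lemma quotient_map_orbit: "quotient_map E B q"
  unfolding orbit_space_def by (rule quotient_map_quotient_topology)

lemma continuous_map_orbit: "continuous_map E B q"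
  by (rule quotient_imp_continuous_map [OF quotient_map_orbit])

lemma topspace_B: "topspace B = q ` topspace E"
  by (simp add: orbit_space_def)

text \<open>The saturation of an open set \<open>U\<close> is the union of \<open>U\<close> and its
  preimage under \<open>g\<close>.\<close>

lemma open_map_orbit: "open_map E B q"
  unfolding open_map_def
proof (intro allI impI)
  fix U assume U: "openin E U"
  have "{x \<in> topspace E. q x \<in> q ` U} = U \<union> {x \<in> topspace E. g x \<in> U}"
    using openin_subset [OF U] by (auto simp: orbit_eq_iff image_iff) (metis orbit_involution subsetD)+
  moreover have "openin E {x \<in> topspace E. g x \<in> U}"
    by (rule openin_continuous_map_preimage [OF continuous_involution U])
  ultimately have "openin E {x \<in> topspace E. q x \<in> q ` U}"
    using U openin_Un by metis
  then show "openin B (q ` U)"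
    using openin_subset [OF U] by (auto simp: orbit_space_def openin_quotient_topology)
qed

definition chart :: "nat \<Rightarrow> 'e set" where
  "chart i = {e \<in> topspace E. \<xi> e i > 0}"

lemma openin_chart: "openin E (chart i)"
  unfolding chart_def
  using openin_continuous_map_preimage [OF continuous_coordinate, of "{0<..}" i] by simp

text \<open>\<open>\<xi>\<close> changes sign under \<open>g\<close>, so an orbit meets a chart at
  most once; an injective open continuous map has a continuous inverse on its image.\<close>

lemma section_on_chart:
  "\<exists>r. continuous_map (subtopology B (q ` chart i)) E r \<and> (\<forall>b\<in>q ` chart i. q (r b) = b)"
proof -
  have sub: "chart i \<subseteq> topspace E" by (auto simp: chart_def)
  have "embedding_map (subtopology E (chart i)) B q"
  proof (rule injective_open_imp_embedding_map)
    show "continuous_map (subtopology E (chart i)) B q"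
      by (rule continuous_map_from_subtopology [OF continuous_map_orbit])
    show "open_map (subtopology E (chart i)) B q"
      using open_map_orbit openin_chart by (auto simp: open_map_def openin_open_subtopology)
    show "inj_on q (topspace (subtopology E (chart i)))"
      by (auto simp: inj_on_def chart_def orbit_eq_iff coordinate_involution)
  qed
  then have "homeomorphic_map (subtopology E (chart i)) (subtopology B (q ` chart i)) q"
    using sub by (simp add: embedding_map_def Int_absorb1)
  then obtain r where r: "homeomorphic_maps (subtopology E (chart i)) (subtopology B (q ` chart i)) q r"
    using homeomorphic_map_maps by blast
  have "q ` chart i \<subseteq> topspace B"
    using sub topspace_B by auto
  then show ?thesis
    using r by (intro exI [of _ r])
      (auto simp: homeomorphic_maps_def continuous_map_in_subtopology Int_absorb1)
qed

definition lifts :: "((nat \<Rightarrow> real) \<Rightarrow> 'e set) \<Rightarrow> (nat \<Rightarrow> real) set \<Rightarrow> ((nat \<Rightarrow> real) \<Rightarrow> 'e) \<Rightarrow> bool" where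
  "lifts s A h \<longleftrightarrow> continuous_map (top_of_set A) E h \<and> (\<forall>t\<in>A. q (h t) = s t)"

lemma lifts_in: "lifts s A h \<Longrightarrow> t \<in> A \<Longrightarrow> h t \<in> topspace E"
  by (auto simp: lifts_def continuous_map_def)

lemma lifts_subset: "lifts s A h \<Longrightarrow> A' \<subseteq> A \<Longrightarrow> lifts s A' h"
  unfolding lifts_def by (metis continuous_map_from_subtopology_mono subsetD)

lemma lifts_involution: "lifts s A h \<Longrightarrow> lifts s A (g \<circ> h)"
  using lifts_in [of s A h]
  by (auto simp: lifts_def intro: continuous_map_compose [OF _ continuous_involution])

lemma lifts_chart:
  assumes s: "continuous_map (top_of_set A) B s" and sub: "s ` A \<subseteq> q ` chart i"
  shows "\<exists>h. lifts s A h"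
proof -
  obtain r where r: "continuous_map (subtopology B (q ` chart i)) E r" "\<forall>b\<in>q ` chart i. q (r b) = b"
    using section_on_chart by blast
  have "continuous_map (top_of_set A) (subtopology B (q ` chart i)) s"
    using s sub by (simp add: continuous_map_in_subtopology image_subset_iff_funcset)
  then have "lifts s A (r \<circ> s)"
    using r sub by (auto simp: lifts_def intro: continuous_map_compose)
  then show ?thesis by blast
qed

text \<open>At each point two lifts are equal or differ by \<open>g\<close>. The signs of the
  products \<open>\<xi> (h t) i * \<xi> (k t) i\<close> tell which, so each alternative holds on an
  open set, and connectedness leaves only one.\<close>

lemma lifts_unique:
  assumes A: "connected A" and h: "lifts s A h" and k: "lifts s A k"
  shows "(\<forall>t\<in>A. k t = h t) \<or> (\<forall>t\<in>A. k t = g (h t))"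
proof -
  define P where "P = {t \<in> A. \<exists>i. \<xi> (h t) i * \<xi> (k t) i > 0}"
  define N where "N = {t \<in> A. \<exists>i. \<xi> (h t) i * \<xi> (k t) i < 0}"
  have cont: "continuous_map (top_of_set A) euclideanreal (\<lambda>t. \<xi> (h t) i * \<xi> (k t) i)" for i
  proof (intro continuous_intros)
    show "continuous_map (top_of_set A) euclideanreal (\<lambda>t. \<xi> (h t) i)"
      using continuous_map_compose [OF _ continuous_coordinate, of "top_of_set A" h i] h
      unfolding lifts_def o_def by blast
    show "continuous_map (top_of_set A) euclideanreal (\<lambda>t. \<xi> (k t) i)"
      using continuous_map_compose [OF _ continuous_coordinate, of "top_of_set A" k i] k
      unfolding lifts_def o_def by blast
  qed
  have "P = (\<Union>i. {t \<in> topspace (top_of_set A). \<xi> (h t) i * \<xi> (k t) i \<in> {0<..}})"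
    by (auto simp: P_def)
  then have openP: "openin (top_of_set A) P"
    using openin_continuous_map_preimage [OF cont, of "{0<..}"] by (auto intro!: openin_Union)
  have "N = (\<Union>i. {t \<in> topspace (top_of_set A). \<xi> (h t) i * \<xi> (k t) i \<in> {..<0}})"
    by (auto simp: N_def)
  then have openN: "openin (top_of_set A) N"
    using openin_continuous_map_preimage [OF cont, of "{..<0}"] by (auto intro!: openin_Union)
  have cases: "(k t = h t \<and> t \<in> P \<and> t \<notin> N) \<or> (k t = g (h t) \<and> t \<in> N \<and> t \<notin> P)" if t: "t \<in> A" for t
  proof -
    have ht: "h t \<in> topspace E" and kt: "k t \<in> topspace E"
      using lifts_in h k t by auto
    have "q (h t) = q (k t)"
      using h k t by (simp add: lifts_def)
    then have "k t = h t \<or> k t = g (h t)"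
      using orbit_eq_iff ht kt by blast
    moreover obtain i where "\<xi> (h t) i \<noteq> 0"
      using coordinate_nonzero ht by blast
    then have "\<xi> (h t) i * \<xi> (h t) i > 0"
      by (auto simp: zero_less_mult_iff)
    moreover have "\<not> (x * x < (0::real))" for x
      by (simp add: mult_less_0_iff)
    ultimately show ?thesis
      using t ht by (auto simp: P_def N_def coordinate_involution)
  qed
  then have "A \<subseteq> P \<union> N" "P \<inter> N = {}"
    by (auto simp: P_def N_def)
  then have "P = {} \<or> N = {}"
    using A openP openN unfolding connected_openin by blast
  then show ?thesis
    using cases by blast
qed

text \<open>If the lifts differ by \<open>g\<close> on the connected overlap, \<open>h2\<close> is
  replaced by \<open>g \<circ> h2\<close>; after that they agree there and can be pasted along
  closed sets.\<close>

lemma lifts_union: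
  assumes cl: "closed A1" "closed A2" and conn: "connected (A1 \<inter> A2)"
    and h1: "lifts s A1 h1" and h2: "lifts s A2 h2"
  shows "\<exists>h. lifts s (A1 \<union> A2) h"
proof -
  have "lifts s (A1 \<inter> A2) h1" "lifts s (A1 \<inter> A2) h2"
    using h1 h2 lifts_subset by auto
  from lifts_unique [OF conn this]
  obtain k where k: "lifts s A2 k" and eq: "\<forall>t\<in>A1 \<inter> A2. k t = h1 t"
  proof
    assume "\<forall>t\<in>A1 \<inter> A2. h2 t = h1 t"
    with h2 show ?thesis using that by blast
  next
    assume *: "\<forall>t\<in>A1 \<inter> A2. h2 t = g (h1 t)"
    have "lifts s A2 (g \<circ> h2)"
      using h2 by (rule lifts_involution)
    moreover have "\<forall>t\<in>A1 \<inter> A2. (g \<circ> h2) t = h1 t"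
      using * lifts_in [OF h1] by (auto simp: involution)
    ultimately show ?thesis using that by blast
  qed
  define h where "h t = (if t \<in> A1 then h1 t else k t)" for t
  have "continuous_map (top_of_set (A1 \<union> A2)) E h"
  proof (rule pasting_lemma_closed [where I = "UNIV :: bool set" and T = "\<lambda>b. if b then A1 else A2" and f = "\<lambda>b. if b then h1 else k"])
    show "closedin (top_of_set (A1 \<union> A2)) (if b then A1 else A2)" for b
      using cl by (auto intro: closed_subset)
    show "continuous_map (subtopology (top_of_set (A1 \<union> A2)) (if b then A1 else A2)) E (if b then h1 else k)" for b
      using h1 k by (auto simp: lifts_def subtopology_subtopology Int_absorb1)
  qed (use eq in \<open>auto simp: h_def split: if_splits\<close>)
  then have "lifts s (A1 \<union> A2) h"
    using h1 k by (auto simp: lifts_def h_def)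
  then show ?thesis by blast
qed

text \<open>
  Every cell of a sufficiently fine grid lies over one chart. The lifts over the cells are glued one
  coordinate direction at a time; adjacent pieces meet in a convex set, where two lifts agree up to \<open>g\<close>.
\<close>

lemma simplex_lifts:
  assumes s: "continuous_map (top_of_set (standard_simplex p)) B s"
  shows "\<exists>h. lifts s (standard_simplex p) h"
proof -
  let ?K = "standard_simplex p"
  \<comment> \<open>Open sets on which \<open>s\<close> stays in the image of a single chart; they
    cover the simplex, and the mesh of the grid is chosen for this cover.\<close>
  define \<W> where "\<W> = {W. open W \<and> (\<exists>i. s ` (?K \<inter> W) \<subseteq> q ` chart i)}"
  have "?K \<subseteq> \<Union>\<W>"
  proof
    fix t assume t: "t \<in> ?K"
    then have "s t \<in> topspace B"
      using s by (auto simp: continuous_map_def)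
    then obtain e where e: "e \<in> topspace E" "s t = q e"
      by (auto simp: topspace_B)
    obtain i where i: "\<xi> e i \<noteq> 0"
      using coordinate_nonzero e by blast
    have "s t \<in> q ` chart i"
    proof (cases "\<xi> e i > 0")
      case True
      then show ?thesis using e by (auto simp: chart_def)
    next
      case False
      then have "g e \<in> chart i" using i e by (auto simp: chart_def coordinate_involution)
      then show ?thesis using e by (metis image_eqI orbit_involution)
    qed
    moreover have "openin (top_of_set ?K) {x \<in> topspace (top_of_set ?K). s x \<in> q ` chart i}"
      using open_map_orbit openin_chart by (intro openin_continuous_map_preimage [OF s]) (auto simp: open_map_def)
    then obtain W where "open W" "{x \<in> ?K. s x \<in> q ` chart i} = ?K \<inter> W"
      by (auto simp: openin_open)
    ultimately show "t \<in> \<Union>\<W>"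
      using t by (auto simp: \<W>_def)
  qed
  then obtain N :: nat where N: "N > 0" and small: "\<And>A. A \<subseteq> ?K \<Longrightarrow>
      (\<And>x y i. x \<in> A \<Longrightarrow> y \<in> A \<Longrightarrow> i \<le> p \<Longrightarrow> \<bar>x i - y i\<bar> \<le> 1 / real N) \<Longrightarrow> A \<noteq> {} \<Longrightarrow> \<exists>W\<in>\<W>. A \<subseteq> W"
    using simplex_grid_fine [of \<W> p] by (metis (no_types, lifting) \<W>_def mem_Collect_eq)
  \<comment> \<open>Coordinates from \<open>j\<close> on are confined to intervals of length
    \<open>1 / N\<close>, those below \<open>j\<close> are free. Thus \<open>cell 0 m\<close> is one
    grid cell and \<open>cell (Suc p) m\<close> is the whole simplex.\<close>
  define cell where "cell j m = {x \<in> ?K. \<forall>i. j \<le> i \<and> i \<le> p \<longrightarrow> real (m i) / N \<le> x i \<and> x i \<le> real (m i + 1) / N}"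
    for j and m :: "nat \<Rightarrow> nat"
  have closed_le: "closed {x :: nat \<Rightarrow> real. x i \<le> c}" "closed {x :: nat \<Rightarrow> real. c \<le> x i}" for i c
    by (auto intro!: closed_Collect_le continuous_on_const)
  have closed_cell: "closed (cell j m)" for j m
  proof -
    have "cell j m = ?K \<inter> (\<Inter>i\<in>{j..p}. {x. real (m i) / N \<le> x i} \<inter> {x. x i \<le> real (m i + 1) / N})"
      by (auto simp: cell_def)
    then show ?thesis
      by (auto intro!: closed_Int closed_INT closed_standard_simplex closed_le)
  qed
  have convex_cell: "(\<lambda>i. (1 - u) * x i + u * y i) \<in> cell j m"
    if "x \<in> cell j m" "y \<in> cell j m" "0 \<le> u" "u \<le> 1" for j m x y u
  proof -
    have "real (m i) / N \<le> (1 - u) * x i + u * y i \<and> (1 - u) * x i + u * y i \<le> real (m i + 1) / N"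
      if "j \<le> i" "i \<le> p" for i
      using that \<open>x \<in> cell j m\<close> \<open>y \<in> cell j m\<close> \<open>0 \<le> u\<close> \<open>u \<le> 1\<close>
      by (intro convex_combination_bounds) (auto simp: cell_def)
    then show ?thesis
      using that by (simp add: cell_def convex_standard_simplex)
  qed
  have "\<exists>h. lifts s (cell j m) h" if "j \<le> Suc p" for j m
    using that
  proof (induction j arbitrary: m)
    case 0
    show ?case
    proof (cases "cell 0 m = {}")
      case False
      have "\<exists>W\<in>\<W>. cell 0 m \<subseteq> W"
      proof (rule small)
        show "\<bar>x i - y i\<bar> \<le> 1 / real N" if "x \<in> cell 0 m" "y \<in> cell 0 m" "i \<le> p" for x y i
        proof -
          have "real (m i) / N \<le> x i" "x i \<le> real (m i) / N + 1 / N" "real (m i) / N \<le> y i" "y i \<le> real (m i) / N + 1 / N"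
            using that by (auto simp: cell_def add_divide_distrib)
          then show ?thesis by linarith
        qed
      qed (use False in \<open>auto simp: cell_def\<close>)
      then obtain i where "s ` cell 0 m \<subseteq> q ` chart i"
        by (fastforce simp: \<W>_def cell_def)
      moreover have "continuous_map (top_of_set (cell 0 m)) B s"
        using s by (rule continuous_map_from_subtopology_mono) (auto simp: cell_def)
      ultimately show ?thesis
        by (intro lifts_chart)
    qed (simp add: lifts_def)
  next
    case (Suc j)
    then have j: "j \<le> p" by simp
    \<comment> \<open>Coordinate \<open>j\<close> is released by a sweep: slabs of width
      \<open>1 / N\<close> are added one after another, and \<open>n = N\<close> exhausts the
      simplex because coordinates are at most 1.\<close>
    have "\<exists>h. lifts s (cell (Suc j) m \<inter> {x. x j \<le> real n / N}) h" for n
    proof (induction n)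
      case 0
      \<comment> \<open>Coordinates are nonnegative, so the sweep starts on the face
        \<open>x j = 0\<close>, which is part of the slab with index 0.\<close>
      have sub: "cell (Suc j) m \<inter> {x. x j \<le> real 0 / N} \<subseteq> cell j (m(j := 0))"
      proof
        fix x assume x: "x \<in> cell (Suc j) m \<inter> {x. x j \<le> real 0 / N}"
        then have "x j \<ge> 0" "x j \<le> 0"
          by (auto simp: cell_def standard_simplex_def)
        with x show "x \<in> cell j (m(j := 0))"
          by (auto simp: cell_def Suc_le_eq)
      qed
      obtain h where "lifts s (cell j (m(j := 0))) h"
        using Suc by fastforce
      from lifts_subset [OF this sub] show ?case by blast
    next
      case (Suc n)
      let ?A1 = "cell (Suc j) m \<inter> {x. x j \<le> real n / N}" and ?A2 = "cell j (m(j := n))"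
      obtain h1 where h1: "lifts s ?A1 h1"
        using Suc by blast
      obtain h2 where h2: "lifts s ?A2 h2"
        using Suc.prems \<open>\<And>m. j \<le> Suc p \<Longrightarrow> \<exists>a. lifts s (cell j m) a\<close> j by fastforce
      have "connected (?A1 \<inter> ?A2)"
      proof (rule connected_convex_combinations)
        fix x y u assume x: "x \<in> ?A1 \<inter> ?A2" and y: "y \<in> ?A1 \<inter> ?A2" and u: "0 \<le> u" "u \<le> (1::real)"
        have "(1 - u) * x j + u * y j \<le> real n / N"
          using x y u by (intro convex_bound_le) auto
        then show "(\<lambda>i. (1 - u) * x i + u * y i) \<in> ?A1 \<inter> ?A2"
          using x y u by (auto simp: convex_cell)
      qed
      then obtain h where h: "lifts s (?A1 \<union> ?A2) h"
        using lifts_union [OF _ closed_cell _ h1 h2] closed_cell closed_le by blast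
      have "cell (Suc j) m \<inter> {x. x j \<le> real (Suc n) / N} \<subseteq> ?A1 \<union> ?A2"
      proof
        fix x assume x: "x \<in> cell (Suc j) m \<inter> {x. x j \<le> real (Suc n) / N}"
        show "x \<in> ?A1 \<union> ?A2"
        proof (cases "x j \<le> real n / N")
          case False
          have "real ((m(j := n)) i) / N \<le> x i \<and> x i \<le> real ((m(j := n)) i + 1) / N"
            if "j \<le> i" "i \<le> p" for i
            using x that False by (cases "i = j") (auto simp: cell_def)
          then show ?thesis
            using x by (simp add: cell_def)
        qed (use x in auto)
      qed
      from lifts_subset [OF h this] show ?case by blast
    qed
    from this [of N] obtain h where h: "lifts s (cell (Suc j) m \<inter> {x. x j \<le> 1}) h"
      using N by auto
    have "cell (Suc j) m \<subseteq> cell (Suc j) m \<inter> {x. x j \<le> 1}"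
      by (auto simp: cell_def standard_simplex_def)
    from lifts_subset [OF h this] show ?case by blast
  qed
  from this [of "Suc p" "\<lambda>i. 0"] show ?thesis
    by (simp add: cell_def)
qed

lemma singular_simplex_lift:
  assumes "singular_simplex p B s"
  shows "\<exists>s'. singular_simplex p E s' \<and> simplex_map p q s' = s"
proof -
  have "continuous_map (top_of_set (standard_simplex p)) B s"
    using assms by (simp add: singular_simplex_def euclidean_product_topology)
  then obtain h where h: "lifts s (standard_simplex p) h"
    using simplex_lifts by blast
  have "continuous_map (simplex_space p) E (restrict h (standard_simplex p))"
    by (rule continuous_map_eq [of _ _ h]) (use h in \<open>auto simp: lifts_def euclidean_product_topology\<close>)
  moreover have "simplex_map p q (restrict h (standard_simplex p)) = s"
    using h assms by (auto simp: simplex_map_def lifts_def singular_simplex_def fun_eq_iff extensional_def)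
  ultimately show ?thesis
    by (intro exI [of _ "restrict h (standard_simplex p)"]) (simp add: singular_simplex_def)
qed

lemma singular_simplex_lift_unique:
  assumes s: "singular_simplex p E s" and s': "singular_simplex p E s'"
    and eq: "simplex_map p q s = simplex_map p q s'"
  shows "s' = s \<or> s' = simplex_map p g s"
proof -
  have "connected (standard_simplex p)"
    using connectedin_standard_simplex [of p] by (simp add: euclidean_product_topology)
  moreover have "lifts (simplex_map p q s) (standard_simplex p) s"
    using s by (simp add: lifts_def singular_simplex_def euclidean_product_topology simplex_map_def)
  moreover have "lifts (simplex_map p q s) (standard_simplex p) s'"
    using s' unfolding eq by (simp add: lifts_def singular_simplex_def euclidean_product_topology simplex_map_def)
  ultimately have "(\<forall>t\<in>standard_simplex p. s' t = s t) \<or> (\<forall>t\<in>standard_simplex p. s' t = g (s t))"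
    by (rule lifts_unique)
  then show ?thesis
  proof (elim disjE)
    assume "\<forall>t\<in>standard_simplex p. s' t = s t"
    then have "s' = s"
      using s s' by (intro extensionalityI [of _ "standard_simplex p"]) (auto simp: singular_simplex_def)
    then show ?thesis ..
  next
    assume "\<forall>t\<in>standard_simplex p. s' t = g (s t)"
    then have "s' = simplex_map p g s"
      using s' by (intro extensionalityI [of _ "standard_simplex p"])
        (auto simp: singular_simplex_def simplex_map_def)
    then show ?thesis ..
  qed
qed

end

section \<open>The transfer sequence\<close>

context antipodal_space
begin

text \<open>An arbitrary choice between the two lifts; the cochains built from it turn out to be
  independent of this choice.\<close>

definition lift :: "nat \<Rightarrow> ((nat \<Rightarrow> real) \<Rightarrow> 'e set) \<Rightarrow> (nat \<Rightarrow> real) \<Rightarrow> 'e" where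
  "lift p s = (SOME s'. singular_simplex p E s' \<and> simplex_map p q s' = s)"

lemma
  assumes "singular_simplex p B s"
  shows singular_simplex_lift': "singular_simplex p E (lift p s)"
    and simplex_map_lift: "simplex_map p q (lift p s) = s"
  using someI_ex [OF singular_simplex_lift [OF assms]] by (auto simp: lift_def)

lemma simplex_map_orbit_involution:
  assumes "singular_simplex p E s"
  shows "simplex_map p q (simplex_map p g s) = simplex_map p q s"
  using singular_simplex_image [OF assms] by (auto simp: simplex_map_def fun_eq_iff)

lemma simplex_map_involution:
  assumes "singular_simplex p E s"
  shows "simplex_map p g (simplex_map p g s) = s"
proof -
  have "simplex_map p g (simplex_map p g s) = simplex_map p (g \<circ> g) s"
    by (simp add: simplex_map_compose)
  also have "\<dots> = s"
    by (rule simplex_map_id_gen [OF assms]) (simp add: involution)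
  finally show ?thesis .
qed

lemma lift_cases:
  assumes "singular_simplex p E s"
  shows "lift p (simplex_map p q s) = s \<or> lift p (simplex_map p q s) = simplex_map p g s"
proof -
  have b: "singular_simplex p B (simplex_map p q s)"
    using assms continuous_map_orbit by (rule singular_simplex_simplex_map)
  show ?thesis
    using singular_simplex_lift_unique [OF assms singular_simplex_lift' [OF b]] simplex_map_lift [OF b] by auto
qed

definition transfer :: "nat \<Rightarrow> 'e cochain \<Rightarrow> 'e set cochain" where
  "transfer p \<phi> = (\<lambda>s. if singular_simplex p B s then \<phi> (lift p s) + \<phi> (simplex_map p g (lift p s)) else 0)"

text \<open>The sum runs over both lifts, so replacing the chosen lift by \<open>s\<close> at most
  exchanges the summands.\<close>

lemma transfer_simplex:
  assumes "singular_simplex p E s"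
  shows "transfer p \<phi> (simplex_map p q s) = \<phi> s + \<phi> (simplex_map p g s)"
  using lift_cases [OF assms] simplex_map_involution [OF assms]
    singular_simplex_simplex_map [OF assms continuous_map_orbit]
  by (auto simp: transfer_def add.commute)

text \<open>Every simplex of \<open>B\<close> has a lift, so a cochain on \<open>B\<close> is
  determined by its values on projected simplices. This also makes pullback along \<open>q\<close>
  injective on cochains.\<close>

lemma base_cochain_eqI:
  assumes "\<phi> \<in> cochain_set p B S" "\<psi> \<in> cochain_set p B T"
    and "\<And>s. singular_simplex p E s \<Longrightarrow> \<phi> (simplex_map p q s) = \<psi> (simplex_map p q s)"
  shows "\<phi> = \<psi>"
proof
  fix s
  show "\<phi> s = \<psi> s"
  proof (cases "singular_simplex p B s")
    case True
    then show ?thesis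
      using assms(3) [OF singular_simplex_lift' [OF True]] simplex_map_lift [OF True] by simp
  qed (use assms in \<open>auto simp: cochain_set_def\<close>)
qed

lemma pullback_orbit_inject:
  assumes "\<phi> \<in> cochain_set p B S" "\<psi> \<in> cochain_set p B T"
    and eq: "cochain_pullback p E q \<phi> = cochain_pullback p E q \<psi>"
  shows "\<phi> = \<psi>"
proof (rule base_cochain_eqI [OF assms(1,2)])
  show "\<phi> (simplex_map p q s) = \<psi> (simplex_map p q s)" if "singular_simplex p E s" for s
    using fun_cong [OF eq, of s] that by (simp add: cochain_pullback_def)
qed

lemma transfer_add: "transfer p (\<phi> + \<psi>) = transfer p \<phi> + transfer p \<psi>"
  by (auto simp: transfer_def fun_eq_iff ac_simps)

lemma transfer_0 [simp]: "transfer p 0 = 0"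
  by (auto simp: transfer_def fun_eq_iff)

lemma transfer_pullback [simp]: "transfer p (cochain_pullback p E q \<phi>) = 0"
proof
  fix s
  have "singular_simplex p E (simplex_map p g (lift p s))" if "singular_simplex p B s"
    using singular_simplex_lift' [OF that] continuous_involution by (rule singular_simplex_simplex_map)
  then show "transfer p (cochain_pullback p E q \<phi>) s = 0 s"
    by (auto simp: transfer_def cochain_pullback_def singular_simplex_lift' simplex_map_orbit_involution)
qed

text \<open>The faces of a lift are lifts of the faces, and the transfer does not care which lift is
  taken.\<close>

lemma transfer_coboundary:
  "coboundary p B (transfer p \<phi>) = transfer (Suc p) (coboundary p E \<phi>)"
proof
  fix s
  show "coboundary p B (transfer p \<phi>) s = transfer (Suc p) (coboundary p E \<phi>) s"
  proof (cases "singular_simplex (Suc p) B s")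
    case True
    let ?s = "lift (Suc p) s"
    have s: "singular_simplex (Suc p) E ?s"
      using singular_simplex_lift' [OF True] .
    then have gs: "singular_simplex (Suc p) E (simplex_map (Suc p) g ?s)"
      using continuous_involution by (rule singular_simplex_simplex_map)
    have "transfer p \<phi> (singular_face (Suc p) k s)
        = \<phi> (singular_face (Suc p) k ?s) + \<phi> (singular_face (Suc p) k (simplex_map (Suc p) g ?s))"
      if k: "k \<le> Suc p" for k
    proof -
      have "singular_face (Suc p) k s = simplex_map p q (singular_face (Suc p) k ?s)"
        using singular_face_simplex_map' [of "Suc p" k q ?s] k simplex_map_lift [OF True] by simp
      moreover have "singular_simplex p E (singular_face (Suc p) k ?s)"
        using singular_simplex_singular_face [OF s _ k] by simp
      ultimately show ?thesis
        using k by (simp add: transfer_simplex singular_face_simplex_map')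
    qed
    then show ?thesis
      using True s gs by (simp add: coboundary_def transfer_def sum.distrib del: sum.atMost_Suc)
  qed (simp add: coboundary_def transfer_def)
qed

text \<open>The projection formula: a pulled back cochain has the same value on both lifts and
  factors out, leaving the transfer of \<open>\<theta>\<close>, which is 1. This is an explicit
  preimage of \<open>x\<close> under the transfer.\<close>

lemma transfer_cup_pullback:
  assumes "x \<in> cochain_set n B S" and \<theta>: "transfer 0 \<theta> = unit_cochain B"
  shows "transfer n (cup_cochain n 0 E (cochain_pullback n E q x) \<theta>) = x"
proof (rule base_cochain_eqI [OF _ assms(1)])
  show "transfer n (cup_cochain n 0 E (cochain_pullback n E q x) \<theta>) \<in> cochain_set n B {}"
    by (auto simp: cochain_set_def transfer_def singular_simplex_empty)
  fix s assume s: "singular_simplex n E s"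
  have gs: "singular_simplex n E (simplex_map n g s)"
    using s continuous_involution by (rule singular_simplex_simplex_map)
  have ff: "front_face n s = s" "front_face n (simplex_map n g s) = simplex_map n g s"
    using s gs by (auto simp: front_face_def singular_simplex_def extensional_restrict)
  have bf: "back_face n 0 (simplex_map n g s) = simplex_map 0 g (back_face n 0 s)"
    using back_face_simplex_map [of n 0 g s] by simp
  have b: "singular_simplex 0 E (back_face n 0 s)"
    using singular_simplex_back_face [of n 0 E s] s by simp
  have "\<theta> (back_face n 0 s) + \<theta> (simplex_map 0 g (back_face n 0 s)) = 1"
    using transfer_simplex [OF b, of \<theta>] singular_simplex_simplex_map [OF b continuous_map_orbit]
    by (simp add: \<theta>)
  then show "transfer n (cup_cochain n 0 E (cochain_pullback n E q x) \<theta>) (simplex_map n q s) = x (simplex_map n q s)"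
    using s gs by (simp add: transfer_simplex cup_cochain_def ff bf cochain_pullback_def
        simplex_map_orbit_involution flip: distrib_left)
qed

subsection \<open>The characteristic class\<close>

text \<open>The 0-cochain that takes the value 1 on exactly one point of every orbit.\<close>

definition hemisphere :: "'e cochain" where
  "hemisphere = (\<lambda>s. if singular_simplex 0 E s \<and>
     (let x = \<xi> (s (\<lambda>j. if j = 0 then 1 else 0)) in x (LEAST i. x i \<noteq> 0) > 0) then 1 else 0)"

text \<open>The coboundary of \<open>hemisphere\<close> has the same value on both lifts and
  descends to \<open>B\<close>. This is the connecting homomorphism applied to 1, a cocycle for the
  class of the double covering.\<close>

definition char_cochain :: "'e set cochain" where
  "char_cochain = (\<lambda>s. if singular_simplex (Suc 0) B s then coboundary 0 E hemisphere (lift (Suc 0) s) else 0)"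

lemma hemisphere_cochain: "hemisphere \<in> cochain_set 0 E {}"
  by (auto simp: cochain_set_def hemisphere_def singular_simplex_empty)

text \<open>The first nonzero coordinate has the same index at both points of an orbit, and opposite
  signs.\<close>

lemma hemisphere_involution:
  assumes "singular_simplex 0 E s"
  shows "hemisphere s + hemisphere (simplex_map 0 g s) = 1"
proof -
  define e where "e = s (\<lambda>j. if j = 0 then 1 else 0)"
  have e: "e \<in> topspace E"
    unfolding e_def by (rule singular_simplex_image [OF assms]) simp
  have ge: "simplex_map 0 g s (\<lambda>j. if j = 0 then 1 else 0) = g e"
    by (simp add: simplex_map_def e_def)
  have "\<xi> (g e) = (\<lambda>i. - \<xi> e i)"
    using coordinate_involution [OF e] by auto
  moreover have "\<xi> e (LEAST i. \<xi> e i \<noteq> 0) \<noteq> 0"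
    using coordinate_nonzero [OF e] by (rule LeastI_ex)
  moreover have "singular_simplex 0 E (simplex_map 0 g s)"
    using assms continuous_involution by (rule singular_simplex_simplex_map)
  ultimately show ?thesis
    using assms by (auto simp: hemisphere_def ge Let_def simp flip: e_def)
qed

lemma transfer_hemisphere: "transfer 0 hemisphere = unit_cochain B"
  by (auto simp: transfer_def hemisphere_involution singular_simplex_lift')

lemma pullback_char_cochain: "cochain_pullback (Suc 0) E q char_cochain = coboundary 0 E hemisphere"
proof
  fix s
  show "cochain_pullback (Suc 0) E q char_cochain s = coboundary 0 E hemisphere s"
  proof (cases "singular_simplex (Suc 0) E s")
    case True
    \<comment> \<open>The transfer of this coboundary is the coboundary of the unit, hence 0; modulo
      2 this means invariance under \<open>g\<close>.\<close>
    have "transfer (Suc 0) (coboundary 0 E hemisphere) = coboundary 0 B (unit_cochain B)"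
      using transfer_coboundary [of 0 hemisphere] by (simp add: transfer_hemisphere)
    also have "\<dots> = 0"
      using unit_cochain_cocycle [of B] by (simp add: cocycle_set_iff)
    finally have "coboundary 0 E hemisphere s + coboundary 0 E hemisphere (simplex_map (Suc 0) g s) = 0"
      using transfer_simplex [OF True, of "coboundary 0 E hemisphere"] by simp
    then have "coboundary 0 E hemisphere (simplex_map (Suc 0) g s) = coboundary 0 E hemisphere s"
      by (metis add.right_neutral bit_add_self add.left_commute)
    then have "coboundary 0 E hemisphere (lift (Suc 0) (simplex_map (Suc 0) q s)) = coboundary 0 E hemisphere s"
      using lift_cases [OF True] by auto
    then show ?thesis
      using True singular_simplex_simplex_map [OF True continuous_map_orbit]
      by (simp add: cochain_pullback_def char_cochain_def)
  qed (simp add: cochain_pullback_def coboundary_def)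
qed

lemma char_cochain_cocycle: "char_cochain \<in> cocycle_set (Suc 0) B {}"
proof -
  have c: "char_cochain \<in> cochain_set (Suc 0) B {}"
    by (auto simp: cochain_set_def char_cochain_def singular_simplex_empty)
  have "cochain_pullback (Suc (Suc 0)) E q (coboundary (Suc 0) B char_cochain) = 0"
    by (simp add: pullback_char_cochain coboundary_coboundary flip: coboundary_pullback [OF continuous_map_orbit])
  then have "coboundary (Suc 0) B char_cochain = 0"
    using pullback_orbit_inject [OF coboundary_cochain [OF c] cochain_set_0 [where S = "{}"]] by simp
  with c show ?thesis
    by (simp add: cocycle_set_iff)
qed

subsection \<open>Exactness\<close>

context
  fixes S :: "'e set"
  assumes S: "S \<subseteq> topspace E" "g ` S \<subseteq> S"
begin

lemma orbit_in_image:
  assumes e: "e \<in> topspace E"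
  shows "q e \<in> q ` S \<longleftrightarrow> e \<in> S"
proof
  assume "q e \<in> q ` S"
  then obtain x where x: "x \<in> S" "q x = q e" by auto
  then have "e = x \<or> e = g x"
    using orbit_eq_iff e S(1) by blast
  then show "e \<in> S"
    using x(1) S(2) by blast
qed auto

lemma orbit_image_subset: "q ` (topspace E \<inter> S) \<subseteq> q ` S"
  by auto

text \<open>The invariant set \<open>S\<close> is the full preimage of its image in
  \<open>B\<close>, so both lifts of a simplex of that image lie in \<open>S\<close>.\<close>

lemma lift_in:
  assumes "singular_simplex p (subtopology B (q ` S)) s"
  shows "singular_simplex p (subtopology E S) (lift p s)"
    and "singular_simplex p (subtopology E S) (simplex_map p g (lift p s))"
proof -
  have s: "singular_simplex p B s" and im: "s ` standard_simplex p \<subseteq> q ` S"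
    using assms by (auto simp: singular_simplex_subtopology)
  have l: "singular_simplex p E (lift p s)"
    using s by (rule singular_simplex_lift')
  have "lift p s t \<in> S" if t: "t \<in> standard_simplex p" for t
  proof -
    have "q (lift p s t) = s t"
      using fun_cong [OF simplex_map_lift [OF s], of t] t by (simp add: simplex_map_def)
    then have "q (lift p s t) \<in> q ` S"
      using im t by auto
    then show ?thesis
      using orbit_in_image [OF singular_simplex_image [OF l t]] by blast
  qed
  then have *: "lift p s ` standard_simplex p \<subseteq> S" by auto
  then show "singular_simplex p (subtopology E S) (lift p s)"
    using l by (simp add: singular_simplex_subtopology)
  show "singular_simplex p (subtopology E S) (simplex_map p g (lift p s))"
    unfolding singular_simplex_subtopology
    using singular_simplex_simplex_map [OF l continuous_involution] * S by (auto simp: simplex_map_def)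
qed

lemma transfer_cochain:
  assumes "\<phi> \<in> cochain_set p E S"
  shows "transfer p \<phi> \<in> cochain_set p B (q ` S)"
  using assms lift_in by (auto simp: cochain_set_def transfer_def)

lemma transfer_coboundary_set:
  assumes "\<phi> \<in> coboundary_set p E S"
  shows "transfer p \<phi> \<in> coboundary_set p B (q ` S)"
proof (cases p)
  case 0
  then show ?thesis using assms by (simp add: coboundary_set_0_eq)
next
  case (Suc n)
  then show ?thesis
    using assms transfer_cochain by (auto simp: coboundary_set_Suc simp flip: transfer_coboundary)
qed

text \<open>Exactness in the middle: transfer 0 means equal values on the two lifts, so evaluating
  on the chosen lift defines a cochain on \<open>B\<close> that pulls back to
  \<open>\<phi>\<close>.\<close>

lemma transfer_eq_0:
  assumes \<phi>: "\<phi> \<in> cochain_set p E S" and 0: "transfer p \<phi> = 0"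
  obtains \<psi> where "\<psi> \<in> cochain_set p B (q ` S)" "cochain_pullback p E q \<psi> = \<phi>"
proof
  let ?\<psi> = "\<lambda>s. if singular_simplex p B s then \<phi> (lift p s) else 0"
  show "?\<psi> \<in> cochain_set p B (q ` S)"
    using \<phi> lift_in by (auto simp: cochain_set_def)
  show "cochain_pullback p E q ?\<psi> = \<phi>"
  proof
    fix s
    show "cochain_pullback p E q ?\<psi> s = \<phi> s"
    proof (cases "singular_simplex p E s")
      case True
      have "\<phi> s + \<phi> (simplex_map p g s) = 0"
        using transfer_simplex [OF True, of \<phi>] 0 by simp
      then have "\<phi> (simplex_map p g s) = \<phi> s"
        by (metis add.right_neutral bit_add_self add.left_commute)
      then show ?thesis
        using True lift_cases [OF True] singular_simplex_simplex_map [OF True continuous_map_orbit]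
        by (auto simp: cochain_pullback_def)
    qed (use \<phi> in \<open>auto simp: cochain_pullback_def cochain_set_def\<close>)
  qed
qed

text \<open>This identifies the connecting homomorphism of the transfer sequence with the cup product by \<open>u\<close>.\<close>

lemma coboundary_pullback_cup_hemisphere:
  assumes "x \<in> cocycle_set n B (q ` S)"
  shows "coboundary n E (cup_cochain n 0 E (cochain_pullback n E q x) hemisphere)
    = cochain_pullback (Suc n) E q (cup_cochain n (Suc 0) B x char_cochain)"
proof -
  have "coboundary n E (cochain_pullback n E q x) = 0"
    using assms by (simp add: coboundary_pullback [OF continuous_map_orbit] cocycle_set_iff)
  then show ?thesis
    using coboundary_cup [of n 0 E "cochain_pullback n E q x" hemisphere]
      cup_cochain_pullback [OF continuous_map_orbit, of n "Suc 0" x char_cochain]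
    by (simp add: pullback_char_cochain)
qed

lemma cup_hemisphere_cochain:
  assumes "x \<in> cocycle_set n B (q ` S)"
  shows "cup_cochain n 0 E (cochain_pullback n E q x) hemisphere \<in> cochain_set n E S"
  using cup_cochain_cochain [OF cochain_pullback_cochain [OF _ continuous_map_orbit orbit_image_subset], of x n 0 hemisphere]
    assms by (simp add: cocycle_set_iff)

proposition kernel_pullback_orbit_0:
  assumes "b \<in> cocycle_set 0 B (q ` S)" "cochain_pullback 0 E q b \<in> coboundary_set 0 E S"
  shows "b = 0"
  using pullback_orbit_inject [of b 0 "q ` S" 0] assms by (auto simp: coboundary_set_0_eq cocycle_set_iff)

text \<open>The quotient of \<open>b\<close> by the characteristic class is the transfer of a
  primitive of its pullback.\<close>

proposition kernel_pullback_orbit_Suc: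
  assumes b: "b \<in> cocycle_set (Suc n) B (q ` S)" and 0: "cochain_pullback (Suc n) E q b \<in> coboundary_set (Suc n) E S"
  obtains b' where "b' \<in> cocycle_set n B (q ` S)"
    "b + cup_cochain n (Suc 0) B b' char_cochain \<in> coboundary_set (Suc n) B (q ` S)"
proof -
  obtain \<phi> where \<phi>: "\<phi> \<in> cochain_set n E S" and q\<phi>: "cochain_pullback (Suc n) E q b = coboundary n E \<phi>"
    using 0 by (auto simp: coboundary_set_Suc)
  define b' where "b' = transfer n \<phi>"
  have b': "b' \<in> cocycle_set n B (q ` S)"
    unfolding b'_def cocycle_set_iff
    using transfer_cochain [OF \<phi>] by (simp add: transfer_coboundary flip: q\<phi>)
  \<comment> \<open>\<open>?c\<close> has the same transfer as \<open>\<phi>\<close>, so their sum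
    descends to some \<open>\<psi>\<close> on \<open>B\<close>; the coboundary of
    \<open>\<psi>\<close> is the required relation.\<close>
  let ?c = "cup_cochain n 0 E (cochain_pullback n E q b') hemisphere"
  have c: "?c \<in> cochain_set n E S"
    using b' by (rule cup_hemisphere_cochain)
  have "transfer n ?c = b'"
    using transfer_cup_pullback [OF _ transfer_hemisphere] b' by (auto simp: cocycle_set_iff)
  then have "transfer n (\<phi> + ?c) = 0"
    by (simp add: transfer_add flip: b'_def)
  then obtain \<psi> where \<psi>: "\<psi> \<in> cochain_set n B (q ` S)" "cochain_pullback n E q \<psi> = \<phi> + ?c"
    using transfer_eq_0 [OF cochain_set_add [OF \<phi> c]] by metis
  have "cochain_pullback (Suc n) E q (b + cup_cochain n (Suc 0) B b' char_cochain)
      = cochain_pullback (Suc n) E q (coboundary n B \<psi>)"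
    using coboundary_pullback_cup_hemisphere [OF b']
    by (simp add: cochain_pullback_add q\<phi> \<psi>(2) coboundary_add flip: coboundary_pullback [OF continuous_map_orbit])
  then have "b + cup_cochain n (Suc 0) B b' char_cochain = coboundary n B \<psi>"
    using b b' cup_cochain_cochain [of b' n B "q ` S" "Suc 0" char_cochain]
    by (intro pullback_orbit_inject [OF _ coboundary_cochain [OF \<psi>(1)]])
      (auto simp: cocycle_set_iff intro!: cochain_set_add)
  then show ?thesis
    using that [OF b'] \<psi>(1) by (simp add: coboundary_set_Suc)
qed

text \<open>The pulled back product has two primitives, \<open>?c\<close> from the hemisphere and
  \<open>?p\<close> from the hypothesis. Their sum is a cocycle, and its transfer is
  \<open>x\<close> because the transfer kills the pullback \<open>?p\<close>.\<close>

proposition kernel_cup_char: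
  assumes x: "x \<in> cocycle_set n B (q ` S)"
    and 0: "cup_cochain n (Suc 0) B x char_cochain \<in> coboundary_set (Suc n) B (q ` S)"
  obtains \<phi> where "\<phi> \<in> cocycle_set n E S" "transfer n \<phi> = x"
proof -
  obtain \<psi> where \<psi>: "\<psi> \<in> cochain_set n B (q ` S)" "cup_cochain n (Suc 0) B x char_cochain = coboundary n B \<psi>"
    using 0 by (auto simp: coboundary_set_Suc)
  let ?c = "cup_cochain n 0 E (cochain_pullback n E q x) hemisphere"
  let ?p = "cochain_pullback n E q \<psi>"
  have c: "?c \<in> cochain_set n E S"
    using x by (rule cup_hemisphere_cochain)
  have p: "?p \<in> cochain_set n E S"
    using \<psi>(1) by (rule cochain_pullback_cochain [OF _ continuous_map_orbit orbit_image_subset])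
  have "coboundary n E (?c + ?p) = 0"
    using coboundary_pullback_cup_hemisphere [OF x] coboundary_pullback [OF continuous_map_orbit, of n \<psi>] \<psi>(2)
    by (simp add: coboundary_add)
  then have "?c + ?p \<in> cocycle_set n E S"
    using cochain_set_add [OF c p] by (simp add: cocycle_set_iff)
  moreover have "transfer n (?c + ?p) = x"
    using transfer_cup_pullback [OF _ transfer_hemisphere] x by (auto simp: cocycle_set_iff transfer_add)
  ultimately show ?thesis
    using that by blast
qed

text \<open>If pullback is onto in cohomology, the transfer is zero there, since the transfer of a
  pullback is 0; hence only the zero class is killed by the characteristic class.\<close>

corollary cup_char_inject:
  assumes x: "x \<in> cocycle_set n B (q ` S)"
    and 0: "cup_cochain n (Suc 0) B x char_cochain \<in> coboundary_set (Suc n) B (q ` S)"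
    and surj: "\<And>\<phi>. \<phi> \<in> cocycle_set n E S \<Longrightarrow>
      \<exists>y\<in>cocycle_set n B (q ` S). \<phi> + cochain_pullback n E q y \<in> coboundary_set n E S"
  shows "x \<in> coboundary_set n B (q ` S)"
proof -
  obtain \<phi> where \<phi>: "\<phi> \<in> cocycle_set n E S" "transfer n \<phi> = x"
    using kernel_cup_char [OF x 0] .
  obtain y where "\<phi> + cochain_pullback n E q y \<in> coboundary_set n E S"
    using surj [OF \<phi>(1)] by blast
  from transfer_coboundary_set [OF this] show ?thesis
    by (simp add: transfer_add \<phi>(2))
qed

end

end

section \<open>Contractibility of the infinite-dimensional sphere\<close>

lemma topspace_EC: "topspace EC = (\<Union>n. topspace (nsphere n))"
proof -
  have "openin (nsphere n) ((\<Union>m. topspace (nsphere m)) \<inter> topspace (nsphere n))" for n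
    by (metis UN_upper UNIV_I inf.absorb2 openin_topspace)
  then have "openin EC (\<Union>n. topspace (nsphere n))"
    by (simp add: openin_EC)
  then show ?thesis
    by (metis openin_EC openin_subset openin_topspace subset_antisym)
qed

lemma continuous_map_nsphere_EC: "continuous_map (nsphere n) EC id"
proof -
  have "{x \<in> topspace (nsphere n). x \<in> U} = U \<inter> topspace (nsphere n)" for U
    by auto
  then show ?thesis
    by (auto simp: continuous_map_def openin_EC topspace_EC)
qed

lemma continuous_map_from_EC:
  assumes "\<And>n. continuous_map (nsphere n) Z f"
  shows "continuous_map EC Z f"
  unfolding continuous_map_def
proof (intro conjI allI impI)
  show "f \<in> topspace EC \<rightarrow> topspace Z"
    using assms by (auto simp: topspace_EC continuous_map_def Pi_iff)
  fix U assume "openin Z U"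
  then have "openin (nsphere n) {x \<in> topspace (nsphere n). f x \<in> U}" for n
    using assms by (auto simp: continuous_map_def)
  moreover have "{x \<in> topspace EC. f x \<in> U} \<inter> topspace (nsphere n) = {x \<in> topspace (nsphere n). f x \<in> U}" for n
    by (auto simp: topspace_EC)
  ultimately show "openin EC {x \<in> topspace EC. f x \<in> U}"
    by (auto simp: openin_EC topspace_EC)
qed

lemma continuous_map_to_EC: "continuous_map Z (nsphere n) f \<Longrightarrow> continuous_map Z EC f"
  using continuous_map_compose [OF _ continuous_map_nsphere_EC, of Z n f] by simp

lemma quotient_map_sum_EC: "quotient_map (sum_topology nsphere UNIV) EC snd"
proof -
  have "openin (sum_topology nsphere UNIV) {z \<in> topspace (sum_topology nsphere UNIV). snd z \<in> U} \<longleftrightarrow> openin EC U"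
    if "U \<subseteq> topspace EC" for U
  proof -
    have "{x. (n, x) \<in> {z \<in> topspace (sum_topology nsphere UNIV). snd z \<in> U}} = U \<inter> topspace (nsphere n)" for n
      by auto
    then show ?thesis
      using that by (auto simp: openin_sum_topology openin_EC topspace_EC)
  qed
  moreover have "snd ` topspace (sum_topology nsphere UNIV) = topspace EC"
    by (force simp: topspace_EC)
  ultimately show ?thesis
    by (simp add: quotient_map_def)
qed

text \<open>The product of a quotient map with a locally compact Hausdorff space is again a quotient
  map, so continuity can be tested over each sphere although \<open>EC\<close> carries the colimit
  topology.\<close>

lemma continuous_map_from_cylinder_EC:
  assumes F: "\<And>n. continuous_map (prod_topology unit_interval (nsphere n)) Z F"
  shows "continuous_map (prod_topology unit_interval EC) Z F"
proof (rule continuous_compose_quotient_map)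
  show "quotient_map (prod_topology unit_interval (sum_topology nsphere UNIV)) (prod_topology unit_interval EC) (\<lambda>(t, x). (t, snd x))"
  proof (rule quotient_map_prod_right [OF _ _ quotient_map_sum_EC])
    show "locally_compact_space unit_interval"
      by (simp add: compact_imp_locally_compact_space compact_space_subtopology)
  qed (simp add: Hausdorff_space_subtopology)
  show "continuous_map (prod_topology unit_interval (sum_topology nsphere UNIV)) Z (F \<circ> (\<lambda>(t, x). (t, snd x)))"
    unfolding continuous_map_def
  proof (intro conjI allI impI)
    show "F \<circ> (\<lambda>(t, x). (t, snd x)) \<in> topspace (prod_topology unit_interval (sum_topology nsphere UNIV)) \<rightarrow> topspace Z"
      using F by (auto simp: continuous_map_def Pi_iff)
    fix U assume U: "openin Z U"
    show "openin (prod_topology unit_interval (sum_topology nsphere UNIV))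
       {z \<in> topspace (prod_topology unit_interval (sum_topology nsphere UNIV)). (F \<circ> (\<lambda>(t, x). (t, snd x))) z \<in> U}" (is "openin _ ?P")
      unfolding openin_prod_topology_alt
    proof (intro allI impI)
      fix t nx assume z: "(t, nx) \<in> ?P"
      obtain n x where nx: "nx = (n, x)" by (cases nx)
      have "openin (prod_topology unit_interval (nsphere n)) {w \<in> topspace (prod_topology unit_interval (nsphere n)). F w \<in> U}"
        by (rule openin_continuous_map_preimage [OF F U])
      moreover have "(t, x) \<in> {w \<in> topspace (prod_topology unit_interval (nsphere n)). F w \<in> U}"
        using z nx by auto
      ultimately obtain V W where V: "openin unit_interval V" "openin (nsphere n) W" "t \<in> V" "x \<in> W"
        "V \<times> W \<subseteq> {w \<in> topspace (prod_topology unit_interval (nsphere n)). F w \<in> U}"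
        unfolding openin_prod_topology_alt by meson
      have "openin (sum_topology nsphere UNIV) ((\<lambda>x. (n, x)) ` W)"
        using open_map_component_injection [of n UNIV nsphere] V(2) by (auto simp: open_map_def)
      moreover have "V \<times> (\<lambda>x. (n, x)) ` W \<subseteq> ?P"
        using V(5) by auto
      ultimately show "\<exists>V W. openin unit_interval V \<and> openin (sum_topology nsphere UNIV) W \<and> t \<in> V \<and> nx \<in> W \<and> V \<times> W \<subseteq> ?P"
        using V nx by blast
    qed
  qed
qed

text \<open>Summing over the support keeps the dimension out of the formula, so that one function
  serves all spheres. It is meant for finitely supported sequences.\<close>

definition normalize_seq :: "(nat \<Rightarrow> real) \<Rightarrow> nat \<Rightarrow> real" where
  "normalize_seq x = (\<lambda>i. x i / sqrt (\<Sum>i | x i \<noteq> 0. (x i)\<^sup>2))"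

lemma normalize_seq_eq:
  assumes "\<And>i. i > n \<Longrightarrow> x i = 0"
  shows "normalize_seq x = (\<lambda>i. x i / sqrt (\<Sum>i\<le>n. (x i)\<^sup>2))"
proof -
  have "(\<Sum>i | x i \<noteq> 0. (x i)\<^sup>2) = (\<Sum>i\<le>n. (x i)\<^sup>2)"
    by (rule sum.mono_neutral_left) (use assms in \<open>auto simp: not_less [symmetric]\<close>)
  then show ?thesis
    by (simp add: normalize_seq_def)
qed

lemma normalize_seq_nsphere: "x \<in> topspace (nsphere n) \<Longrightarrow> normalize_seq x = x"
  using normalize_seq_eq [of n x] by (auto simp: nsphere)

lemma continuous_map_normalize_seq:
  assumes cont: "\<And>i. continuous_map Z euclideanreal (\<lambda>z. V z i)"
    and zero: "\<And>z i. z \<in> topspace Z \<Longrightarrow> i > n \<Longrightarrow> V z i = 0"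
    and nz: "\<And>z. z \<in> topspace Z \<Longrightarrow> \<exists>i. V z i \<noteq> 0"
  shows "continuous_map Z (nsphere n) (\<lambda>z. normalize_seq (V z))"
proof (rule continuous_map_eq)
  have pos: "(\<Sum>i\<le>n. (V z i)\<^sup>2) > 0" if z: "z \<in> topspace Z" for z
  proof -
    obtain i where "V z i \<noteq> 0" "i \<le> n"
      using nz [OF z] zero [OF z] not_less by metis
    then show ?thesis
      by (intro sum_pos2 [of _ i]) auto
  qed
  show "continuous_map Z (nsphere n) (\<lambda>z i. V z i / sqrt (\<Sum>i\<le>n. (V z i)\<^sup>2))"
    unfolding nsphere continuous_map_in_subtopology
  proof
    have "continuous_map Z euclideanreal (\<lambda>z. sqrt (\<Sum>i\<le>n. (V z i)\<^sup>2))"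
      by (intro continuous_intros cont) auto
    then have "continuous_map Z euclideanreal (\<lambda>z. V z i / sqrt (\<Sum>i\<le>n. (V z i)\<^sup>2))" for i
      using pos by (intro continuous_map_real_divide cont) force+
    then show "continuous_map Z (powertop_real UNIV) (\<lambda>z i. V z i / sqrt (\<Sum>i\<le>n. (V z i)\<^sup>2))"
      by (auto simp: continuous_map_componentwise)
    show "(\<lambda>z i. V z i / sqrt (\<Sum>i\<le>n. (V z i)\<^sup>2)) \<in> topspace Z \<rightarrow> {x. (\<Sum>i\<le>n. (x i)\<^sup>2) = 1 \<and> (\<forall>i>n. x i = 0)}"
    proof (intro Pi_I CollectI conjI allI impI)
      fix z assume z: "z \<in> topspace Z"
      have "(\<Sum>i\<le>n. (V z i / sqrt (\<Sum>i\<le>n. (V z i)\<^sup>2))\<^sup>2) = (\<Sum>i\<le>n. (V z i)\<^sup>2) / (\<Sum>i\<le>n. (V z i)\<^sup>2)"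
        using pos [OF z] by (simp add: power_divide less_imp_le flip: sum_divide_distrib)
      also have "\<dots> = 1"
        using pos [OF z] by simp
      finally show "(\<Sum>i\<le>n. (V z i / sqrt (\<Sum>i\<le>n. (V z i)\<^sup>2))\<^sup>2) = 1" .
    qed (simp add: zero)
  qed
  show "(\<lambda>i. V z i / sqrt (\<Sum>i\<le>n. (V z i)\<^sup>2)) = normalize_seq (V z)" if "z \<in> topspace Z" for z
    using normalize_seq_eq [of n "V z"] zero [OF that] by simp
qed

text \<open>The bound \<open>Suc n\<close> instead of \<open>n\<close> leaves room for a shift of
  coordinates, which raises the dimension by one.\<close>

lemma homotopic_with_normalize_seq:
  fixes V :: "real \<times> (nat \<Rightarrow> real) \<Rightarrow> nat \<Rightarrow> real"
  assumes cont: "\<And>n i. continuous_map (prod_topology unit_interval (nsphere n)) euclideanreal (\<lambda>z. V z i)"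
    and zero: "\<And>n t x i. x \<in> topspace (nsphere n) \<Longrightarrow> i > Suc n \<Longrightarrow> V (t, x) i = 0"
    and nz: "\<And>n t x. x \<in> topspace (nsphere n) \<Longrightarrow> 0 \<le> t \<Longrightarrow> t \<le> 1 \<Longrightarrow> \<exists>i. V (t, x) i \<noteq> 0"
  shows "homotopic_with (\<lambda>h. True) EC EC (\<lambda>x. normalize_seq (V (0, x))) (\<lambda>x. normalize_seq (V (1, x)))"
proof -
  have "continuous_map (prod_topology unit_interval EC) EC (\<lambda>z. normalize_seq (V z))"
  proof (rule continuous_map_from_cylinder_EC)
    fix n
    show "continuous_map (prod_topology unit_interval (nsphere n)) EC (\<lambda>z. normalize_seq (V z))"
      by (rule continuous_map_to_EC [of _ "Suc n"], rule continuous_map_normalize_seq [OF cont])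
         (use zero nz in auto)
  qed
  then show ?thesis
    unfolding homotopic_with_def by (intro exI [of _ "\<lambda>z. normalize_seq (V z)"]) auto
qed

text \<open>A straight line from \<open>x\<close> to a fixed point of the sphere meets 0 if
  \<open>x\<close> is the antipode. Passing through the shifted sequence makes coordinate 0 vanish,
  and from there the line to the basis vector \<open>a\<close> avoids 0.\<close>

lemma contractible_EC: "contractible_space EC"
proof -
  define shift :: "(nat \<Rightarrow> real) \<Rightarrow> nat \<Rightarrow> real" where "shift x i = (if i = 0 then 0 else x (i - 1))" for x i
  define a :: "nat \<Rightarrow> real" where "a i = (if i = 0 then 1 else 0)" for i
  define V where "V z i = (1 - fst z) * snd z i + fst z * shift (snd z) i" for z :: "real \<times> (nat \<Rightarrow> real)" and i
  define W where "W z i = (1 - fst z) * shift (snd z) i + fst z * a i" for z :: "real \<times> (nat \<Rightarrow> real)" and i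
  have c1: "continuous_map (prod_topology unit_interval (nsphere n)) euclideanreal fst" for n
    by (meson continuous_map_fst continuous_map_into_fulltopology)
  have c2: "continuous_map (prod_topology unit_interval (nsphere n)) euclideanreal (\<lambda>z. snd z i)" for n i
    using continuous_map_compose [OF continuous_map_snd continuous_map_nsphere_projection, of unit_interval n i]
    by (simp add: o_def)
  have c3: "continuous_map (prod_topology unit_interval (nsphere n)) euclideanreal (\<lambda>z. shift (snd z) i)" for n i
    using c2 by (simp add: shift_def)
  have nonzero: "\<exists>i. x i \<noteq> 0" if "x \<in> topspace (nsphere n)" for x n
    using that by (auto simp: nsphere) (metis (no_types, lifting) power_zero_numeral sum.neutral zero_neq_one)
  have shift_nz: "\<exists>i. shift x i \<noteq> 0" if "x \<in> topspace (nsphere n)" for x n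
    using nonzero [OF that] by (metis add_diff_cancel_left' nat.simps(3) plus_1_eq_Suc shift_def)
  have hV: "homotopic_with (\<lambda>h. True) EC EC (\<lambda>x. normalize_seq (V (0, x))) (\<lambda>x. normalize_seq (V (1, x)))"
  proof (rule homotopic_with_normalize_seq)
    show "continuous_map (prod_topology unit_interval (nsphere n)) euclideanreal (\<lambda>z. V z i)" for n i
      unfolding V_def by (intro continuous_intros c1 c2 c3)
    show "V (t, x) i = 0" if "x \<in> topspace (nsphere n)" "i > Suc n" for n t x i
      using that by (auto simp: V_def shift_def nsphere)
    show "\<exists>i. V (t, x) i \<noteq> 0" if x: "x \<in> topspace (nsphere n)" and t: "0 \<le> t" "t \<le> 1" for n t x
    proof (rule ccontr)
      assume "\<nexists>i. V (t, x) i \<noteq> 0"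
      then have V0: "(1 - t) * x i + t * shift x i = 0" for i
        by (simp add: V_def)
      show False
      proof (cases "t = 1")
        case True
        then show False using V0 shift_nz [OF x] by auto
      next
        case False
        \<comment> \<open>For \<open>t \<noteq> 1\<close> the vanishing of \<open>V\<close> kills
          the coordinates one after another, since coordinate \<open>i + 1\<close> of the shift is
          coordinate \<open>i\<close> of \<open>x\<close>.\<close>
        have "x i = 0" for i
        proof (induction i)
          case 0
          show ?case using V0 [of 0] False by (simp add: shift_def)
        next
          case (Suc i)
          then show ?case using V0 [of "Suc i"] False by (simp add: shift_def)
        qed
        then show False using nonzero [OF x] by blast
      qed
    qed
  qed
  have hW: "homotopic_with (\<lambda>h. True) EC EC (\<lambda>x. normalize_seq (W (0, x))) (\<lambda>x. normalize_seq (W (1, x)))"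
  proof (rule homotopic_with_normalize_seq)
    show "continuous_map (prod_topology unit_interval (nsphere n)) euclideanreal (\<lambda>z. W z i)" for n i
      unfolding W_def by (intro continuous_intros c1 c3)
    show "W (t, x) i = 0" if "x \<in> topspace (nsphere n)" "i > Suc n" for n t x i
      using that by (auto simp: W_def a_def shift_def nsphere)
    show "\<exists>i. W (t, x) i \<noteq> 0" if x: "x \<in> topspace (nsphere n)" and t: "0 \<le> t" "t \<le> 1" for n t x
    proof (cases "t = 0")
      case True
      then show ?thesis using shift_nz [OF x] by (simp add: W_def)
    next
      case False
      then show ?thesis by (intro exI [of _ 0]) (simp add: W_def a_def shift_def)
    qed
  qed
  have VW: "V (1, x) = W (0, x)" and Wa: "W (1, x) = a" for x
    by (auto simp: V_def W_def)
  have hid: "homotopic_with (\<lambda>h. True) EC EC id (\<lambda>x. normalize_seq (V (0, x)))"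
  proof (rule homotopic_with_equal)
    show "id x = normalize_seq (V (0, x))" if x: "x \<in> topspace EC" for x
    proof -
      have "V (0, x) = x" by (auto simp: V_def)
      then show ?thesis using x normalize_seq_nsphere by (auto simp: topspace_EC)
    qed
  qed auto
  have "homotopic_with (\<lambda>h. True) EC EC id (\<lambda>x. normalize_seq a)"
    using homotopic_with_trans [OF hid homotopic_with_trans [OF hV [unfolded VW] hW [unfolded Wa]]] .
  then show ?thesis
    unfolding contractible_space_def by blast
qed

lemma EC_basepoint_in: "EC_basepoint \<in> topspace EC"
  using in_topspace_nsphere [of 0] by (auto simp: topspace_EC EC_basepoint_def)

section \<open>The Borel construction\<close>

lemma continuous_map_antipode: "continuous_map EC EC antipode"
proof (rule continuous_map_from_EC)
  fix n
  have "continuous_map (nsphere n) (nsphere n) antipode"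
    unfolding nsphere continuous_map_in_subtopology
  proof
    show "continuous_map (subtopology (powertop_real UNIV) {x. (\<Sum>i\<le>n. (x i)\<^sup>2) = 1 \<and> (\<forall>i>n. x i = 0)}) (powertop_real UNIV) antipode"
      unfolding antipode_def continuous_map_componentwise
      using continuous_map_nsphere_projection [of n] by (auto simp: nsphere intro!: continuous_map_minus)
  qed (auto simp: antipode_def)
  then show "continuous_map (nsphere n) EC antipode"
    by (rule continuous_map_to_EC)
qed

lemma continuous_map_EC_coordinate: "continuous_map EC euclideanreal (\<lambda>e. e i)"
  by (intro continuous_map_from_EC continuous_map_nsphere_projection)

interpretation EC: antipodal_space EC antipode "\<lambda>e. e"
proof
  show "\<exists>i. e i \<noteq> 0" if "e \<in> topspace EC" for e
    using that by (auto simp: topspace_EC nsphere) (metis (no_types, lifting) power_zero_numeral sum.neutral zero_neq_one)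
qed (auto simp: continuous_map_antipode continuous_map_EC_coordinate antipode_def)

text \<open>The coordinates of the sphere factor suffice, so the action is free even over the fixed
  points of \<open>\<tau>\<close>.\<close>

lemma borel_antipodal:
  assumes "involution_on X \<tau>"
  shows "antipodal_space (prod_topology EC X) (borel_involution \<tau>) fst"
proof
  have \<tau>: "continuous_map X X \<tau>" "\<And>x. x \<in> topspace X \<Longrightarrow> \<tau> (\<tau> x) = x"
    using assms by (auto simp: involution_on_def)
  show "continuous_map (prod_topology EC X) (prod_topology EC X) (borel_involution \<tau>)"
    unfolding borel_involution_def map_prod_def
    by (subst continuous_map_prod_top) (simp add: continuous_map_antipode \<tau>)
  show "borel_involution \<tau> (borel_involution \<tau> z) = z" if "z \<in> topspace (prod_topology EC X)" for z
    using that \<tau> by (auto simp: borel_involution_def antipode_def)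
  show "continuous_map (prod_topology EC X) euclideanreal (\<lambda>z. fst z i)" for i
    using continuous_map_compose [OF continuous_map_fst continuous_map_EC_coordinate, of X i]
    by (simp add: o_def)
  show "fst (borel_involution \<tau> z) i = - fst z i" if "z \<in> topspace (prod_topology EC X)" for z i
    by (cases z) (simp add: borel_involution_def antipode_def)
  show "\<exists>i. fst z i \<noteq> 0" if "z \<in> topspace (prod_topology EC X)" for z
    using that EC.coordinate_nonzero by auto
qed

section \<open>Cocycles of \<open>EC\<close> in degrees 0 and 1\<close>

lemma homotopic_EC_id_const: "homotopic_with (\<lambda>h. True) EC EC id (\<lambda>e. EC_basepoint)"
  by (rule homotopic_into_contractible_space) (simp add: contractible_EC EC_basepoint_in)

lemma EC_cocycle_const:
  assumes "\<phi> \<in> cocycle_set p EC {}"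
  shows "\<phi> + cochain_pullback p EC (\<lambda>e. EC_basepoint) \<phi> \<in> coboundary_set p EC {}"
proof -
  have "cochain_pullback p EC id \<phi> + cochain_pullback p EC (\<lambda>e. EC_basepoint) \<phi> \<in> coboundary_set p EC {}"
    by (rule homotopic_cochain_pullback [where S = "{}"]) (use homotopic_EC_id_const assms in auto)
  then show ?thesis
    using assms by (simp add: cochain_pullback_id [of _ _ _ "{}"] cocycle_set_iff)
qed

lemma simplex_map_const: "simplex_map p (\<lambda>e. c) s = restrict (\<lambda>t. c) (standard_simplex p)"
  by (auto simp: simplex_map_def)

lemma EC_cocycle_0:
  assumes "\<phi> \<in> cocycle_set 0 EC {}"
  shows "\<exists>c. \<phi> = (\<lambda>s. if singular_simplex 0 EC s then c else 0)"
proof -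
  have "\<phi> = cochain_pullback 0 EC (\<lambda>e. EC_basepoint) \<phi>"
    using EC_cocycle_const [OF assms] by (simp add: coboundary_set_0_eq cochain_add_eq_0_iff)
  then show ?thesis
    unfolding cochain_pullback_def simplex_map_const by blast
qed

text \<open>Up to a coboundary the cocycle is pulled back along a constant map, so only its value on
  the constant 1-simplex matters.\<close>

lemma EC_cocycle_1:
  assumes \<phi>: "\<phi> \<in> cocycle_set (Suc 0) EC {}"
  shows "\<phi> \<in> coboundary_set (Suc 0) EC {}"
proof -
  let ?c = "\<lambda>p. restrict (\<lambda>t. EC_basepoint) (standard_simplex p)"
  have face: "singular_face (Suc (Suc 0)) k (?c 2) = ?c 1" if "k \<le> Suc (Suc 0)" for k
    using that simplical_face_in_standard_simplex [of "Suc (Suc 0)" k]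
    by (auto simp: singular_face_def fun_eq_iff numeral_2_eq_2)
  have "singular_simplex (Suc (Suc 0)) EC (?c 2)"
  proof -
    have "continuous_map (simplex_space 2) EC (?c 2)"
      by (rule continuous_map_eq [of _ _ "\<lambda>t. EC_basepoint"]) (auto simp: EC_basepoint_in)
    then show ?thesis
      by (simp add: singular_simplex_def numeral_2_eq_2)
  qed
  then have "(\<Sum>k\<le>Suc (Suc 0). \<phi> (singular_face (Suc (Suc 0)) k (?c 2))) = coboundary (Suc 0) EC \<phi> (?c 2)"
    by (simp add: coboundary_def)
  also have "\<dots> = 0"
    using \<phi> by (simp add: cocycle_set_iff)
  \<comment> \<open>The constant 2-simplex has three equal faces; as 3 is odd, the cocycle condition
    says that the value itself is 0.\<close>
  finally have "(\<Sum>k\<le>Suc (Suc 0). \<phi> (?c 1)) = 0"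
    using face by simp
  then have "\<phi> (?c 1) = 0"
    by (simp add: add.assoc)
  then have "cochain_pullback (Suc 0) EC (\<lambda>e. EC_basepoint) \<phi> = 0"
    by (auto simp: cochain_pullback_def simplex_map_const fun_eq_iff)
  then show ?thesis
    using EC_cocycle_const [OF \<phi>] by simp
qed

subsection \<open>The first cohomology group of the classifying space\<close>

lemma BC_cocycle_0:
  assumes \<phi>: "\<phi> \<in> cocycle_set 0 BC {}"
  shows "\<exists>c. \<phi> = (\<lambda>s. if singular_simplex 0 BC s then c else 0)"
proof -
  have "cochain_pullback 0 EC (orbit antipode) \<phi> \<in> cocycle_set 0 EC {}"
    using \<phi> EC.continuous_map_orbit by (intro cochain_pullback_cocycle) (auto simp: BC_def)
  then obtain c where c: "cochain_pullback 0 EC (orbit antipode) \<phi> = (\<lambda>s. if singular_simplex 0 EC s then c else 0)"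
    using EC_cocycle_0 by blast
  have "\<phi> = (\<lambda>s. if singular_simplex 0 BC s then c else 0)"
    unfolding BC_def
  proof (rule EC.base_cochain_eqI)
    show "\<phi> \<in> cochain_set 0 (orbit_space EC antipode) {}"
      using \<phi> by (simp add: BC_def cocycle_set_iff)
    show "(\<lambda>s. if singular_simplex 0 (orbit_space EC antipode) s then c else 0) \<in> cochain_set 0 (orbit_space EC antipode) {}"
      by (simp add: cochain_set_def singular_simplex_empty)
    fix s assume s: "singular_simplex 0 EC s"
    show "\<phi> (simplex_map 0 (orbit antipode) s) =
      (if singular_simplex 0 (orbit_space EC antipode) (simplex_map 0 (orbit antipode) s) then c else 0)"
      using fun_cong [OF c, of s] s singular_simplex_simplex_map [OF s EC.continuous_map_orbit]
      by (simp add: cochain_pullback_def)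
  qed
  then show ?thesis by blast
qed

text \<open>The pullback to \<open>EC\<close> is a coboundary, so up to coboundaries
  \<open>\<phi>\<close> is the product of a 0-cocycle \<open>b\<close> with the characteristic
  class; \<open>b\<close> is constant, 0 or 1.\<close>

lemma BC_cocycle_1:
  assumes \<phi>: "\<phi> \<in> cocycle_set (Suc 0) BC {}"
  shows "\<phi> \<in> coboundary_set (Suc 0) BC {} \<or> \<phi> + EC.char_cochain \<in> coboundary_set (Suc 0) BC {}"
proof -
  have "cochain_pullback (Suc 0) EC (orbit antipode) \<phi> \<in> cocycle_set (Suc 0) EC {}"
    using \<phi> EC.continuous_map_orbit by (intro cochain_pullback_cocycle) (auto simp: BC_def)
  then have "cochain_pullback (Suc 0) EC (orbit antipode) \<phi> \<in> coboundary_set (Suc 0) EC {}"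
    by (rule EC_cocycle_1)
  then obtain b where b: "b \<in> cocycle_set 0 BC {}"
    "\<phi> + cup_cochain 0 (Suc 0) BC b EC.char_cochain \<in> coboundary_set (Suc 0) BC {}"
    using EC.kernel_pullback_orbit_Suc [of "{}" \<phi> 0] \<phi> by (auto simp: BC_def)
  obtain c where c: "b = (\<lambda>s. if singular_simplex 0 BC s then c else 0)"
    using BC_cocycle_0 [OF b(1)] by blast
  show ?thesis
  proof (cases c)
    case zero
    then have "b = 0" using c by auto
    then show ?thesis using b(2) by simp
  next
    case one
    then have "b = unit_cochain BC" using c by auto
    then show ?thesis
      using b(2) EC.char_cochain_cocycle by (simp add: cup_unit_cochain_left [of _ _ _ "{}"] cocycle_set_iff BC_def)
  qed
qed

text \<open>Otherwise 1 would be the transfer of a 0-cocycle of \<open>EC\<close>; such a cocycle is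
  constant, and its transfer is \<open>c + c = 0\<close>.\<close>

lemma char_cochain_nontrivial: "EC.char_cochain \<notin> coboundary_set (Suc 0) BC {}"
proof
  assume "EC.char_cochain \<in> coboundary_set (Suc 0) BC {}"
  then have "cup_cochain 0 (Suc 0) BC (unit_cochain BC) EC.char_cochain \<in> coboundary_set (Suc 0) BC {}"
    using EC.char_cochain_cocycle by (simp add: cup_unit_cochain_left [of _ _ _ "{}"] cocycle_set_iff BC_def)
  then obtain \<phi> where \<phi>: "\<phi> \<in> cocycle_set 0 EC {}" and tr: "EC.transfer 0 \<phi> = unit_cochain BC"
    using EC.kernel_cup_char [of "{}" "unit_cochain BC" 0] unit_cochain_cocycle [of BC] by (auto simp: BC_def)
  obtain c where c: "\<phi> = (\<lambda>s. if singular_simplex 0 EC s then c else 0)"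
    using EC_cocycle_0 [OF \<phi>] by blast
  define s where "s = restrict (\<lambda>t. EC_basepoint) (standard_simplex 0)"
  have s: "singular_simplex 0 EC s"
  proof -
    have "continuous_map (simplex_space 0) EC s"
      unfolding s_def by (rule continuous_map_eq [of _ _ "\<lambda>t. EC_basepoint"]) (auto simp: EC_basepoint_in)
    then show ?thesis
      by (simp add: singular_simplex_def s_def)
  qed
  have "EC.transfer 0 \<phi> (simplex_map 0 (orbit antipode) s) = c + c"
    using EC.transfer_simplex [OF s, of \<phi>] s singular_simplex_simplex_map [OF s continuous_map_antipode]
    by (simp add: c)
  moreover have "unit_cochain BC (simplex_map 0 (orbit antipode) s) = 1"
    using singular_simplex_simplex_map [OF s EC.continuous_map_orbit] by (simp add: BC_def)
  ultimately show False
    by (simp add: tr)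
qed

section \<open>Cohomology classes\<close>

lemma cocycle_group_simps [simp]:
  "carrier (cocycle_group p X S) = cocycle_set p X S"
  "\<phi> \<otimes>\<^bsub>cocycle_group p X S\<^esub> \<psi> = \<phi> + \<psi>"
  "\<one>\<^bsub>cocycle_group p X S\<^esub> = 0"
  by (auto simp: cocycle_group_def plus_fun_def zero_fun_def)

lemma comm_group_cocycle_group: "comm_group (cocycle_group p X S)"
proof (rule comm_groupI)
  fix \<phi> assume "\<phi> \<in> carrier (cocycle_group p X S)"
  then show "\<exists>\<psi>\<in>carrier (cocycle_group p X S). \<psi> \<otimes>\<^bsub>cocycle_group p X S\<^esub> \<phi> = \<one>\<^bsub>cocycle_group p X S\<^esub>"
    by (intro bexI [of _ \<phi>]) auto
qed (auto simp: cocycle_set_add ac_simps)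

lemma normal_coboundary_set: "coboundary_set p X S \<lhd> cocycle_group p X S"
proof -
  interpret comm_group "cocycle_group p X S"
    by (rule comm_group_cocycle_group)
  have inv: "inv\<^bsub>cocycle_group p X S\<^esub> \<phi> = \<phi>" if "\<phi> \<in> cocycle_set p X S" for \<phi>
    using that by (intro inv_equality) auto
  have "subgroup (coboundary_set p X S) (cocycle_group p X S)"
    using coboundary_set_subset
    by (intro subgroupI) (auto simp: coboundary_set_add inv subset_iff intro: coboundary_set_0)
  then show ?thesis
    by (rule normal_iff_subgroup [THEN iffD2])
qed

lemma mem_cohomology_class: "\<psi> \<in> cohomology_class p X S \<phi> \<longleftrightarrow> \<psi> + \<phi> \<in> coboundary_set p X S"
proof
  assume "\<psi> + \<phi> \<in> coboundary_set p X S"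
  moreover have "\<psi> = (\<psi> + \<phi>) + \<phi>"
    by (simp add: add.assoc)
  ultimately show "\<psi> \<in> cohomology_class p X S \<phi>"
    unfolding cohomology_class_def r_coset_def cocycle_group_simps by blast
qed (auto simp: cohomology_class_def r_coset_def add.assoc)

lemma cohomology_class_eq_iff:
  "cohomology_class p X S \<phi> = cohomology_class p X S \<psi> \<longleftrightarrow> \<phi> + \<psi> \<in> coboundary_set p X S"
proof
  assume "cohomology_class p X S \<phi> = cohomology_class p X S \<psi>"
  then have "\<phi> \<in> cohomology_class p X S \<psi>"
    by (metis mem_cohomology_class cochain_add_self coboundary_set_0)
  then show "\<phi> + \<psi> \<in> coboundary_set p X S"
    by (simp add: mem_cohomology_class)
next
  assume *: "\<phi> + \<psi> \<in> coboundary_set p X S"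
  have "\<zeta> + \<phi> \<in> coboundary_set p X S \<longleftrightarrow> \<zeta> + \<psi> \<in> coboundary_set p X S" for \<zeta>
  proof -
    have "\<zeta> + \<phi> = (\<zeta> + \<psi>) + (\<phi> + \<psi>)" "\<zeta> + \<psi> = (\<zeta> + \<phi>) + (\<phi> + \<psi>)"
      by (simp_all add: ac_simps)
    then show ?thesis
      using coboundary_set_add [OF _ *] by metis
  qed
  then show "cohomology_class p X S \<phi> = cohomology_class p X S \<psi>"
    by (auto simp: mem_cohomology_class)
qed

lemma carrier_cohomology_group: "carrier (cohomology_group p X S) = cohomology_class p X S ` cocycle_set p X S"
  by (auto simp: cohomology_group_def FactGroup_def RCOSETS_def cohomology_class_def)

lemma cohomology_class_in [simp]:
  "\<phi> \<in> cocycle_set p X S \<Longrightarrow> cohomology_class p X S \<phi> \<in> carrier (cohomology_group p X S)"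
  by (simp add: carrier_cohomology_group)

lemma comm_group_cohomology_group: "comm_group (cohomology_group p X S)"
  unfolding cohomology_group_def
  by (intro comm_group.abelian_FactGroup comm_group_cocycle_group normal_imp_subgroup normal_coboundary_set)

lemma cohomology_mult:
  assumes "\<phi> \<in> cocycle_set p X S" "\<psi> \<in> cocycle_set p X S"
  shows "cohomology_class p X S \<phi> \<otimes>\<^bsub>cohomology_group p X S\<^esub> cohomology_class p X S \<psi> = cohomology_class p X S (\<phi> + \<psi>)"
  using normal.rcos_sum [OF normal_coboundary_set, of \<phi> p X S \<psi>] assms
  by (simp add: cohomology_group_def FactGroup_def cohomology_class_def)

lemma cohomology_one: "\<one>\<^bsub>cohomology_group p X S\<^esub> = cohomology_class p X S 0"
  by (auto simp: cohomology_group_def FactGroup_def mem_cohomology_class)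

lemma cohomology_class_eq_one_iff:
  "cohomology_class p X S \<phi> = \<one>\<^bsub>cohomology_group p X S\<^esub> \<longleftrightarrow> \<phi> \<in> coboundary_set p X S"
  by (simp add: cohomology_one cohomology_class_eq_iff)

lemma finprod_cohomology_class:
  assumes "finite I" "\<And>i. i \<in> I \<Longrightarrow> f i \<in> cocycle_set p X S"
  shows "finprod (cohomology_group p X S) (\<lambda>i. cohomology_class p X S (f i)) I = cohomology_class p X S (\<Sum>i\<in>I. f i)"
proof -
  interpret comm_group "cohomology_group p X S"
    by (rule comm_group_cohomology_group)
  show ?thesis
    using assms
  proof (induction I rule: finite_induct)
    case empty
    show ?case by (simp only: finprod_empty sum.empty cohomology_one)
  next
    case (insert i I)
    have "finprod (cohomology_group p X S) (\<lambda>i. cohomology_class p X S (f i)) (insert i I)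
        = cohomology_class p X S (f i) \<otimes>\<^bsub>cohomology_group p X S\<^esub> cohomology_class p X S (\<Sum>i\<in>I. f i)"
      using insert by (subst finprod_insert) auto
    also have "\<dots> = cohomology_class p X S (\<Sum>i\<in>insert i I. f i)"
      using insert by (simp add: cohomology_mult cocycle_set_sum)
    finally show ?case .
  qed
qed

lemma cohomology_map_class:
  assumes "continuous_map Y X f" "f ` (topspace Y \<inter> T) \<subseteq> S"
  shows "cohomology_map p Y T f (cohomology_class p X S \<phi>) = cohomology_class p Y T (cochain_pullback p Y f \<phi>)"
proof -
  have "cohomology_class p Y T (cochain_pullback p Y f \<psi>) = cohomology_class p Y T (cochain_pullback p Y f \<phi>)"
    if "\<psi> \<in> cohomology_class p X S \<phi>" for \<psi>
    using cochain_pullback_coboundary_set [OF _ assms] that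
    by (auto simp: mem_cohomology_class cohomology_class_eq_iff simp flip: cochain_pullback_add)
  moreover have "\<phi> \<in> cohomology_class p X S \<phi>"
    by (simp add: mem_cohomology_class)
  ultimately show ?thesis
    unfolding cohomology_map_def by blast
qed

text \<open>For other representatives the product changes by
  \<open>(\<phi>' + \<phi>) \<psi>' + \<phi> (\<psi>' + \<psi>)\<close>, a coboundary since
  \<open>\<psi>'\<close> and \<open>\<phi>\<close> are cocycles.\<close>

lemma cup_class:
  assumes \<phi>: "\<phi> \<in> cocycle_set p X S" and \<psi>: "\<psi> \<in> cocycle_set q X {}"
  shows "cup p q X S (cohomology_class p X S \<phi>) (cohomology_class q X {} \<psi>)
    = cohomology_class (p + q) X S (cup_cochain p q X \<phi> \<psi>)"
proof -
  have "cohomology_class (p + q) X S (cup_cochain p q X \<phi>' \<psi>') = cohomology_class (p + q) X S (cup_cochain p q X \<phi> \<psi>)"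
    if \<phi>': "\<phi>' \<in> cohomology_class p X S \<phi>" and \<psi>': "\<psi>' \<in> cohomology_class q X {} \<psi>" for \<phi>' \<psi>'
  proof -
    have d: "\<phi>' + \<phi> \<in> coboundary_set p X S" "\<psi>' + \<psi> \<in> coboundary_set q X {}"
      using that by (simp_all add: mem_cohomology_class)
    have "(\<psi>' + \<psi>) + \<psi> \<in> cocycle_set q X {}"
      using d(2) \<psi> coboundary_set_subset by (blast intro: cocycle_set_add)
    then have "\<psi>' \<in> cocycle_set q X {}"
      by (simp add: add.assoc)
    then have "cup_cochain p q X (\<phi>' + \<phi>) \<psi>' + cup_cochain p q X \<phi> (\<psi>' + \<psi>) \<in> coboundary_set (p + q) X S"
      using d \<phi> by (blast intro: coboundary_set_add cup_cochain_coboundary_left cup_cochain_coboundary_right)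
    moreover have "cup_cochain p q X (\<phi>' + \<phi>) \<psi>' + cup_cochain p q X \<phi> (\<psi>' + \<psi>)
       = cup_cochain p q X \<phi>' \<psi>' + cup_cochain p q X \<phi> \<psi>"
      by (simp add: cup_cochain_add_left cup_cochain_add_right ac_simps)
    ultimately show ?thesis
      by (simp add: cohomology_class_eq_iff)
  qed
  moreover have "\<phi> \<in> cohomology_class p X S \<phi>" "\<psi> \<in> cohomology_class q X {} \<psi>"
    by (simp_all add: mem_cohomology_class)
  ultimately show ?thesis
    unfolding cup_def by blast
qed

text \<open>\<open>BC\<close> has exactly one nonzero class of degree 1, so the definite description
  denotes the class found by the transfer sequence.\<close>

lemma u_class_eq: "u_class = cohomology_class 1 BC {} EC.char_cochain"
  unfolding u_class_def
proof (rule the_equality)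
  show "cohomology_class 1 BC {} EC.char_cochain \<in> carrier (cohomology_group 1 BC {}) \<and>
    cohomology_class 1 BC {} EC.char_cochain \<noteq> \<one>\<^bsub>cohomology_group 1 BC {}\<^esub>"
    using char_cochain_nontrivial EC.char_cochain_cocycle
    by (simp add: cohomology_class_eq_one_iff flip: BC_def)
next
  fix v assume v: "v \<in> carrier (cohomology_group 1 BC {}) \<and> v \<noteq> \<one>\<^bsub>cohomology_group 1 BC {}\<^esub>"
  then obtain \<phi> where "\<phi> \<in> cocycle_set (Suc 0) BC {}" "v = cohomology_class 1 BC {} \<phi>"
    by (auto simp: carrier_cohomology_group)
  with v show "v = cohomology_class 1 BC {} EC.char_cochain"
    using BC_cocycle_1 [of \<phi>] by (auto simp: cohomology_class_eq_one_iff cohomology_class_eq_iff)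
qed

primrec char_power :: "nat \<Rightarrow> (nat \<Rightarrow> real) set cochain" where
  "char_power 0 = unit_cochain BC"
| "char_power (Suc i) = cup_cochain i (Suc 0) BC (char_power i) EC.char_cochain"

lemma char_power_cocycle: "char_power i \<in> cocycle_set i BC {}"
proof (induction i)
  case 0
  then show ?case by (simp add: unit_cochain_cocycle)
next
  case (Suc i)
  then show ?case
    using cup_cochain_cocycle [OF Suc, of EC.char_cochain "Suc 0"] EC.char_cochain_cocycle by (simp add: BC_def)
qed

lemma cup_power_u_class: "cup_power BC u_class i = cohomology_class i BC {} (char_power i)"
proof (induction i)
  case 0
  then show ?case by (simp add: cohomology_unit_def)
next
  case (Suc i)
  then show ?case
    using cup_class [OF char_power_cocycle, of EC.char_cochain 1 i] EC.char_cochain_cocycle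
    by (simp add: u_class_eq BC_def)
qed

section \<open>Equivariant cohomology of a pair\<close>

definition borel_char :: "'a topology \<Rightarrow> ('a \<Rightarrow> 'a) \<Rightarrow> ((nat \<Rightarrow> real) \<times> 'a) set cochain" where
  "borel_char X \<tau> = cochain_pullback (Suc 0) (borel_space X \<tau>) borel_to_BC EC.char_cochain"

definition borel_power :: "'a topology \<Rightarrow> ('a \<Rightarrow> 'a) \<Rightarrow> nat \<Rightarrow> ((nat \<Rightarrow> real) \<times> 'a) set cochain" where
  "borel_power X \<tau> i = cochain_pullback i (borel_space X \<tau>) borel_to_BC (char_power i)"

definition fibre_inclusion :: "('a \<Rightarrow> 'a) \<Rightarrow> 'a \<Rightarrow> ((nat \<Rightarrow> real) \<times> 'a) set" where
  "fibre_inclusion \<tau> x = orbit (borel_involution \<tau>) (EC_basepoint, x)"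

lemma borel_to_BC_orbit [simp]: "borel_to_BC (orbit (borel_involution \<tau>) z) = orbit antipode (fst z)"
  by (cases z) (auto simp: borel_to_BC_def orbit_def borel_involution_def)

lemma borel_to_BC_borel_map [simp]: "borel_to_BC (borel_map f z) = borel_to_BC z"
  by (force simp: borel_to_BC_def borel_map_def)

locale borel_pair =
  fixes X :: "'a topology" and \<tau> :: "'a \<Rightarrow> 'a" and Y :: "'a set"
  assumes inv_on: "involution_on X \<tau>" and subset: "Y \<subseteq> topspace X" and invariant: "\<tau> ` Y = Y"
begin

sublocale antipodal_space "prod_topology EC X" "borel_involution \<tau>" fst
  using inv_on by (rule borel_antipodal)

abbreviation "BX \<equiv> borel_space X \<tau>"
abbreviation "BY \<equiv> borel_subset \<tau> Y"
abbreviation "TX \<equiv> prod_topology EC X"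
abbreviation "TY \<equiv> topspace EC \<times> Y"

lemma TY: "TY \<subseteq> topspace TX" "borel_involution \<tau> ` TY \<subseteq> TY"
  using subset invariant by (auto simp: borel_involution_def)

lemma BY_eq: "BY = q ` TY"
  by (simp add: borel_subset_def)

lemma BX_eq: "BX = B"
  by (simp add: borel_space_def)

lemma topspace_BX: "topspace BX = q ` (topspace EC \<times> topspace X)"
  using topspace_B by (simp add: BX_eq)

lemma continuous_map_borel_to_BC: "continuous_map BX BC borel_to_BC"
  unfolding BX_eq
proof (rule continuous_compose_quotient_map [OF quotient_map_orbit])
  have "borel_to_BC \<circ> orbit (borel_involution \<tau>) = orbit antipode \<circ> fst"
    by (simp add: fun_eq_iff)
  then show "continuous_map TX BC (borel_to_BC \<circ> orbit (borel_involution \<tau>))"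
    using continuous_map_compose [OF continuous_map_fst EC.continuous_map_orbit] by (simp add: BC_def)
qed

text \<open>This holds for cochains, not just classes: \<open>hemisphere\<close> looks only at the
  \<open>EC\<close> factor, and pullback along \<open>q\<close> is injective. Thus multiplication by
  the \<open>u\<close> of the conjugation equation is the connecting homomorphism of the covering of
  \<open>BX\<close> by \<open>TX\<close>.\<close>

lemma char_cochain_eq: "char_cochain = borel_char X \<tau>"
proof (rule pullback_orbit_inject)
  show "char_cochain \<in> cochain_set (Suc 0) B {}"
    using char_cochain_cocycle by (simp add: cocycle_set_iff)
  have "EC.char_cochain \<in> cochain_set (Suc 0) BC {}"
    using EC.char_cochain_cocycle by (simp add: cocycle_set_iff BC_def)
  then show "borel_char X \<tau> \<in> cochain_set (Suc 0) B {}"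
    unfolding borel_char_def BX_eq [symmetric]
    by (rule cochain_pullback_cochain [OF _ continuous_map_borel_to_BC]) simp
  have "cochain_pullback (Suc 0) TX q (borel_char X \<tau>)
      = cochain_pullback (Suc 0) TX (borel_to_BC \<circ> q) EC.char_cochain"
    unfolding borel_char_def BX_eq by (rule cochain_pullback_compose [OF continuous_map_orbit])
  also have "borel_to_BC \<circ> q = orbit antipode \<circ> fst"
    by (simp add: fun_eq_iff)
  also have "cochain_pullback (Suc 0) TX (orbit antipode \<circ> fst) EC.char_cochain
      = cochain_pullback (Suc 0) TX fst (cochain_pullback (Suc 0) EC (orbit antipode) EC.char_cochain)"
    by (rule cochain_pullback_compose [symmetric]) (rule continuous_map_fst)
  also have "\<dots> = coboundary 0 TX (cochain_pullback 0 TX fst EC.hemisphere)"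
    by (simp only: EC.pullback_char_cochain coboundary_pullback [OF continuous_map_fst])
  also have "cochain_pullback 0 TX fst EC.hemisphere = hemisphere"
  proof
    fix s
    show "cochain_pullback 0 TX fst EC.hemisphere s = hemisphere s"
    proof (cases "singular_simplex 0 TX s")
      case True
      then have "singular_simplex 0 EC (simplex_map 0 fst s)"
        using continuous_map_fst by (rule singular_simplex_simplex_map)
      moreover have "simplex_map 0 fst s (\<lambda>j. if j = 0 then 1 else 0) = fst (s (\<lambda>j. if j = 0 then 1 else 0))"
        by (simp add: simplex_map_def)
      ultimately show ?thesis
        using True by (simp add: cochain_pullback_def EC.hemisphere_def hemisphere_def)
    qed (simp add: cochain_pullback_def hemisphere_def)
  qed
  finally show "cochain_pullback (Suc 0) TX q char_cochain = cochain_pullback (Suc 0) TX q (borel_char X \<tau>)"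
    by (simp add: pullback_char_cochain)
qed

lemma borel_char_cocycle: "borel_char X \<tau> \<in> cocycle_set (Suc 0) BX {}"
  using char_cochain_cocycle by (simp add: char_cochain_eq BX_eq)

lemma borel_power_cocycle: "borel_power X \<tau> i \<in> cocycle_set i BX {}"
  unfolding borel_power_def
  by (intro cochain_pullback_cocycle [OF char_power_cocycle continuous_map_borel_to_BC]) simp

lemma borel_power_0: "borel_power X \<tau> 0 = unit_cochain BX"
  using singular_simplex_simplex_map [OF _ continuous_map_borel_to_BC]
  by (auto simp: borel_power_def cochain_pullback_def)

lemma borel_power_Suc: "borel_power X \<tau> (Suc i) = cup_cochain i (Suc 0) BX (borel_power X \<tau> i) (borel_char X \<tau>)"
  using cup_cochain_pullback [OF continuous_map_borel_to_BC, of i "Suc 0"]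
  by (simp add: borel_power_def borel_char_def)

section \<open>Restriction to the fibre\<close>

lemma continuous_map_basepoint: "continuous_map X TX (Pair EC_basepoint)"
  by (auto simp: continuous_map_pairwise o_def EC_basepoint_in)

lemma fibre_inclusion_eq: "fibre_inclusion \<tau> = q \<circ> Pair EC_basepoint"
  by (simp add: fun_eq_iff fibre_inclusion_def)

lemma continuous_map_fibre_inclusion: "continuous_map X BX (fibre_inclusion \<tau>)"
  unfolding fibre_inclusion_eq BX_eq
  by (rule continuous_map_compose [OF continuous_map_basepoint continuous_map_orbit])

lemma fibre_inclusion_subset: "fibre_inclusion \<tau> ` (topspace X \<inter> Y) \<subseteq> BY"
  using EC_basepoint_in by (auto simp: fibre_inclusion_def BY_eq)

text \<open>The contraction of \<open>EC\<close>, applied to the first factor, preserves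
  \<open>TY\<close> and joins the identity to the projection onto the slice at the base
  point.\<close>

lemma TX_cocycle_homologous:
  assumes "\<phi> \<in> cocycle_set n TX TY"
  shows "\<phi> + cochain_pullback n TX (Pair EC_basepoint \<circ> snd) \<phi> \<in> coboundary_set n TX TY"
proof -
  obtain h where h: "continuous_map (prod_topology unit_interval EC) EC h"
    "\<And>e. h (0, e) = e" "\<And>e. h (1, e) = EC_basepoint"
    using homotopic_EC_id_const by (auto simp: homotopic_with_def)
  define H where "H = (\<lambda>z::real \<times> (nat \<Rightarrow> real) \<times> 'a. (h (fst z, fst (snd z)), snd (snd z)))"
  have "continuous_map (prod_topology unit_interval TX) TX H"
    unfolding H_def
  proof (intro continuous_map_pairedI)
    have s: "continuous_map (prod_topology unit_interval TX) EC (\<lambda>z. fst (snd z))"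
      "continuous_map (prod_topology unit_interval TX) X (\<lambda>z. snd (snd z))"
      using continuous_map_compose [OF continuous_map_snd continuous_map_fst, of unit_interval EC X]
        continuous_map_compose [OF continuous_map_snd continuous_map_snd, of unit_interval EC X]
      by (simp_all add: o_def)
    have "continuous_map (prod_topology unit_interval TX) (prod_topology unit_interval EC) (\<lambda>z. (fst z, fst (snd z)))"
      by (intro continuous_map_pairedI continuous_map_fst s)
    from continuous_map_compose [OF this h(1)]
    show "continuous_map (prod_topology unit_interval TX) EC (\<lambda>z. h (fst z, fst (snd z)))"
      by (simp add: o_def)
    show "continuous_map (prod_topology unit_interval TX) X (\<lambda>z. snd (snd z))"
      by (rule s)
  qed
  moreover have "h (t, e) \<in> topspace EC" if "0 \<le> t" "t \<le> 1" "e \<in> topspace EC" for t e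
    using h(1) that by (auto simp: continuous_map_def Pi_iff)
  ultimately have "homotopic_with (\<lambda>k. k ` (topspace TX \<inter> TY) \<subseteq> TY) TX TX id (Pair EC_basepoint \<circ> snd)"
    unfolding homotopic_with_def by (intro exI [of _ H]) (auto simp: H_def h)
  from homotopic_cochain_pullback [OF this assms] show ?thesis
    using assms by (simp add: cochain_pullback_id [of _ _ _ TY] cocycle_set_iff)
qed

text \<open>The pullback of \<open>b\<close> to \<open>TX\<close> is homologous to the pullback of
  its fibre restriction along \<open>snd\<close>. So the kernel of \<rho> lies in the kernel of
  pullback along \<open>q\<close>, which the transfer sequence describes.\<close>

lemma kernel_fibre:
  assumes b: "b \<in> cocycle_set n BX BY" and 0: "cochain_pullback n X (fibre_inclusion \<tau>) b \<in> coboundary_set n X Y"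
  shows "cochain_pullback n TX q b \<in> coboundary_set n TX TY"
proof -
  let ?\<phi> = "cochain_pullback n TX q b"
  have \<phi>: "?\<phi> \<in> cocycle_set n TX TY"
    using b by (intro cochain_pullback_cocycle [OF _ continuous_map_orbit]) (auto simp: BX_eq BY_eq)
  have "cochain_pullback n TX snd (cochain_pullback n X (fibre_inclusion \<tau>) b) \<in> coboundary_set n TX TY"
    using 0 by (rule cochain_pullback_coboundary_set) (auto simp: continuous_map_snd)
  also have "cochain_pullback n TX snd (cochain_pullback n X (fibre_inclusion \<tau>) b)
      = cochain_pullback n TX (Pair EC_basepoint \<circ> snd) ?\<phi>"
    using cochain_pullback_compose [OF continuous_map_snd, of n EC X "fibre_inclusion \<tau>" b]
      cochain_pullback_compose [OF continuous_map_compose [OF continuous_map_snd continuous_map_basepoint], of n EC q b]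
    by (simp add: fibre_inclusion_eq comp_assoc)
  finally have "(?\<phi> + cochain_pullback n TX (Pair EC_basepoint \<circ> snd) ?\<phi>) +
      cochain_pullback n TX (Pair EC_basepoint \<circ> snd) ?\<phi> \<in> coboundary_set n TX TY"
    by (intro coboundary_set_add TX_cocycle_homologous \<phi>)
  then show ?thesis
    by (simp add: add.assoc)
qed

lemma kernel_fibre_0:
  assumes "b \<in> cocycle_set 0 BX BY" and "cochain_pullback 0 X (fibre_inclusion \<tau>) b \<in> coboundary_set 0 X Y"
  shows "b = 0"
  using kernel_pullback_orbit_0 [OF TY, of b] kernel_fibre [OF assms] assms(1) by (simp add: BX_eq BY_eq)

lemma kernel_fibre_Suc:
  assumes "b \<in> cocycle_set (Suc n) BX BY"
    and "cochain_pullback (Suc n) X (fibre_inclusion \<tau>) b \<in> coboundary_set (Suc n) X Y"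
  obtains b' where "b' \<in> cocycle_set n BX BY"
    "b + cup_cochain n (Suc 0) BX b' (borel_char X \<tau>) \<in> coboundary_set (Suc n) BX BY"
  using kernel_pullback_orbit_Suc [OF TY, of b n] kernel_fibre [OF assms] assms(1)
  by (auto simp: BX_eq BY_eq char_cochain_eq)

text \<open>The fibre inclusion factors through \<open>TX\<close>, where the characteristic cochain
  becomes the coboundary of \<open>hemisphere\<close>.\<close>

lemma pullback_fibre_borel_char:
  "cochain_pullback (Suc 0) X (fibre_inclusion \<tau>) (borel_char X \<tau>) \<in> coboundary_set (Suc 0) X {}"
proof -
  have "cochain_pullback (Suc 0) X (fibre_inclusion \<tau>) (borel_char X \<tau>)
    = cochain_pullback (Suc 0) X (Pair EC_basepoint) (coboundary 0 TX hemisphere)"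
    using cochain_pullback_compose [OF continuous_map_basepoint, of "Suc 0" q char_cochain]
    by (simp only: fibre_inclusion_eq pullback_char_cochain flip: char_cochain_eq)
  also have "coboundary 0 TX hemisphere \<in> coboundary_set (Suc 0) TX {}"
    using hemisphere_cochain by (simp add: coboundary_set_Suc)
  then have "cochain_pullback (Suc 0) X (Pair EC_basepoint) (coboundary 0 TX hemisphere) \<in> coboundary_set (Suc 0) X {}"
    by (rule cochain_pullback_coboundary_set [OF _ continuous_map_basepoint]) simp
  finally show ?thesis .
qed

lemma pullback_fibre_cup_borel_char:
  assumes "x \<in> cocycle_set n BX BY"
  shows "cochain_pullback (Suc n) X (fibre_inclusion \<tau>) (cup_cochain n (Suc 0) BX x (borel_char X \<tau>))
    \<in> coboundary_set (Suc n) X Y"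
proof -
  have "cochain_pullback n X (fibre_inclusion \<tau>) x \<in> cocycle_set n X Y"
    using assms continuous_map_fibre_inclusion fibre_inclusion_subset by (rule cochain_pullback_cocycle)
  from cup_cochain_coboundary_right [OF this pullback_fibre_borel_char] show ?thesis
    using cup_cochain_pullback [OF continuous_map_fibre_inclusion, of n "Suc 0" x "borel_char X \<tau>"] by simp
qed

lemma cup_borel_char_coboundary:
  "x \<in> coboundary_set n BX BY \<Longrightarrow> cup_cochain n (Suc 0) BX x (borel_char X \<tau>) \<in> coboundary_set (Suc n) BX BY"
  using cup_cochain_coboundary_left [OF _ borel_char_cocycle, of x n BY] by simp

end

subsection \<open>Naturality\<close>

locale equivariant_map = Y: borel_pair Y \<tau>\<^sub>Y Y\<^sub>0 + X: borel_pair X \<tau>\<^sub>X X\<^sub>0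
  for Y :: "'b topology" and \<tau>\<^sub>Y Y\<^sub>0 and X :: "'a topology" and \<tau>\<^sub>X X\<^sub>0 +
  fixes f :: "'b \<Rightarrow> 'a"
  assumes continuous: "continuous_map Y X f" and map_subset: "f ` Y\<^sub>0 \<subseteq> X\<^sub>0"
    and equivariant: "\<And>y. y \<in> topspace Y \<Longrightarrow> f (\<tau>\<^sub>Y y) = \<tau>\<^sub>X (f y)"
begin

lemma borel_map_orbit:
  assumes "y \<in> topspace Y"
  shows "borel_map f (orbit (borel_involution \<tau>\<^sub>Y) (e, y)) = orbit (borel_involution \<tau>\<^sub>X) (e, f y)"
  using equivariant [OF assms] by (auto simp: borel_map_def orbit_def borel_involution_def)

lemma continuous_map_borel_map: "continuous_map (borel_space Y \<tau>\<^sub>Y) (borel_space X \<tau>\<^sub>X) (borel_map f)"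
  unfolding Y.BX_eq
proof (rule continuous_compose_quotient_map [OF Y.quotient_map_orbit])
  have "continuous_map (prod_topology EC Y) (prod_topology EC X) (map_prod id f)"
    unfolding map_prod_def by (subst continuous_map_prod_top) (simp add: continuous)
  then have "continuous_map (prod_topology EC Y) (borel_space X \<tau>\<^sub>X) (orbit (borel_involution \<tau>\<^sub>X) \<circ> map_prod id f)"
    unfolding X.BX_eq by (rule continuous_map_compose [OF _ X.continuous_map_orbit])
  then show "continuous_map (prod_topology EC Y) (borel_space X \<tau>\<^sub>X) (borel_map f \<circ> orbit (borel_involution \<tau>\<^sub>Y))"
    by (rule continuous_map_eq) (auto simp: borel_map_orbit)
qed

lemma borel_map_subset: "borel_map f ` (topspace (borel_space Y \<tau>\<^sub>Y) \<inter> borel_subset \<tau>\<^sub>Y Y\<^sub>0) \<subseteq> borel_subset \<tau>\<^sub>X X\<^sub>0"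
  using map_subset Y.subset by (auto simp: borel_subset_def borel_map_orbit subset_iff image_subset_iff)

lemma map_subset': "f ` (topspace Y \<inter> Y\<^sub>0) \<subseteq> X\<^sub>0"
  using map_subset by auto

lemma pullback_borel_char:
  "cochain_pullback (Suc 0) (borel_space Y \<tau>\<^sub>Y) (borel_map f) (borel_char X \<tau>\<^sub>X) = borel_char Y \<tau>\<^sub>Y"
  unfolding borel_char_def
  by (simp add: cochain_pullback_compose [OF continuous_map_borel_map] o_def)

lemma pullback_borel_power:
  "cochain_pullback i (borel_space Y \<tau>\<^sub>Y) (borel_map f) (borel_power X \<tau>\<^sub>X i) = borel_power Y \<tau>\<^sub>Y i"
  unfolding borel_power_def
  by (simp add: cochain_pullback_compose [OF continuous_map_borel_map] o_def)

lemma pullback_fibre_borel_map: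
  "cochain_pullback n Y (fibre_inclusion \<tau>\<^sub>Y) (cochain_pullback n (borel_space Y \<tau>\<^sub>Y) (borel_map f) b)
    = cochain_pullback n Y f (cochain_pullback n X (fibre_inclusion \<tau>\<^sub>X) b)"
proof -
  have "cochain_pullback n Y (borel_map f \<circ> fibre_inclusion \<tau>\<^sub>Y) b = cochain_pullback n Y (fibre_inclusion \<tau>\<^sub>X \<circ> f) b"
    by (rule cochain_pullback_cong) (simp add: fibre_inclusion_def borel_map_orbit)
  then show ?thesis
    by (simp add: cochain_pullback_compose [OF Y.continuous_map_fibre_inclusion] cochain_pullback_compose [OF continuous])
qed

end

section \<open>Trivial actions\<close>

definition monomial_cochain ::
  "'a topology \<Rightarrow> ('a \<Rightarrow> 'a) \<Rightarrow> nat \<Rightarrow> nat \<Rightarrow> 'a cochain \<Rightarrow> ((nat \<Rightarrow> real) \<times> 'a) set cochain" where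
  "monomial_cochain X \<tau> d i c = cup_cochain d i (borel_space X \<tau>)
     (cochain_pullback d (borel_space X \<tau>) borel_to_space c) (borel_power X \<tau> i)"

text \<open>Here \<open>n\<close> is the total degree, so the coefficient of \<open>u\<^sup>i\<close> has degree \<open>n - i\<close>.\<close>

definition polynomial_cochain ::
  "'a topology \<Rightarrow> ('a \<Rightarrow> 'a) \<Rightarrow> nat \<Rightarrow> nat \<Rightarrow> (nat \<Rightarrow> 'a cochain) \<Rightarrow> ((nat \<Rightarrow> real) \<times> 'a) set cochain" where
  "polynomial_cochain X \<tau> n k c = (\<Sum>i<k. monomial_cochain X \<tau> (n - i) i (c i))"

lemma monomial_cochain_add: "monomial_cochain X \<tau> d i (a + b) = monomial_cochain X \<tau> d i a + monomial_cochain X \<tau> d i b"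
  by (simp add: monomial_cochain_def cochain_pullback_add cup_cochain_add_left)

lemma polynomial_cochain_add:
  "polynomial_cochain X \<tau> n k (\<lambda>i. a i + b i) = polynomial_cochain X \<tau> n k a + polynomial_cochain X \<tau> n k b"
  by (simp add: polynomial_cochain_def monomial_cochain_add sum.distrib)

text \<open>Padding with zero coefficients lets polynomials with different numbers of terms be
  added.\<close>

lemma polynomial_cochain_extend:
  assumes "k \<le> l"
  shows "polynomial_cochain X \<tau> n l (\<lambda>i. if i < k then a i else 0) = polynomial_cochain X \<tau> n k a"
proof -
  have "monomial_cochain X \<tau> (n - i) i 0 = 0" for i
    by (simp add: monomial_cochain_def)
  then show ?thesis
    unfolding polynomial_cochain_def using assms
    by (intro sum.mono_neutral_cong_right) auto
qed

locale borel_trivial = borel_pair +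
  assumes trivial: "\<And>x. x \<in> topspace X \<Longrightarrow> \<tau> x = x"
begin

lemma borel_to_space_orbit:
  assumes "x \<in> topspace X"
  shows "borel_to_space (q (e, x)) = x"
  using trivial [OF assms] by (simp add: borel_to_space_def orbit_def borel_involution_def)

lemma continuous_map_borel_to_space: "continuous_map BX X borel_to_space"
  unfolding BX_eq
proof (rule continuous_compose_quotient_map [OF quotient_map_orbit])
  show "continuous_map TX X (borel_to_space \<circ> q)"
    by (rule continuous_map_eq [OF continuous_map_snd]) (auto simp: borel_to_space_orbit)
qed

lemma borel_to_space_subset: "borel_to_space ` (topspace BX \<inter> BY) \<subseteq> Y"
  using subset by (auto simp: BY_eq borel_to_space_orbit)

lemma pullback_borel_to_space_cocycle:
  "c \<in> cocycle_set n X Y \<Longrightarrow> cochain_pullback n BX borel_to_space c \<in> cocycle_set n BX BY"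
  by (rule cochain_pullback_cocycle [OF _ continuous_map_borel_to_space borel_to_space_subset])

text \<open>For a trivial action the projection of \<open>TX\<close> to \<open>X\<close> factors
  through the orbit space. As \<open>EC\<close> is contractible, every class of \<open>TX\<close>
  comes from \<open>X\<close>, hence from the orbit space, and \<open>cup_char_inject\<close>
  applies.\<close>

lemma cup_borel_char_inject:
  assumes x: "x \<in> cocycle_set n BX BY"
    and 0: "cup_cochain n (Suc 0) BX x (borel_char X \<tau>) \<in> coboundary_set (Suc n) BX BY"
  shows "x \<in> coboundary_set n BX BY"
proof -
  have "\<exists>y\<in>cocycle_set n B (q ` TY). \<phi> + cochain_pullback n TX q y \<in> coboundary_set n TX TY"
    if \<phi>: "\<phi> \<in> cocycle_set n TX TY" for \<phi>
  proof
    let ?c = "cochain_pullback n X (Pair EC_basepoint) \<phi>"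
    have c: "?c \<in> cocycle_set n X Y"
      using \<phi> by (rule cochain_pullback_cocycle [OF _ continuous_map_basepoint]) (auto simp: EC_basepoint_in)
    then show "cochain_pullback n BX borel_to_space ?c \<in> cocycle_set n B (q ` TY)"
      using pullback_borel_to_space_cocycle by (simp add: BX_eq BY_eq)
    have "cochain_pullback n TX q (cochain_pullback n BX borel_to_space ?c) = cochain_pullback n TX (borel_to_space \<circ> q) ?c"
      unfolding BX_eq by (rule cochain_pullback_compose [OF continuous_map_orbit])
    also have "\<dots> = cochain_pullback n TX snd ?c"
      by (rule cochain_pullback_cong) (auto simp: borel_to_space_orbit)
    also have "\<dots> = cochain_pullback n TX (Pair EC_basepoint \<circ> snd) \<phi>"
      by (rule cochain_pullback_compose [OF continuous_map_snd])
    finally show "\<phi> + cochain_pullback n TX q (cochain_pullback n BX borel_to_space ?c) \<in> coboundary_set n TX TY"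
      using TX_cocycle_homologous [OF \<phi>] by simp
  qed
  then show ?thesis
    using cup_char_inject [OF TY, of x n] x 0 by (simp add: BX_eq BY_eq char_cochain_eq)
qed

section \<open>Monomials and polynomials in \<open>u\<close>\<close>

lemma monomial_cochain_cocycle:
  assumes "c \<in> cocycle_set d X Y"
  shows "monomial_cochain X \<tau> d i c \<in> cocycle_set (d + i) BX BY"
  unfolding monomial_cochain_def
  by (intro cup_cochain_cocycle pullback_borel_to_space_cocycle assms borel_power_cocycle)

lemma monomial_cochain_0:
  assumes "c \<in> cocycle_set d X Y"
  shows "monomial_cochain X \<tau> d 0 c = cochain_pullback d BX borel_to_space c"
  using pullback_borel_to_space_cocycle [OF assms]
  by (simp add: monomial_cochain_def borel_power_0 cup_unit_cochain_right [of _ _ _ BY] cocycle_set_iff)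

lemma monomial_cochain_Suc:
  "monomial_cochain X \<tau> d (Suc i) c = cup_cochain (d + i) (Suc 0) BX (monomial_cochain X \<tau> d i c) (borel_char X \<tau>)"
  using cup_cochain_assoc [of d i "Suc 0" BX] by (simp add: monomial_cochain_def borel_power_Suc)

lemma pullback_fibre_monomial_0:
  assumes c: "c \<in> cocycle_set d X Y"
  shows "cochain_pullback d X (fibre_inclusion \<tau>) (monomial_cochain X \<tau> d 0 c) = c"
proof -
  have "cochain_pullback d X (fibre_inclusion \<tau>) (monomial_cochain X \<tau> d 0 c)
      = cochain_pullback d X (borel_to_space \<circ> fibre_inclusion \<tau>) c"
    unfolding monomial_cochain_0 [OF c] by (rule cochain_pullback_compose [OF continuous_map_fibre_inclusion])
  also have "\<dots> = c"
    using c by (intro cochain_pullback_id [of _ _ _ Y]) (auto simp: cocycle_set_iff fibre_inclusion_def borel_to_space_orbit)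
  finally show ?thesis .
qed

lemma monomial_cochain_0_coboundary:
  assumes "c \<in> coboundary_set d X Y"
  shows "monomial_cochain X \<tau> d 0 c \<in> coboundary_set d BX BY"
  using assms coboundary_set_subset cochain_pullback_coboundary_set [OF assms continuous_map_borel_to_space borel_to_space_subset]
  by (subst monomial_cochain_0) auto

lemma polynomial_cochain_cocycle:
  assumes "k \<le> Suc n" "\<And>i. i < k \<Longrightarrow> c i \<in> cocycle_set (n - i) X Y"
  shows "polynomial_cochain X \<tau> n k c \<in> cocycle_set n BX BY"
  unfolding polynomial_cochain_def
proof (rule cocycle_set_sum)
  fix i assume "i \<in> {..<k}"
  then show "monomial_cochain X \<tau> (n - i) i (c i) \<in> cocycle_set n BX BY"
    using monomial_cochain_cocycle [of "c i" "n - i" i] assms by auto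
qed

text \<open>The constant term is split off and one factor \<open>u\<close> is taken out of the rest.
  Total degree and index drop together, so the coefficients keep their degrees:
  \<open>Suc n - Suc i = n - i\<close>.\<close>

lemma polynomial_cochain_Suc:
  assumes "k \<le> Suc n"
  shows "polynomial_cochain X \<tau> (Suc n) (Suc k) c = monomial_cochain X \<tau> (Suc n) 0 (c 0)
    + cup_cochain n (Suc 0) BX (polynomial_cochain X \<tau> n k (\<lambda>i. c (Suc i))) (borel_char X \<tau>)"
proof -
  have "(\<Sum>i<k. monomial_cochain X \<tau> (Suc n - Suc i) (Suc i) (c (Suc i)))
     = (\<Sum>i<k. cup_cochain n (Suc 0) BX (monomial_cochain X \<tau> (n - i) i (c (Suc i))) (borel_char X \<tau>))"
    using assms by (intro sum.cong) (auto simp: monomial_cochain_Suc)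
  then show ?thesis
    unfolding polynomial_cochain_def sum.lessThan_Suc_shift by (simp add: cup_cochain_sum_left)
qed

text \<open>Restriction to the fibre picks out the constant term; the rest is divided by \<open>u\<close>.\<close>

lemma polynomial_divide:
  assumes k: "k \<le> Suc n" and c: "\<And>i. i < Suc k \<Longrightarrow> c i \<in> cocycle_set (Suc n - i) X Y"
    and x: "x \<in> cocycle_set n BX BY"
    and 0: "cup_cochain n (Suc 0) BX x (borel_char X \<tau>) + polynomial_cochain X \<tau> (Suc n) (Suc k) c
      \<in> coboundary_set (Suc n) BX BY"
  shows "x + polynomial_cochain X \<tau> n k (\<lambda>i. c (Suc i)) \<in> coboundary_set n BX BY"
proof -
  let ?P = "polynomial_cochain X \<tau> n k (\<lambda>i. c (Suc i))"
  let ?u = "borel_char X \<tau>"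
  have P: "?P \<in> cocycle_set n BX BY"
    using k c by (intro polynomial_cochain_cocycle) force+
  have xP: "x + ?P \<in> cocycle_set n BX BY"
    using x P by (rule cocycle_set_add)
  have c0: "c 0 \<in> cocycle_set (Suc n) X Y"
    using c [of 0] by simp
  have eq: "cup_cochain n (Suc 0) BX x ?u + polynomial_cochain X \<tau> (Suc n) (Suc k) c
     = monomial_cochain X \<tau> (Suc n) 0 (c 0) + cup_cochain n (Suc 0) BX (x + ?P) ?u"
    unfolding polynomial_cochain_Suc [OF k] by (simp add: cup_cochain_add_left ac_simps)
  have "cochain_pullback (Suc n) X (fibre_inclusion \<tau>)
     (monomial_cochain X \<tau> (Suc n) 0 (c 0) + cup_cochain n (Suc 0) BX (x + ?P) ?u) \<in> coboundary_set (Suc n) X Y"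
    using 0 unfolding eq
    by (rule cochain_pullback_coboundary_set [OF _ continuous_map_fibre_inclusion fibre_inclusion_subset])
  then have "c 0 + cochain_pullback (Suc n) X (fibre_inclusion \<tau>) (cup_cochain n (Suc 0) BX (x + ?P) ?u)
     \<in> coboundary_set (Suc n) X Y"
    by (simp add: cochain_pullback_add pullback_fibre_monomial_0 [OF c0])
  from coboundary_set_add [OF this pullback_fibre_cup_borel_char [OF xP]]
  have "c 0 \<in> coboundary_set (Suc n) X Y"
    by (simp add: add.assoc)
  then have "monomial_cochain X \<tau> (Suc n) 0 (c 0) \<in> coboundary_set (Suc n) BX BY"
    by (rule monomial_cochain_0_coboundary)
  from coboundary_set_add [OF this 0 [unfolded eq]]
  have "cup_cochain n (Suc 0) BX (x + ?P) ?u \<in> coboundary_set (Suc n) BX BY"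
    by simp
  then show ?thesis
    by (rule cup_borel_char_inject [OF xP])
qed

text \<open>Division by \<open>u\<close>, with 0 in the role of \<open>x\<close> in
  \<open>polynomial_divide\<close>, is repeated \<open>k\<close> times; it brings the top
  coefficient to the constant place, where restriction to the fibre reads it off.\<close>

lemma polynomial_leading_coefficient:
  assumes "k \<le> n" "\<And>i. i \<le> k \<Longrightarrow> c i \<in> cocycle_set (n - i) X Y"
    and "polynomial_cochain X \<tau> n (Suc k) c \<in> coboundary_set n BX BY"
  shows "c k \<in> coboundary_set (n - k) X Y"
  using assms
proof (induction k arbitrary: n c)
  case 0
  then have c0: "c 0 \<in> cocycle_set n X Y" and "monomial_cochain X \<tau> n 0 (c 0) \<in> coboundary_set n BX BY"
    by (auto simp: polynomial_cochain_def)
  then show ?case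
    using cochain_pullback_coboundary_set [OF _ continuous_map_fibre_inclusion fibre_inclusion_subset]
      pullback_fibre_monomial_0 [OF c0] by fastforce
next
  case (Suc k)
  obtain n' where n: "n = Suc n'"
    using Suc.prems(1) by (cases n) auto
  have "0 + polynomial_cochain X \<tau> n' (Suc k) (\<lambda>i. c (Suc i)) \<in> coboundary_set n' BX BY"
    using Suc.prems by (intro polynomial_divide) (auto simp: n simp flip: zero_fun_def)
  moreover have "c (Suc i) \<in> cocycle_set (n' - i) X Y" if "i \<le> k" for i
    using Suc.prems(2) [of "Suc i"] that by (simp add: n)
  ultimately show ?case
    using Suc.IH [of n' "\<lambda>i. c (Suc i)"] Suc.prems(1) by (simp add: n)
qed

lemma u_monomial_class:
  assumes c: "c \<in> cocycle_set d X Y"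
  shows "u_monomial d i X \<tau> Y (cohomology_class d X Y c) = cohomology_class (d + i) BX BY (monomial_cochain X \<tau> d i c)"
  unfolding u_monomial_def cup_power_u_class monomial_cochain_def
  using cup_class [OF pullback_borel_to_space_cocycle [OF c] borel_power_cocycle]
    cohomology_map_class [OF continuous_map_borel_to_space borel_to_space_subset]
    cohomology_map_class [OF continuous_map_borel_to_BC, of "{}" "{}"]
  by (simp add: borel_power_def)

end

lemma borel_map_ident: "borel_map (\<lambda>x::'b. x) = (\<lambda>z. z)"
proof -
  have "map_prod id (\<lambda>x. x) ` z = z" for z :: "((nat \<Rightarrow> real) \<times> 'b) set"
    by force
  then show ?thesis
    by (simp add: fun_eq_iff borel_map_def)
qed

text \<open>Monomials are natural because the projections to \<open>BC\<close> and to the space are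
  both compatible with \<open>borel_map f\<close>.\<close>

lemma pullback_polynomial_cochain:
  assumes "borel_trivial Y \<tau>\<^sub>Y Y\<^sub>0" "borel_trivial X \<tau>\<^sub>X X\<^sub>0" "equivariant_map Y \<tau>\<^sub>Y Y\<^sub>0 X \<tau>\<^sub>X X\<^sub>0 f" and k: "k \<le> Suc n"
  shows "cochain_pullback n (borel_space Y \<tau>\<^sub>Y) (borel_map f) (polynomial_cochain X \<tau>\<^sub>X n k c)
    = polynomial_cochain Y \<tau>\<^sub>Y n k (\<lambda>i. cochain_pullback (n - i) Y f (c i))"
proof -
  interpret Y: borel_trivial Y \<tau>\<^sub>Y Y\<^sub>0 by fact
  interpret X: borel_trivial X \<tau>\<^sub>X X\<^sub>0 by fact
  interpret f: equivariant_map Y \<tau>\<^sub>Y Y\<^sub>0 X \<tau>\<^sub>X X\<^sub>0 f by fact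
  have f_in: "f y \<in> topspace X" if "y \<in> topspace Y" for y
    using f.continuous that by (auto simp: continuous_map_def Pi_iff)
  have "cochain_pullback d (borel_space Y \<tau>\<^sub>Y) (borel_map f) (cochain_pullback d (borel_space X \<tau>\<^sub>X) borel_to_space b)
      = cochain_pullback d (borel_space Y \<tau>\<^sub>Y) borel_to_space (cochain_pullback d Y f b)" for d b
  proof -
    have "cochain_pullback d (borel_space Y \<tau>\<^sub>Y) (borel_to_space \<circ> borel_map f) b
        = cochain_pullback d (borel_space Y \<tau>\<^sub>Y) (f \<circ> borel_to_space) b"
      by (rule cochain_pullback_cong)
         (auto simp: Y.topspace_BX f.borel_map_orbit X.borel_to_space_orbit Y.borel_to_space_orbit f_in)
    then show ?thesis
      by (simp add: cochain_pullback_compose [OF f.continuous_map_borel_map]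
          cochain_pullback_compose [OF Y.continuous_map_borel_to_space])
  qed
  then have mono: "cochain_pullback (d + i) (borel_space Y \<tau>\<^sub>Y) (borel_map f) (monomial_cochain X \<tau>\<^sub>X d i b)
      = monomial_cochain Y \<tau>\<^sub>Y d i (cochain_pullback d Y f b)" for d i b
    unfolding monomial_cochain_def cup_cochain_pullback [OF f.continuous_map_borel_map, symmetric]
    by (simp add: f.pullback_borel_power)
  show ?thesis
    unfolding polynomial_cochain_def cochain_pullback_sum
  proof (rule sum.cong)
    fix i assume "i \<in> {..<k}"
    then show "cochain_pullback n (borel_space Y \<tau>\<^sub>Y) (borel_map f) (monomial_cochain X \<tau>\<^sub>X (n - i) i (c i))
        = monomial_cochain Y \<tau>\<^sub>Y (n - i) i (cochain_pullback (n - i) Y f (c i))"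
      using mono [of "n - i" i "c i"] k by simp
  qed simp
qed

section \<open>Frames\<close>

lemma group_cohomology_group: "Group.group (cohomology_group p X S)"
  using comm_group_cohomology_group by (rule comm_group.axioms(2))

locale framed_pair = borel_pair +
  fixes \<kappa> \<sigma>
  assumes frame: "cohomology_frame X \<tau> Y \<kappa> \<sigma>"
begin

abbreviation "Z \<equiv> fixed_space X \<tau>"
abbreviation "W \<equiv> Y \<inter> fixed_set X \<tau>"
abbreviation "BZ \<equiv> borel_space Z \<tau>"
abbreviation "BW \<equiv> borel_subset \<tau> W"

lemma topspace_Z: "topspace Z = fixed_set X \<tau>"
  by (auto simp: fixed_space_def fixed_set_def)

lemma borel_trivial_fixed: "borel_trivial Z \<tau> W"
proof
  have "\<tau> x \<in> fixed_set X \<tau>" if "x \<in> fixed_set X \<tau>" for x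
    using that by (simp add: fixed_set_def)
  then have "continuous_map Z Z \<tau>"
    using inv_on by (auto simp: fixed_space_def involution_on_def continuous_map_in_subtopology
        continuous_map_from_subtopology)
  then show "involution_on Z \<tau>"
    by (simp add: involution_on_def topspace_Z) (simp add: fixed_set_def)
  show "W \<subseteq> topspace Z"
    by (simp add: topspace_Z)
  show "\<tau> ` W = W"
    by (force simp: fixed_set_def)
  show "\<tau> x = x" if "x \<in> topspace Z" for x
    using that by (simp add: topspace_Z fixed_set_def)
qed

sublocale fixed: borel_trivial Z \<tau> W
  by (rule borel_trivial_fixed)

lemma equivariant_map_fixed: "equivariant_map Z \<tau> W X \<tau> Y (\<lambda>x. x)"
proof -
  have "borel_pair X \<tau> Y" ..
  moreover have "borel_pair Z \<tau> W" ..
  ultimately show ?thesis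
    by (auto simp: equivariant_map_def equivariant_map_axioms_def fixed_space_def continuous_map_from_subtopology)
qed

definition restrict_cochain :: "nat \<Rightarrow> ((nat \<Rightarrow> real) \<times> 'a) set cochain \<Rightarrow> ((nat \<Rightarrow> real) \<times> 'a) set cochain" where
  "restrict_cochain n b = cochain_pullback n BZ (borel_map (\<lambda>x. x)) b"

lemma restrict_cochain_add: "restrict_cochain n (a + b) = restrict_cochain n a + restrict_cochain n b"
  by (simp add: restrict_cochain_def cochain_pullback_add)

lemma restrict_cochain_cocycle: "b \<in> cocycle_set n BX BY \<Longrightarrow> restrict_cochain n b \<in> cocycle_set n BZ BW"
  unfolding restrict_cochain_def
  by (rule cochain_pullback_cocycle [OF _ equivariant_map.continuous_map_borel_map [OF equivariant_map_fixed]
      equivariant_map.borel_map_subset [OF equivariant_map_fixed]])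

lemma restrict_cochain_coboundary: "b \<in> coboundary_set n BX BY \<Longrightarrow> restrict_cochain n b \<in> coboundary_set n BZ BW"
  unfolding restrict_cochain_def
  by (rule cochain_pullback_coboundary_set [OF _ equivariant_map.continuous_map_borel_map [OF equivariant_map_fixed]
      equivariant_map.borel_map_subset [OF equivariant_map_fixed]])

lemma restrict_cochain_cup:
  "restrict_cochain (Suc n) (cup_cochain n (Suc 0) BX b (borel_char X \<tau>))
    = cup_cochain n (Suc 0) BZ (restrict_cochain n b) (borel_char Z \<tau>)"
  unfolding restrict_cochain_def
  using cup_cochain_pullback [OF equivariant_map.continuous_map_borel_map [OF equivariant_map_fixed], of n "Suc 0" b "borel_char X \<tau>"]
  by (simp add: equivariant_map.pullback_borel_char [OF equivariant_map_fixed])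

lemma restrict_fixed_class:
  "restrict_fixed n X \<tau> Y (cohomology_class n BX BY b) = cohomology_class n BZ BW (restrict_cochain n b)"
  unfolding restrict_fixed_def equivariant_cohomology_map_def restrict_cochain_def
  by (rule cohomology_map_class [OF equivariant_map.continuous_map_borel_map [OF equivariant_map_fixed]
      equivariant_map.borel_map_subset [OF equivariant_map_fixed]])

text \<open>The frame conditions in terms of representatives. The conjugation equation becomes one
  polynomial with \<open>Suc m\<close> terms whose entry at index \<open>m\<close> is the cocycle
  \<open>k\<close> for \<open>\<kappa>\<close>; its degree \<open>2 * m - m\<close> is the right
  one.\<close>

lemma frame_cocycles:
  assumes a: "a \<in> cocycle_set (2 * m) X Y"
  obtains b k c where
    "b \<in> cocycle_set (2 * m) BX BY" "\<sigma> m (cohomology_class (2 * m) X Y a) = cohomology_class (2 * m) BX BY b"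
    "cochain_pullback (2 * m) X (fibre_inclusion \<tau>) b + a \<in> coboundary_set (2 * m) X Y"
    "k \<in> cocycle_set m Z W" "\<kappa> m (cohomology_class (2 * m) X Y a) = cohomology_class m Z W k"
    "\<forall>i<m. c i \<in> cocycle_set (2 * m - i) Z W"
    "restrict_cochain (2 * m) b + polynomial_cochain Z \<tau> (2 * m) (Suc m) (\<lambda>i. if i < m then c i else k)
      \<in> coboundary_set (2 * m) BZ BW"
proof -
  let ?A = "cohomology_class (2 * m) X Y a"
  have A: "?A \<in> carrier (cohomology_group (2 * m) X Y)"
    using a by simp
  have "\<sigma> m ?A \<in> carrier (equivariant_cohomology_group (2 * m) X \<tau> Y)"
    using frame A by (auto simp: cohomology_frame_def hom_def)
  then obtain b where b: "b \<in> cocycle_set (2 * m) BX BY" "\<sigma> m ?A = cohomology_class (2 * m) BX BY b"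
    by (auto simp: equivariant_cohomology_group_def carrier_cohomology_group)
  have "\<kappa> m ?A \<in> carrier (cohomology_group m Z W)"
    using frame A by (auto simp: cohomology_frame_def iso_def hom_def)
  then obtain k where k: "k \<in> cocycle_set m Z W" "\<kappa> m ?A = cohomology_class m Z W k"
    by (auto simp: carrier_cohomology_group)
  have "restrict_fibre (2 * m) X \<tau> Y (\<sigma> m ?A) = ?A"
    using frame A by (auto simp: cohomology_frame_def)
  moreover have "restrict_fibre (2 * m) X \<tau> Y = cohomology_map (2 * m) X Y (fibre_inclusion \<tau>)"
    by (simp add: restrict_fibre_def fibre_inclusion_def [abs_def])
  ultimately have \<rho>: "cochain_pullback (2 * m) X (fibre_inclusion \<tau>) b + a \<in> coboundary_set (2 * m) X Y"
    using cohomology_map_class [OF continuous_map_fibre_inclusion fibre_inclusion_subset, of "2 * m" b]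
    by (simp add: b(2) cohomology_class_eq_iff)
  let ?G = "cohomology_group (2 * m) BZ BW"
  have "conjugation_equation m X \<tau> Y (\<kappa> m ?A) (\<sigma> m ?A)"
    using frame A by (auto simp: cohomology_frame_def)
  then obtain C where C: "\<And>i. i < m \<Longrightarrow> C i \<in> carrier (cohomology_group (2 * m - i) Z W)"
    and eq: "cohomology_class (2 * m) BZ BW (restrict_cochain (2 * m) b)
      = u_monomial m m Z \<tau> W (cohomology_class m Z W k) \<otimes>\<^bsub>?G\<^esub>
        finprod ?G (\<lambda>i. u_monomial (2 * m - i) i Z \<tau> W (C i)) {..<m}"
    by (auto simp: conjugation_equation_def Let_def b(2) k(2) restrict_fixed_class equivariant_cohomology_group_def)
  have "\<exists>c. \<forall>i<m. c i \<in> cocycle_set (2 * m - i) Z W \<and> C i = cohomology_class (2 * m - i) Z W (c i)"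
    using C by (intro choice) (auto simp: carrier_cohomology_group image_iff)
  then obtain c where c: "\<And>i. i < m \<Longrightarrow> c i \<in> cocycle_set (2 * m - i) Z W"
    "\<And>i. i < m \<Longrightarrow> C i = cohomology_class (2 * m - i) Z W (c i)"
    by blast
  have mono: "monomial_cochain Z \<tau> (2 * m - i) i (c i) \<in> cocycle_set (2 * m) BZ BW"
    "u_monomial (2 * m - i) i Z \<tau> W (C i) = cohomology_class (2 * m) BZ BW (monomial_cochain Z \<tau> (2 * m - i) i (c i))"
    if "i < m" for i
    using fixed.monomial_cochain_cocycle [OF c(1) [OF that], of i] fixed.u_monomial_class [OF c(1) [OF that], of i] c(2) that
    by auto
  have top: "monomial_cochain Z \<tau> m m k \<in> cocycle_set (2 * m) BZ BW"
    "u_monomial m m Z \<tau> W (cohomology_class m Z W k) = cohomology_class (2 * m) BZ BW (monomial_cochain Z \<tau> m m k)"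
    using fixed.monomial_cochain_cocycle [OF k(1), of m] fixed.u_monomial_class [OF k(1), of m]
    by (simp_all add: mult_2)
  interpret G: comm_group ?G
    by (rule comm_group_cohomology_group)
  have sum: "(\<Sum>i<m. monomial_cochain Z \<tau> (2 * m - i) i (c i)) \<in> cocycle_set (2 * m) BZ BW"
    using mono by (intro cocycle_set_sum) auto
  have "finprod ?G (\<lambda>i. u_monomial (2 * m - i) i Z \<tau> W (C i)) {..<m}
      = finprod ?G (\<lambda>i. cohomology_class (2 * m) BZ BW (monomial_cochain Z \<tau> (2 * m - i) i (c i))) {..<m}"
    using mono by (intro G.finprod_cong') auto
  also have "\<dots> = cohomology_class (2 * m) BZ BW (\<Sum>i<m. monomial_cochain Z \<tau> (2 * m - i) i (c i))"
    using mono by (intro finprod_cohomology_class) auto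
  finally have "cohomology_class (2 * m) BZ BW (restrict_cochain (2 * m) b)
     = cohomology_class (2 * m) BZ BW (monomial_cochain Z \<tau> m m k + (\<Sum>i<m. monomial_cochain Z \<tau> (2 * m - i) i (c i)))"
    unfolding eq top(2) using cohomology_mult [OF top(1) sum] by simp
  moreover have "monomial_cochain Z \<tau> m m k + (\<Sum>i<m. monomial_cochain Z \<tau> (2 * m - i) i (c i))
     = polynomial_cochain Z \<tau> (2 * m) (Suc m) (\<lambda>i. if i < m then c i else k)"
    by (simp add: polynomial_cochain_def add.commute mult_2)
  ultimately have "restrict_cochain (2 * m) b + polynomial_cochain Z \<tau> (2 * m) (Suc m) (\<lambda>i. if i < m then c i else k)
      \<in> coboundary_set (2 * m) BZ BW"
    by (simp add: cohomology_class_eq_iff)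
  then show ?thesis
    using that b k \<rho> c(1) by blast
qed

lemma frame_section_coboundary:
  assumes "a \<in> coboundary_set (2 * m) X Y"
    and "\<sigma> m (cohomology_class (2 * m) X Y a) = cohomology_class (2 * m) BX BY b"
  shows "b \<in> coboundary_set (2 * m) BX BY"
proof -
  have "\<sigma> m \<in> hom (cohomology_group (2 * m) X Y) (cohomology_group (2 * m) BX BY)"
    using frame by (simp add: cohomology_frame_def equivariant_cohomology_group_def)
  then have "\<sigma> m \<one>\<^bsub>cohomology_group (2 * m) X Y\<^esub> = \<one>\<^bsub>cohomology_group (2 * m) BX BY\<^esub>"
    by (rule hom_one [OF _ group_cohomology_group group_cohomology_group])
  then show ?thesis
    using assms by (metis cohomology_class_eq_one_iff)
qed

lemma frame_iso_coboundary:
  assumes a: "a \<in> cocycle_set (2 * m) X Y"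
    and k: "\<kappa> m (cohomology_class (2 * m) X Y a) = cohomology_class m Z W k" "k \<in> coboundary_set m Z W"
  shows "a \<in> coboundary_set (2 * m) X Y"
proof -
  let ?G = "cohomology_group (2 * m) X Y" and ?H = "cohomology_group m Z W"
  have \<kappa>: "\<kappa> m \<in> hom ?G ?H" "inj_on (\<kappa> m) (carrier ?G)"
    using frame by (auto simp: cohomology_frame_def iso_def bij_betw_def)
  have "\<kappa> m \<one>\<^bsub>?G\<^esub> = \<one>\<^bsub>?H\<^esub>"
    using \<kappa>(1) by (rule hom_one [OF _ group_cohomology_group group_cohomology_group])
  then have "\<kappa> m (cohomology_class (2 * m) X Y a) = \<kappa> m \<one>\<^bsub>?G\<^esub>"
    using k by (metis cohomology_class_eq_one_iff)
  moreover have "\<one>\<^bsub>?G\<^esub> \<in> carrier ?G"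
    by (simp add: cohomology_one)
  ultimately have "cohomology_class (2 * m) X Y a = \<one>\<^bsub>?G\<^esub>"
    using \<kappa>(2) a by (auto dest: inj_onD)
  then show ?thesis
    by (simp add: cohomology_class_eq_one_iff)
qed

text \<open>
  Only \<open>u\<^sup>i\<close> with \<open>i < k\<close> occur, so \<open>2 * k \<le> Suc n\<close> bounds the \<open>u\<close>-degree by less than \<open>n / 2\<close>.
\<close>

definition small_restriction_vanishes :: "nat \<Rightarrow> bool" where
  "small_restriction_vanishes n \<longleftrightarrow> (\<forall>b k c. b \<in> cocycle_set n BX BY \<longrightarrow> 2 * k \<le> Suc n \<longrightarrow>
     (\<forall>i<k. c i \<in> cocycle_set (n - i) Z W) \<longrightarrow>
     restrict_cochain n b + polynomial_cochain Z \<tau> n k c \<in> coboundary_set n BZ BW \<longrightarrow>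
     b \<in> coboundary_set n BX BY)"

lemma small_restriction_vanishesD:
  assumes "small_restriction_vanishes n" "b \<in> cocycle_set n BX BY" "2 * k \<le> Suc n"
    "\<And>i. i < k \<Longrightarrow> c i \<in> cocycle_set (n - i) Z W"
    "restrict_cochain n b + polynomial_cochain Z \<tau> n k c \<in> coboundary_set n BZ BW"
  shows "b \<in> coboundary_set n BX BY"
  using assms(2-) assms(1) [unfolded small_restriction_vanishes_def, rule_format, of b k c] by simp

text \<open>The bound on \<open>2 * k\<close> is larger by one than in
  \<open>small_restriction_vanishes\<close>: division by \<open>u\<close> lowers \<open>n\<close>
  and \<open>k\<close> by one each, and \<open>2 * k \<le> Suc (Suc n)\<close> becomes exactly the
  bound needed for the quotient. In degree \<open>2 * m\<close> this admits the power
  \<open>u^m\<close> of the conjugation equation.\<close>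

lemma fibre_kernel_vanishes:
  assumes IH: "\<And>n'. n = Suc n' \<Longrightarrow> small_restriction_vanishes n'"
    and b: "b \<in> cocycle_set n BX BY" and \<rho>: "cochain_pullback n X (fibre_inclusion \<tau>) b \<in> coboundary_set n X Y"
    and k: "k \<le> Suc n" "2 * k \<le> Suc (Suc n)" and c: "\<And>i. i < k \<Longrightarrow> c i \<in> cocycle_set (n - i) Z W"
    and r: "restrict_cochain n b + polynomial_cochain Z \<tau> n k c \<in> coboundary_set n BZ BW"
  shows "b \<in> coboundary_set n BX BY"
proof (cases n)
  case 0
  then have "b = 0"
    using kernel_fibre_0 b \<rho> by blast
  then show ?thesis by simp
next
  case (Suc n')
  let ?u = "borel_char X \<tau>" and ?v = "borel_char Z \<tau>"
  obtain b' where b': "b' \<in> cocycle_set n' BX BY"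
    and bb': "b + cup_cochain n' (Suc 0) BX b' ?u \<in> coboundary_set n BX BY"
    using kernel_fibre_Suc b \<rho> unfolding Suc by metis
  have r': "restrict_cochain n' b' \<in> cocycle_set n' BZ BW"
    using b' by (rule restrict_cochain_cocycle)
  have "restrict_cochain n b + cup_cochain n' (Suc 0) BZ (restrict_cochain n' b') ?v \<in> coboundary_set n BZ BW"
    using restrict_cochain_coboundary [OF bb'] by (simp add: restrict_cochain_add Suc restrict_cochain_cup)
  from coboundary_set_add [OF this r]
  have d: "cup_cochain n' (Suc 0) BZ (restrict_cochain n' b') ?v + polynomial_cochain Z \<tau> n k c \<in> coboundary_set n BZ BW"
    by (simp add: ac_simps)
  have "b' \<in> coboundary_set n' BX BY"
  proof (cases k)
    \<comment> \<open>Without terms there is no constant coefficient to split off; injectivity of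
      multiplication by \<open>u\<close> suffices.\<close>
    case 0
    then have "restrict_cochain n' b' \<in> coboundary_set n' BZ BW"
      using d fixed.cup_borel_char_inject [OF r'] by (simp add: polynomial_cochain_def Suc)
    then have "restrict_cochain n' b' + polynomial_cochain Z \<tau> n' 0 c \<in> coboundary_set n' BZ BW"
      by (simp add: polynomial_cochain_def)
    then show ?thesis
      by (intro small_restriction_vanishesD [OF IH [OF Suc] b', of 0 c]) auto
  next
    case k': (Suc k')
    have c': "c (Suc i) \<in> cocycle_set (n' - i) Z W" if "i < k'" for i
      using c [of "Suc i"] that by (simp add: k' Suc)
    have "restrict_cochain n' b' + polynomial_cochain Z \<tau> n' k' (\<lambda>i. c (Suc i)) \<in> coboundary_set n' BZ BW"
      using k c d r' unfolding k' Suc by (intro fixed.polynomial_divide) auto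
    moreover have "2 * k' \<le> Suc n'"
      using k by (simp add: k' Suc)
    ultimately show ?thesis
      using c' by (intro small_restriction_vanishesD [OF IH [OF Suc] b', of k' "\<lambda>i. c (Suc i)"])
  qed
  from coboundary_set_add [OF bb' cup_borel_char_coboundary [OF this, folded Suc]] show ?thesis
    by (simp add: add.assoc)
qed

lemma small_restriction_vanishes:
  assumes odd: "\<And>n. odd n \<Longrightarrow> cocycle_set n X Y \<subseteq> coboundary_set n X Y"
  shows "small_restriction_vanishes n"
proof -
  have step: "small_restriction_vanishes n" if IH: "\<And>n'. n = Suc n' \<Longrightarrow> small_restriction_vanishes n'" for n
    unfolding small_restriction_vanishes_def
  proof (intro allI impI)
    fix b k c
    assume b: "b \<in> cocycle_set n BX BY" and k: "2 * k \<le> Suc n" and c: "\<forall>i<k. c i \<in> cocycle_set (n - i) Z W"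
      and r: "restrict_cochain n b + polynomial_cochain Z \<tau> n k c \<in> coboundary_set n BZ BW"
    let ?\<rho> = "cochain_pullback n X (fibre_inclusion \<tau>)"
    have \<rho>b: "?\<rho> b \<in> cocycle_set n X Y"
      using b by (rule cochain_pullback_cocycle [OF _ continuous_map_fibre_inclusion fibre_inclusion_subset])
    show "b \<in> coboundary_set n BX BY"
    proof (cases "odd n")
      \<comment> \<open>Odd cohomology of the pair vanishes, so \<open>b\<close> is in the kernel of
        \<rho> without correction by a section.\<close>
      case True
      then have \<rho>0: "?\<rho> b \<in> coboundary_set n X Y"
        using odd \<rho>b by blast
      show ?thesis
      proof (rule fibre_kernel_vanishes [OF _ b _ _ _ _ r])
        show "small_restriction_vanishes n'" if "n = Suc n'" for n'
          using that by (rule IH)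
      qed (use \<rho>0 k c in auto)
    next
      case False
      then obtain m where n: "n = 2 * m" by auto
      then have km: "k \<le> m" using k by simp
      obtain s l C where s: "s \<in> cocycle_set n BX BY"
          "\<sigma> m (cohomology_class n X Y (?\<rho> b)) = cohomology_class n BX BY s"
        and \<rho>s: "?\<rho> s + ?\<rho> b \<in> coboundary_set n X Y"
        and l: "l \<in> cocycle_set m Z W" "\<kappa> m (cohomology_class n X Y (?\<rho> b)) = cohomology_class m Z W l"
        and C: "\<forall>i<m. C i \<in> cocycle_set (n - i) Z W"
        and rs: "restrict_cochain n s + polynomial_cochain Z \<tau> n (Suc m) (\<lambda>i. if i < m then C i else l)
          \<in> coboundary_set n BZ BW"
        by (rule frame_cocycles [of "?\<rho> b" m, folded n, OF \<rho>b])
      \<comment> \<open>Coefficients of the restriction of \<open>b + s\<close>. As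
        \<open>k \<le> m\<close>, the first summand does not reach index \<open>m\<close>, where the
        entry is \<open>l\<close>, representing \<open>\<kappa>\<close> of the fibre class.\<close>
      define d where "d i = (if i < k then c i else 0) + (if i < m then C i else l)" for i
      have d: "d i \<in> cocycle_set (n - i) Z W" if "i < Suc m" for i
        unfolding d_def using c C l(1) that
        by (intro cocycle_set_add) (auto simp: n mult_2 less_Suc_eq)
      have "polynomial_cochain Z \<tau> n (Suc m) d = polynomial_cochain Z \<tau> n k c
          + polynomial_cochain Z \<tau> n (Suc m) (\<lambda>i. if i < m then C i else l)"
        unfolding d_def polynomial_cochain_add using km by (simp add: polynomial_cochain_extend)
      then have rd: "restrict_cochain n (b + s) + polynomial_cochain Z \<tau> n (Suc m) d \<in> coboundary_set n BZ BW"
        using coboundary_set_add [OF r rs] by (simp add: restrict_cochain_add ac_simps)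
      have \<rho>0: "?\<rho> (b + s) \<in> coboundary_set n X Y"
        using \<rho>s by (simp add: cochain_pullback_add add.commute)
      have bs: "b + s \<in> coboundary_set n BX BY"
      proof (rule fibre_kernel_vanishes [OF _ cocycle_set_add [OF b s(1)] _ _ _ d rd])
        show "small_restriction_vanishes n'" if "n = Suc n'" for n'
          using that by (rule IH)
      qed (use \<rho>0 in \<open>simp_all add: n\<close>)
      have "polynomial_cochain Z \<tau> n (Suc m) d \<in> coboundary_set n BZ BW"
        using coboundary_set_add [OF restrict_cochain_coboundary [OF bs] rd] by simp
      then have "d m \<in> coboundary_set (n - m) Z W"
        using d by (intro fixed.polynomial_leading_coefficient) (auto simp: n)
      \<comment> \<open>So \<open>\<kappa>\<close> of the fibre class is 0, and by injectivity the
        class itself; hence its section \<open>s\<close> is a coboundary, and with it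
        \<open>b\<close>.\<close>
      then have "l \<in> coboundary_set m Z W"
        using km by (simp add: d_def n mult_2)
      then have "?\<rho> b \<in> coboundary_set n X Y"
        using frame_iso_coboundary [of "?\<rho> b" m l] \<rho>b l(2) by (simp add: n)
      then have "s \<in> coboundary_set n BX BY"
        using frame_section_coboundary [of "?\<rho> b" m s] s(2) by (simp add: n)
      from coboundary_set_add [OF bs this] show ?thesis
        by (simp add: add.assoc)
    qed
  qed
  show ?thesis
    by (induction n) (auto intro: step)
qed

end

lemma conjugation_pair_odd:
  assumes "conjugation_pair X \<tau> Y" "odd n"
  shows "cocycle_set n X Y \<subseteq> coboundary_set n X Y"
proof
  fix \<phi> assume "\<phi> \<in> cocycle_set n X Y"
  moreover have "carrier (cohomology_group n X Y) = {\<one>\<^bsub>cohomology_group n X Y\<^esub>}"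
    using assms by (auto simp: conjugation_pair_def trivial_group_def)
  ultimately have "cohomology_class n X Y \<phi> = \<one>\<^bsub>cohomology_group n X Y\<^esub>"
    using cohomology_class_in by fastforce
  then show "\<phi> \<in> coboundary_set n X Y"
    by (simp add: cohomology_class_eq_one_iff)
qed

lemma conjugation_pair_framed_pair:
  assumes "conjugation_pair X \<tau> Y" "cohomology_frame X \<tau> Y \<kappa> \<sigma>"
  shows "framed_pair X \<tau> Y \<kappa> \<sigma>"
proof unfold_locales
  show "involution_on X \<tau>" "Y \<subseteq> topspace X" "\<tau> ` Y = Y"
    using assms(1) unfolding conjugation_pair_def by blast+
qed (rule assms(2))

section \<open>Naturality of the frames\<close>

theorem proposition3p11:
  fixes X :: "'a topology" and \<tau>\<^sub>X :: "'a \<Rightarrow> 'a" and X\<^sub>0 :: "'a set"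
    and Y :: "'b topology" and \<tau>\<^sub>Y :: "'b \<Rightarrow> 'b" and Y\<^sub>0 :: "'b set"
    and f :: "'b \<Rightarrow> 'a"
  assumes "conjugation_pair X \<tau>\<^sub>X X\<^sub>0" and "cohomology_frame X \<tau>\<^sub>X X\<^sub>0 \<kappa>\<^sub>X \<sigma>\<^sub>X"
    and "conjugation_pair Y \<tau>\<^sub>Y Y\<^sub>0" and "cohomology_frame Y \<tau>\<^sub>Y Y\<^sub>0 \<kappa>\<^sub>Y \<sigma>\<^sub>Y"
    and "continuous_map Y X f" and "f ` Y\<^sub>0 \<subseteq> X\<^sub>0"
    and "\<And>y. y \<in> topspace Y \<Longrightarrow> f (\<tau>\<^sub>Y y) = \<tau>\<^sub>X (f y)"
  shows "(\<forall>m. \<forall>a\<in>carrier (cohomology_group (2 * m) X X\<^sub>0).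
            equivariant_cohomology_map (2 * m) Y \<tau>\<^sub>Y Y\<^sub>0 f (\<sigma>\<^sub>X m a) =
              \<sigma>\<^sub>Y m (cohomology_map (2 * m) Y Y\<^sub>0 f a)) \<and>
         (\<forall>m. \<forall>a\<in>carrier (cohomology_group (2 * m) X X\<^sub>0).
            cohomology_map m (fixed_space Y \<tau>\<^sub>Y) (Y\<^sub>0 \<inter> fixed_set Y \<tau>\<^sub>Y) f (\<kappa>\<^sub>X m a) =
              \<kappa>\<^sub>Y m (cohomology_map (2 * m) Y Y\<^sub>0 f a))"
proof -
  interpret X: framed_pair X \<tau>\<^sub>X X\<^sub>0 \<kappa>\<^sub>X \<sigma>\<^sub>X
    using assms(1,2) by (rule conjugation_pair_framed_pair)
  interpret Y: framed_pair Y \<tau>\<^sub>Y Y\<^sub>0 \<kappa>\<^sub>Y \<sigma>\<^sub>Y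
    using assms(3,4) by (rule conjugation_pair_framed_pair)
  interpret f: equivariant_map Y \<tau>\<^sub>Y Y\<^sub>0 X \<tau>\<^sub>X X\<^sub>0 f
    using assms(5-7) by unfold_locales auto
  have fix_in: "f y \<in> fixed_set X \<tau>\<^sub>X" if "y \<in> fixed_set Y \<tau>\<^sub>Y" for y
  proof -
    have y: "y \<in> topspace Y" "\<tau>\<^sub>Y y = y"
      using that by (simp_all add: fixed_set_def)
    then have "f y \<in> topspace X"
      using assms(5) by (auto simp: continuous_map_def)
    then show ?thesis
      using f.equivariant [OF y(1)] y(2) by (simp add: fixed_set_def)
  qed
  have f\<tau>: "equivariant_map Y.Z \<tau>\<^sub>Y Y.W X.Z \<tau>\<^sub>X X.W f"
  proof -
    have "continuous_map Y.Z X.Z f"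
      using assms(5) fix_in
      by (auto simp: fixed_space_def continuous_map_in_subtopology continuous_map_from_subtopology)
    moreover have "f ` Y.W \<subseteq> X.W"
      using assms(6) fix_in by blast
    moreover have "f (\<tau>\<^sub>Y y) = \<tau>\<^sub>X (f y)" if "y \<in> topspace Y.Z" for y
    proof (rule assms(7))
      show "y \<in> topspace Y"
        using that by (simp add: Y.topspace_Z fixed_set_def)
    qed
    ultimately show ?thesis
      using Y.fixed.borel_pair_axioms X.fixed.borel_pair_axioms
      by (simp add: equivariant_map_def equivariant_map_axioms_def)
  qed
  interpret f\<tau>: equivariant_map Y.Z \<tau>\<^sub>Y Y.W X.Z \<tau>\<^sub>X X.W f
    by (rule f\<tau>)
  have "equivariant_cohomology_map (2 * m) Y \<tau>\<^sub>Y Y\<^sub>0 f (\<sigma>\<^sub>X m A) = \<sigma>\<^sub>Y m (cohomology_map (2 * m) Y Y\<^sub>0 f A) \<and>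
      cohomology_map m Y.Z Y.W f (\<kappa>\<^sub>X m A) = \<kappa>\<^sub>Y m (cohomology_map (2 * m) Y Y\<^sub>0 f A)"
    if A: "A \<in> carrier (cohomology_group (2 * m) X X\<^sub>0)" for m A
  proof -
    define n where "n = 2 * m"
    obtain a where a: "a \<in> cocycle_set n X X\<^sub>0" and A_eq: "A = cohomology_class n X X\<^sub>0 a"
      using A by (auto simp: carrier_cohomology_group n_def)
    obtain s l C where s: "s \<in> cocycle_set n X.BX X.BY" "\<sigma>\<^sub>X m A = cohomology_class n X.BX X.BY s"
      and \<rho>s: "cochain_pullback n X (fibre_inclusion \<tau>\<^sub>X) s + a \<in> coboundary_set n X X\<^sub>0"
      and l: "l \<in> cocycle_set m X.Z X.W" "\<kappa>\<^sub>X m A = cohomology_class m X.Z X.W l"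
      and C: "\<forall>i<m. C i \<in> cocycle_set (n - i) X.Z X.W"
      and rs: "X.restrict_cochain n s + polynomial_cochain X.Z \<tau>\<^sub>X n (Suc m) (\<lambda>i. if i < m then C i else l)
        \<in> coboundary_set n X.BZ X.BW"
      by (rule X.frame_cocycles [of a m, folded n_def, OF a, folded A_eq])
    let ?fa = "cochain_pullback n Y f a"
    have fa: "?fa \<in> cocycle_set n Y Y\<^sub>0"
      using a assms(5) f.map_subset' by (rule cochain_pullback_cocycle)
    have fA: "cohomology_map n Y Y\<^sub>0 f A = cohomology_class n Y Y\<^sub>0 ?fa"
      unfolding A_eq using assms(5) f.map_subset' by (rule cohomology_map_class)
    obtain s' l' C' where s': "s' \<in> cocycle_set n Y.BX Y.BY"
        "\<sigma>\<^sub>Y m (cohomology_class n Y Y\<^sub>0 ?fa) = cohomology_class n Y.BX Y.BY s'"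
      and \<rho>s': "cochain_pullback n Y (fibre_inclusion \<tau>\<^sub>Y) s' + ?fa \<in> coboundary_set n Y Y\<^sub>0"
      and l': "l' \<in> cocycle_set m Y.Z Y.W" "\<kappa>\<^sub>Y m (cohomology_class n Y Y\<^sub>0 ?fa) = cohomology_class m Y.Z Y.W l'"
      and C': "\<forall>i<m. C' i \<in> cocycle_set (n - i) Y.Z Y.W"
      and rs': "Y.restrict_cochain n s' + polynomial_cochain Y.Z \<tau>\<^sub>Y n (Suc m) (\<lambda>i. if i < m then C' i else l')
        \<in> coboundary_set n Y.BZ Y.BW"
      by (rule Y.frame_cocycles [of ?fa m, folded n_def, OF fa])
    let ?fs = "cochain_pullback n Y.BX (borel_map f) s"
    have fs: "?fs \<in> cocycle_set n Y.BX Y.BY"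
      using s(1) f.continuous_map_borel_map f.borel_map_subset by (rule cochain_pullback_cocycle)
    have "cochain_pullback n Y f (cochain_pullback n X (fibre_inclusion \<tau>\<^sub>X) s + a) \<in> coboundary_set n Y Y\<^sub>0"
      using \<rho>s assms(5) f.map_subset' by (rule cochain_pullback_coboundary_set)
    then have "cochain_pullback n Y (fibre_inclusion \<tau>\<^sub>Y) ?fs + ?fa \<in> coboundary_set n Y Y\<^sub>0"
      by (simp add: cochain_pullback_add f.pullback_fibre_borel_map)
    from coboundary_set_add [OF this \<rho>s']
    have \<rho>D: "cochain_pullback n Y (fibre_inclusion \<tau>\<^sub>Y) (?fs + s') \<in> coboundary_set n Y Y\<^sub>0"
      by (simp add: cochain_pullback_add ac_simps)
    \<comment> \<open>Coefficients of the difference between the pulled back conjugation equation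
      for \<open>X\<close> and the one for \<open>Y\<close>; index \<open>m\<close> carries the
      difference of the two sides of the second claim.\<close>
    define d where "d i = cochain_pullback (n - i) Y.Z f (if i < m then C i else l) + (if i < m then C' i else l')" for i
    have d: "d i \<in> cocycle_set (n - i) Y.Z Y.W" if "i < Suc m" for i
    proof -
      have "(if i < m then C i else l) \<in> cocycle_set (n - i) X.Z X.W" "(if i < m then C' i else l') \<in> cocycle_set (n - i) Y.Z Y.W"
        using C C' l(1) l'(1) that by (auto simp: n_def mult_2 less_Suc_eq)
      then show ?thesis
        unfolding d_def by (intro cocycle_set_add cochain_pullback_cocycle [OF _ f\<tau>.continuous f\<tau>.map_subset'])
    qed
    have m_le: "m \<le> n"
      by (simp add: n_def)
    \<comment> \<open>Restriction to fixed points commutes with \<open>f\<close>: both composites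
      are given by \<open>borel_map f\<close> on the Borel construction of the fixed points of
      \<open>Y\<close>.\<close>
    have rfs: "Y.restrict_cochain n ?fs = cochain_pullback n Y.BZ (borel_map f) (X.restrict_cochain n s)"
      using cochain_pullback_compose [OF f\<tau>.continuous_map_borel_map, of n "borel_map (\<lambda>x. x)" s]
        cochain_pullback_compose [OF equivariant_map.continuous_map_borel_map [OF Y.equivariant_map_fixed], of n "borel_map f" s]
      by (simp add: Y.restrict_cochain_def X.restrict_cochain_def borel_map_ident o_def)
    have "cochain_pullback n Y.BZ (borel_map f)
        (X.restrict_cochain n s + polynomial_cochain X.Z \<tau>\<^sub>X n (Suc m) (\<lambda>i. if i < m then C i else l)) \<in> coboundary_set n Y.BZ Y.BW"
      using rs f\<tau>.continuous_map_borel_map f\<tau>.borel_map_subset by (rule cochain_pullback_coboundary_set)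
    then have "Y.restrict_cochain n ?fs
        + polynomial_cochain Y.Z \<tau>\<^sub>Y n (Suc m) (\<lambda>i. cochain_pullback (n - i) Y.Z f (if i < m then C i else l))
      \<in> coboundary_set n Y.BZ Y.BW"
      using pullback_polynomial_cochain [OF Y.borel_trivial_fixed X.borel_trivial_fixed f\<tau>, of "Suc m" n]
      by (simp add: cochain_pullback_add rfs m_le)
    from coboundary_set_add [OF this rs']
    have rD: "Y.restrict_cochain n (?fs + s') + polynomial_cochain Y.Z \<tau>\<^sub>Y n (Suc m) d \<in> coboundary_set n Y.BZ Y.BW"
      unfolding d_def polynomial_cochain_add by (simp add: Y.restrict_cochain_add ac_simps)
    \<comment> \<open>Since \<open>n = 2 * m\<close>, the \<open>Suc m\<close> terms of
      \<open>d\<close> just meet the bound \<open>2 * Suc m \<le> Suc (Suc n)\<close>; the vanishing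
      result is invoked for \<open>Y\<close>, where the difference lives.\<close>
    have D: "?fs + s' \<in> coboundary_set n Y.BX Y.BY"
      by (rule Y.fibre_kernel_vanishes [OF Y.small_restriction_vanishes [OF conjugation_pair_odd [OF assms(3)]]
          cocycle_set_add [OF fs s'(1)] \<rho>D _ _ d rD]) (simp_all add: n_def)
    have "polynomial_cochain Y.Z \<tau>\<^sub>Y n (Suc m) d \<in> coboundary_set n Y.BZ Y.BW"
      using coboundary_set_add [OF Y.restrict_cochain_coboundary [OF D] rD] by simp
    then have "d m \<in> coboundary_set (n - m) Y.Z Y.W"
      using d by (intro Y.fixed.polynomial_leading_coefficient) (auto simp: n_def)
    then have dm: "cochain_pullback m Y.Z f l + l' \<in> coboundary_set m Y.Z Y.W"
      by (simp add: d_def n_def mult_2)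
    have "equivariant_cohomology_map n Y \<tau>\<^sub>Y Y\<^sub>0 f (\<sigma>\<^sub>X m A) = \<sigma>\<^sub>Y m (cohomology_map n Y Y\<^sub>0 f A)"
      unfolding equivariant_cohomology_map_def s(2) fA s'(2)
      using D by (simp add: cohomology_map_class [OF f.continuous_map_borel_map f.borel_map_subset] cohomology_class_eq_iff)
    moreover have "cohomology_map m Y.Z Y.W f (\<kappa>\<^sub>X m A) = \<kappa>\<^sub>Y m (cohomology_map n Y Y\<^sub>0 f A)"
      unfolding l(2) fA l'(2)
      using dm by (simp add: cohomology_map_class [OF f\<tau>.continuous f\<tau>.map_subset'] cohomology_class_eq_iff)
    ultimately show ?thesis
      by (simp add: n_def)
  qed
  then show ?thesis by blast
qed

end
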